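(* For all $n\ge6$ there are $\gamma\in(0,\pi)$ such that the fundamental solution $F_{n,\gamma}$ of $$L_\gamma=(\Delta')^2+2\cos\gamma\ \Delta'\left(\tfrac{\partial}{\partial x_n}\right)^2+\left(\tfrac{\partial}{\partial x_n}\right)^4,\qquad \Delta'=\sum_{i=1}^{n-1}\frac{\partial^2}{\partial x_i^2},$$ on $\mathbb{R}^n$ satisfies $F_{n,\gamma}(0,\dots,0,x_n)<0$ for $x_n\neq0$.
   Context: $F_{n,\gamma}$ denotes the fundamental solution of $L_\gamma$ on $\mathbb{R}^n$ with pole $0$, i.e. $L_\gamma F_{n,\gamma}=\delta_0$ in the sense of distributions, given by $F_{n,\gamma}=(2\pi)^{-n/2}\mathcal{F}^{-1}(1/Q_\gamma)$ as a tempered distribution, where $Q_\gamma(\xi',\xi_n)=|\xi'|^4+2\cos\gamma\,|\xi'|^2\xi_n^2+\xi_n^4$ for $(\xi',\xi_n)\in\mathbb{R}^{n-1}\times\mathbb{R}$ and $\mathcal{F}u(\xi)=(2\pi)^{-n/2}\int_{\mathbb{R}^n}e^{-ix\cdot\xi}u(x)\,dx$. It is a regular distribution, i.e. a function, which is $C^\infty$ on $\mathbb{R}^n\setminus\{0\}$ and homogeneous of degree $4-n$ (and it is the unique fundamental solution of $L_\gamma$ with this homogeneity). *)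

theory Defs
  imports "HOL-Analysis.Analysis"
begin

section \<open>Smooth functions, test functions, Schwartz functions\<close>

definition partial_deriv :: "'a::euclidean_space \<Rightarrow> ('a \<Rightarrow> complex) \<Rightarrow> 'a \<Rightarrow> complex" where
  "partial_deriv v f x = frechet_derivative f (at x) v"

text \<open>The list \<open>vs\<close> of coordinate directions plays the role of a multi-index.\<close>

fun iter_partial :: "'a::euclidean_space list \<Rightarrow> ('a \<Rightarrow> complex) \<Rightarrow> 'a \<Rightarrow> complex" where
  "iter_partial [] f = f"
| "iter_partial (v # vs) f = partial_deriv v (iter_partial vs f)"

definition smooth :: "('a::euclidean_space \<Rightarrow> complex) \<Rightarrow> bool" where
  "smooth f \<longleftrightarrow> (\<forall>vs \<in> lists Basis. \<forall>x. iter_partial vs f differentiable (at x))"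

definition test_function :: "('a::euclidean_space \<Rightarrow> complex) \<Rightarrow> bool" where
  "test_function f \<longleftrightarrow> smooth f \<and> (\<exists>K. compact K \<and> (\<forall>x. x \<notin> K \<longrightarrow> f x = 0))"

definition schwartz :: "('a::euclidean_space \<Rightarrow> complex) \<Rightarrow> bool" where
  "schwartz f \<longleftrightarrow> smooth f \<and>
     (\<forall>vs \<in> lists Basis. \<forall>k::nat. \<exists>C. \<forall>x. norm x ^ k * cmod (iter_partial vs f x) \<le> C)"


section \<open>Regular distributions and the inverse Fourier transform\<close>

definition locally_integrable :: "('a::euclidean_space \<Rightarrow> real) \<Rightarrow> bool" where
  "locally_integrable u \<longleftrightarrow> (\<forall>K. compact K \<longrightarrow> set_integrable lborel K u)"

definition regular_distr :: "('a::euclidean_space \<Rightarrow> real) \<Rightarrow> ('a \<Rightarrow> complex) \<Rightarrow> complex" where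
  "regular_distr u \<phi> = (LINT x|lborel. complex_of_real (u x) * \<phi> x)"

text \<open>The inverse of the unitary transform
  \<open>(2 pi)^(-n/2) * (integral of exp (-i x \<bullet> \<xi>) * u x dx)\<close>, where \<open>n = DIM('a)\<close>.\<close>

definition inv_fourier :: "('a::euclidean_space \<Rightarrow> complex) \<Rightarrow> 'a \<Rightarrow> complex" where
  "inv_fourier \<phi> x = complex_of_real ((2 * pi) powr (- real DIM('a) / 2)) *
     (LINT \<xi>|lborel. exp (\<i> * complex_of_real (x \<bullet> \<xi>)) * \<phi> \<xi>)"

definition inv_fourier_distr ::
    "(('a::euclidean_space \<Rightarrow> complex) \<Rightarrow> complex) \<Rightarrow> ('a \<Rightarrow> complex) \<Rightarrow> complex" where
  "inv_fourier_distr T \<phi> = T (inv_fourier \<phi>)"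


section \<open>The operator and its fundamental solution\<close>

text \<open>The space \<open>\<real>^n\<close> is \<open>(real ^ 'm) \<times> real\<close> with \<open>n = CARD('m) + 1\<close>; a point is
  \<open>(x', x_n)\<close>, and the Euclidean structure is that of the product.\<close>

definition d_last :: "((real ^ 'm::finite) \<times> real \<Rightarrow> complex) \<Rightarrow> (real ^ 'm) \<times> real \<Rightarrow> complex" where
  "d_last f = partial_deriv (0, 1) f"

definition laplace' :: "((real ^ 'm::finite) \<times> real \<Rightarrow> complex) \<Rightarrow> (real ^ 'm) \<times> real \<Rightarrow> complex" where
  "laplace' f x = (\<Sum>i\<in>UNIV. partial_deriv (axis i 1, 0) (partial_deriv (axis i 1, 0) f) x)"

definition L_op ::
    "real \<Rightarrow> ((real ^ 'm::finite) \<times> real \<Rightarrow> complex) \<Rightarrow> (real ^ 'm) \<times> real \<Rightarrow> complex" where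
  "L_op \<gamma> f x = laplace' (laplace' f) x
     + complex_of_real (2 * cos \<gamma>) * laplace' (d_last (d_last f)) x
     + d_last (d_last (d_last (d_last f))) x"

definition Q_symbol :: "real \<Rightarrow> (real ^ 'm::finite) \<times> real \<Rightarrow> real" where
  "Q_symbol \<gamma> = (\<lambda>(\<xi>', t). norm \<xi>' ^ 4 + 2 * cos \<gamma> * (norm \<xi>')\<^sup>2 * t\<^sup>2 + t ^ 4)"

text \<open>\<open>L_\<gamma> F = \<delta>_0\<close> in the sense of distributions. All terms of \<open>L_\<gamma>\<close> have even order and
  real constant coefficients, so \<open>L_\<gamma>\<close> is its own formal transpose.\<close>

definition is_fundamental_solution :: "real \<Rightarrow> ((real ^ 'm::finite) \<times> real \<Rightarrow> real) \<Rightarrow> bool" where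
  "is_fundamental_solution \<gamma> F \<longleftrightarrow> locally_integrable F \<and>
     (\<forall>\<phi>. test_function \<phi> \<longrightarrow> regular_distr F (L_op \<gamma> \<phi>) = \<phi> 0)"

text \<open>\<open>F = (2 pi)^(-n/2) * (inverse Fourier transform of 1/Q_\<gamma>)\<close> as tempered distributions.\<close>

definition is_inv_fourier_symbol :: "real \<Rightarrow> ((real ^ 'm::finite) \<times> real \<Rightarrow> real) \<Rightarrow> bool" where
  "is_inv_fourier_symbol \<gamma> F \<longleftrightarrow>
     (\<forall>\<phi>. schwartz \<phi> \<longrightarrow>
        integrable lborel (\<lambda>x. complex_of_real (F x) * \<phi> x) \<and>
        regular_distr F \<phi> =
          complex_of_real ((2 * pi) powr (- real DIM((real ^ 'm) \<times> real) / 2)) *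
          inv_fourier_distr (regular_distr (\<lambda>\<xi>. 1 / Q_symbol \<gamma> \<xi>)) \<phi>)"

text \<open>Pointwise values refer to the representative that is continuous off the pole, which is
  unique off the pole. The value at the pole is irrelevant; it is set to \<open>0\<close> only so that
  the description is definite.\<close>

definition fundamental_solution :: "real \<Rightarrow> (real ^ 'm::finite) \<times> real \<Rightarrow> real" where
  "fundamental_solution \<gamma> = (THE F.
     is_fundamental_solution \<gamma> F \<and> is_inv_fourier_symbol \<gamma> F \<and>
     continuous_on (- {0}) F \<and> F 0 = 0)"

end

theory Submission
  imports Defs "HOL-Probability.Probability" "HOL-Real_Asymp.Real_Asymp"
begin

text \<open>
  Put \<open>A = |\<xi>'|^2\<close> and \<open>B = \<xi>_n^2\<close>, so that \<open>Q_\<gamma> = A^2 + 2 cos \<gamma> A B + B^2\<close>. Since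
  \<open>sin t / ((A + B) (e^(it) A + e^(-it) B))\<close> is an antiderivative of \<open>(e^(it) A + e^(-it) B)^(-2)\<close>,
  \<open>sin \<gamma> / Q_\<gamma>\<close> is the integral of \<open>k exp (-k (e^(it) A + e^(-it) B))\<close> over
  \<open>|t| \<le> \<gamma>/2\<close> and \<open>k > 0\<close>, a superposition of Gaussians with complex parameters, whose inverse
  Fourier transforms are known. By Fubini this yields \<open>F_\<gamma>\<close> as an absolutely convergent integral,
  which is continuous off the pole; Fourier inversion gives \<open>L_\<gamma> F_\<gamma> = \<delta>_0\<close>, and testing
  against concentrated Gaussians gives uniqueness. At \<open>(0, x_n)\<close> the integral over \<open>k\<close> is a Gamma
  integral along a rotated ray and contributes the phase \<open>e^(-i(n-3)t)\<close>, so \<open>F_\<gamma> (0, x_n)\<close> is a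
  positive multiple of \<open>sin ((n-3) \<gamma>/2)\<close>, which is negative for \<open>\<gamma> = 5\<pi> / (2(n-3))\<close>; this
  \<open>\<gamma>\<close> is below \<open>\<pi>\<close> exactly when \<open>n \<ge> 6\<close>.
\<close>

section \<open>Integrals over Euclidean spaces\<close>

text \<open>The symbol factors as Q = s(\<gamma>/2) s(-\<gamma>/2) with s(t) = e^(it) A + e^(-it) B,
  and integrating s(t)^(-2) over the angles in between is Feynman's parameter formula for 1/(a b) in
  angular form. Staying within |t| <= \<gamma>/2 < pi/2 keeps Re s(t) = (A + B) cos t positive off
  the origin, which makes every Gaussian decay; at \<gamma> = pi this fails together with the
  ellipticity of L.

  The obstacle is that 1/Q has the order |\<xi>|^(-4), which is not integrable at infinity for n >=
  4, so its inverse transform is not a pointwise integral. The integrals over \<xi> and over the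
  parameters are therefore exchanged only after pairing with a bounded integrable function, and the
  resulting function is evaluated pointwise on the transformed side, off the pole.

  The phase n - 3 has two sources: (n - 2)/2 is half the sum of the n - 1 angles t and the one angle
  -t, and n/2 - 2 is the exponent of the Gamma integral. As \<open>fundamental_solution\<close> is a
  definite description, a formula for it needs existence and uniqueness.\<close>

interpretation lborel_PiM: product_sigma_finite "\<lambda>_::'a::euclidean_space. lborel :: real measure"
  by standard

text \<open>Lebesgue measure is the image of the product measure over \<open>Basis\<close>, so
  products of coordinate functions integrate to products. Gaussians and polynomial weights are
  reduced to dimension one in this way.\<close>

lemma lborel_product:
  fixes f :: "'a::euclidean_space \<Rightarrow> real \<Rightarrow> 'b::{real_normed_field,banach,second_countable_topology}"
  assumes "\<And>b. b \<in> Basis \<Longrightarrow> integrable lborel (f b)"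
  shows integrable_lborel_prod: "integrable lborel (\<lambda>x. \<Prod>b\<in>Basis. f b (x \<bullet> b))"
    and integral_lborel_prod:
      "(LINT x|lborel. (\<Prod>b\<in>Basis. f b (x \<bullet> b))) = (\<Prod>b\<in>Basis. LINT s|lborel. f b s)"
proof -
  have [measurable]: "f b \<in> borel_measurable borel" if "b \<in> Basis" for b
    using borel_measurable_integrable[OF assms[OF that]] by simp
  have eq: "(\<Prod>b\<in>Basis. f b ((\<Sum>c\<in>Basis. y c *\<^sub>R c) \<bullet> b)) = (\<Prod>b\<in>Basis. f b (y b))"
    for y :: "'a \<Rightarrow> real"
    by (intro prod.cong) simp_all
  show "integrable lborel (\<lambda>x. \<Prod>b\<in>Basis. f b (x \<bullet> b))"
    by (subst lborel_eq, subst integrable_distr_eq)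
      (simp_all add: eq lborel_PiM.product_integrable_prod assms)
  show "(LINT x|lborel. (\<Prod>b\<in>Basis. f b (x \<bullet> b))) = (\<Prod>b\<in>Basis. LINT s|lborel. f b s)"
    by (subst lborel_eq, subst integral_distr)
      (simp_all add: eq lborel_PiM.product_integral_prod assms)
qed

lemma integrable_inverse_1_plus_square_lborel: "integrable lborel (\<lambda>x::real. 1 / (1 + x\<^sup>2))"
  using integrable_inverse_1_plus_square
  by (simp add: set_integrable_def einterval_def inverse_eq_divide)

text \<open>Tonelli's condition in the shape in which it is met below: an integrable majorant
  \<open>h\<close> of the inner L1 norms takes the place of a closed form for them.\<close>

lemma integrable_lborel_pair:
  fixes K :: "'a::euclidean_space \<Rightarrow> 'b::euclidean_space \<Rightarrow> 'c::{banach,second_countable_topology}"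
  assumes meas: "case_prod K \<in> borel_measurable borel"
    and int: "\<And>x. integrable lborel (K x)"
    and h: "integrable lborel h" "\<And>x. (LINT y|lborel. norm (K x y)) \<le> h x"
  shows "integrable (lborel \<Otimes>\<^sub>M lborel) (case_prod K)"
proof -
  have [measurable]: "case_prod K \<in> borel_measurable (lborel \<Otimes>\<^sub>M lborel)"
    using meas by (simp add: lborel_prod)
  have "integrable lborel (\<lambda>x. LINT y|lborel. norm (K x y))"
    by (rule Bochner_Integration.integrable_bound[OF h(1)])
      (use h(2) in \<open>auto intro!: AE_I2 simp: abs_of_nonneg intro: order_trans[OF _ abs_ge_self]\<close>)
  then show ?thesis
    by (intro lborel_pair.Fubini_integrable) (simp_all add: int)
qed

text \<open>If \<open>G\<close> and \<open>H\<close> satisfy \<open>\<partial>\<^sub>l G = \<partial>\<^sub>s H\<close> and \<open>H\<close> vanishes at both ends, then \<open>\<integral> G l s ds\<close>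
  does not depend on \<open>l\<close>. With \<open>G = f \<zeta> * \<partial>\<^sub>s \<zeta>\<close> and \<open>H = f \<zeta> * \<partial>\<^sub>l \<zeta>\<close> this is the invariance of a
  contour integral of \<open>f\<close> under the homotopy \<open>\<zeta> l s\<close> of infinite paths.\<close>

lemma integral_deformation:
  fixes G H D :: "real \<Rightarrow> real \<Rightarrow> complex" and a b :: ereal
  assumes ab: "a < b"
    and G: "\<And>l s. \<lbrakk>0 \<le> l; l \<le> 1; s \<in> einterval a b\<rbrakk> \<Longrightarrow>
              ((\<lambda>l. G l s) has_vector_derivative D l s) (at l within {0..1})"
    and H: "\<And>l s. \<lbrakk>0 \<le> l; l \<le> 1; s \<in> einterval a b\<rbrakk> \<Longrightarrow> (H l has_vector_derivative D l s) (at s)"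
    and D: "continuous_on ({0..1} \<times> einterval a b) (\<lambda>(l, s). D l s)"
    and bound: "\<And>l s. \<lbrakk>0 \<le> l; l \<le> 1; s \<in> einterval a b\<rbrakk> \<Longrightarrow> cmod (D l s) \<le> g s"
    and g: "set_integrable lborel (einterval a b) g"
    and lima: "\<And>l. \<lbrakk>0 \<le> l; l \<le> 1\<rbrakk> \<Longrightarrow> ((H l \<circ> real_of_ereal) \<longlongrightarrow> 0) (at_right a)"
    and limb: "\<And>l. \<lbrakk>0 \<le> l; l \<le> 1\<rbrakk> \<Longrightarrow> ((H l \<circ> real_of_ereal) \<longlongrightarrow> 0) (at_left b)"
    and G0: "set_integrable lborel (einterval a b) (G 0)"
    and G1: "set_integrable lborel (einterval a b) (G 1)"
  shows "(LINT s:einterval a b|lborel. G 1 s) = (LINT s:einterval a b|lborel. G 0 s)"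
proof -
  let ?S = "einterval a b"
  \<comment> \<open>Extending the derivative by zero turns the strip into the whole plane, so that
    Fubini applies to plain Lebesgue integrals.\<close>
  let ?D = "\<lambda>l s. indicator {0..1} l *\<^sub>R indicator ?S s *\<^sub>R D l s"
  have "continuous_on ({0..1} \<times> ?S) (\<lambda>p. case_prod D p)"
    using D by simp
  then have "(\<lambda>p. indicator ({0..1} \<times> ?S) p *\<^sub>R case_prod D p) \<in> borel_measurable borel"
    by (intro borel_measurable_continuous_on_indicator) (auto simp: borel_prod[symmetric])
  moreover have "indicator ({0..1} \<times> ?S) p *\<^sub>R case_prod D p = case_prod ?D p" for p
    by (auto simp: indicator_def split: prod.splits)
  ultimately have "case_prod ?D \<in> borel_measurable borel"
    by simp
  then have meas: "case_prod ?D \<in> borel_measurable (lborel \<Otimes>\<^sub>M lborel)"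
    by (simp only: lborel_prod measurable_lborel2)
  have gb: "integrable lborel (\<lambda>s. indicator ?S s * g s)"
    using g by (simp add: set_integrable_def)
  have Dg: "norm (?D l s) \<le> norm (indicator ?S s * g s)" for l s
  proof (cases "0 \<le> l \<and> l \<le> 1 \<and> s \<in> ?S")
    case True
    with bound[of l s] show ?thesis by (simp add: abs_real_def)
  qed (auto simp: indicator_def)
  have D_s: "integrable lborel (\<lambda>s. ?D l s)" for l
  proof (rule Bochner_Integration.integrable_bound[OF gb])
    show "(\<lambda>s. ?D l s) \<in> borel_measurable lborel"
      using measurable_compose[OF measurable_Pair1' meas, of l] by simp
    show "AE s in lborel. norm (?D l s) \<le> norm (indicator ?S s * g s)"
      using Dg by (intro AE_I2)
  qed
  have int: "integrable (lborel \<Otimes>\<^sub>M lborel) (case_prod ?D)"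
  proof (rule integrable_lborel_pair)
    show "integrable lborel (\<lambda>l::real. indicator {0..1} l * (LINT s|lborel. norm (indicator ?S s * g s)))"
      by (intro integrable_mult_left) auto
    show "(LINT s|lborel. norm (?D l s)) \<le>
        indicator {0..1} l * (LINT s|lborel. norm (indicator ?S s * g s))" for l
    proof (cases "0 \<le> l \<and> l \<le> 1")
      case True
      then have "(LINT s|lborel. norm (?D l s)) \<le> (LINT s|lborel. norm (indicator ?S s * g s))"
        by (intro integral_mono integrable_norm D_s gb Dg)
      with True show ?thesis by simp
    qed (auto simp: indicator_def)
  qed (use meas D_s in \<open>simp_all add: lborel_prod\<close>)
  have "(LINT s:?S|lborel. G 1 s) - (LINT s:?S|lborel. G 0 s)
      = (LINT s|lborel. indicator ?S s *\<^sub>R (G 1 s - G 0 s))"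
    using G0 G1 unfolding set_lebesgue_integral_def set_integrable_def
    by (simp add: scaleR_diff_right)
  \<comment> \<open>Fundamental theorem in the homotopy parameter \<open>l\<close>, for fixed
    \<open>s\<close>.\<close>
  also have "\<dots> = (LINT s|lborel. LINT l|lborel. ?D l s)"
  proof (intro Bochner_Integration.integral_cong refl)
    fix s
    show "indicator ?S s *\<^sub>R (G 1 s - G 0 s) = (LINT l|lborel. ?D l s)"
    proof (cases "s \<in> ?S")
      case True
      have "continuous_on {0..1} (\<lambda>l. case_prod D (l, s))"
        using D by (rule continuous_on_compose2) (use True in \<open>auto intro!: continuous_intros\<close>)
      then have "(LINT l|lborel. indicator {0..1} l *\<^sub>R D l s) = G 1 s - G 0 s"
        using G True by (intro integral_FTC_Icc) auto
      with True show ?thesis by simp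
    qed simp
  qed
  also have "\<dots> = (LINT l|lborel. LINT s|lborel. ?D l s)"
    using int by (rule lborel_pair.Fubini_integral)
  \<comment> \<open>Fundamental theorem in \<open>s\<close>, for fixed \<open>l\<close>: the inner
    integral is the difference of the limits of \<open>H l\<close> at the two ends, both
    zero.\<close>
  also have "\<dots> = (LINT l|(lborel::real measure). 0)"
  proof (intro Bochner_Integration.integral_cong refl)
    fix l :: real
    show "(LINT s|lborel. ?D l s) = 0"
    proof (cases "0 \<le> l \<and> l \<le> 1")
      case True
      have Dl: "integrable lborel (\<lambda>s. indicator ?S s *\<^sub>R D l s)"
        using D_s[of l] True by simp
      have cont: "continuous_on ?S (\<lambda>s. case_prod D (l, s))"
        using D by (rule continuous_on_compose2) (use True in \<open>auto intro!: continuous_intros\<close>)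
      have "(LINT s:?S|lborel. D l s) = (LBINT s=a..b. D l s)"
        using interval_lebesgue_integral_le_eq[OF less_imp_le[OF ab]] by metis
      also have "\<dots> = 0 - 0"
      proof (rule interval_integral_FTC_integrable[OF ab])
        show "isCont (D l) s" if "a < ereal s" "ereal s < b" for s
          using cont that by (simp add: continuous_on_eq_continuous_at[OF open_einterval] einterval_iff)
        show "(H l has_vector_derivative D l s) (at s)" if "a < ereal s" "ereal s < b" for s
          using H[of l s] True that by (simp add: einterval_def)
        show "set_integrable lborel ?S (D l)"
          using Dl by (simp add: set_integrable_def)
        show "((H l \<circ> real_of_ereal) \<longlongrightarrow> 0) (at_right a)" "((H l \<circ> real_of_ereal) \<longlongrightarrow> 0) (at_left b)"
          using lima[of l] limb[of l] True by auto
      qed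
      finally have "(LINT s|lborel. indicator ?S s *\<^sub>R D l s) = 0"
        unfolding set_lebesgue_integral_def by simp
      moreover have "?D l s = indicator ?S s *\<^sub>R D l s" for s
        using True by simp
      ultimately show ?thesis by presburger
    qed (auto simp: indicator_def)
  qed
  finally show ?thesis by simp
qed

section \<open>Gaussian integrals with complex parameters\<close>

lemma bounded_of_tendsto_at_top:
  fixes f :: "real \<Rightarrow> real"
  assumes "continuous_on {0..} f" "(f \<longlongrightarrow> l) at_top"
  shows "\<exists>M>0. \<forall>y\<ge>0. \<bar>f y\<bar> \<le> M"
proof -
  have "eventually (\<lambda>y. \<bar>f y - l\<bar> < 1) at_top"
    using assms(2) by (auto simp: tendsto_iff dist_real_def)
  then obtain N where N: "\<And>y. y \<ge> N \<Longrightarrow> \<bar>f y - l\<bar> < 1"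
    by (auto simp: eventually_at_top_linorder)
  have "compact (f ` {0..N})"
    by (intro compact_continuous_image continuous_on_subset[OF assms(1)]) auto
  then have "bounded (f ` {0..N})"
    by (rule compact_imp_bounded)
  then obtain B where "\<forall>x\<in>f ` {0..N}. norm x \<le> B"
    unfolding bounded_iff ..
  then have B: "\<bar>f y\<bar> \<le> B" if "0 \<le> y" "y \<le> N" for y
    using that by auto
  have "\<bar>f y\<bar> \<le> max B (\<bar>l\<bar> + 1)" if "y \<ge> 0" for y
    using B[OF that] N[of y] by linarith
  then show ?thesis
    by (intro exI[of _ "max B (\<bar>l\<bar> + 1)"]) auto
qed

text \<open>The factor \<open>(1 + \<bar>s\<bar>)\<^sup>2\<close> leaves room for the polynomial
  prefactors that differentiating a Gaussian produces; the linear term in the exponent comes from a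
  complex shift.\<close>

lemma gaussian_majorant:
  fixes d B :: real
  assumes "d > 0"
  obtains M where "M > 0"
    "\<And>s. exp (- d * s\<^sup>2 + B * \<bar>s\<bar>) * (1 + \<bar>s\<bar>)\<^sup>2 \<le> M / (1 + s\<^sup>2)"
proof -
  let ?f = "\<lambda>y::real. exp (- d * y\<^sup>2 + B * y) * (1 + y)\<^sup>2 * (1 + y\<^sup>2)"
  have "(?f \<longlongrightarrow> 0) at_top"
    using assms by real_asymp
  moreover have "continuous_on {0..} ?f"
    by (intro continuous_intros)
  ultimately obtain M where "M > 0" and M: "\<And>y. y \<ge> 0 \<Longrightarrow> \<bar>?f y\<bar> \<le> M"
    using bounded_of_tendsto_at_top by meson
  have "exp (- d * s\<^sup>2 + B * \<bar>s\<bar>) * (1 + \<bar>s\<bar>)\<^sup>2 \<le> M / (1 + s\<^sup>2)" for s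
    using M[of "\<bar>s\<bar>"] by (simp add: pos_le_divide_eq add_pos_nonneg abs_mult)
  with \<open>M > 0\<close> show ?thesis by (rule that)
qed

lemma cos_le_cos_of_abs_le: "\<lbrakk>\<bar>x\<bar> \<le> y; y \<le> pi\<rbrakk> \<Longrightarrow> cos y \<le> cos x"
  using cos_monotone_0_pi_le[of "\<bar>x\<bar>" y] by simp

text \<open>\<open>\<phi>\<close> and \<open>d\<close> stand for the angle and the shift at an
  intermediate stage of a deformation, \<open>\<theta>\<close> and \<open>c\<close> for bounds on
  them, so the estimate is uniform along the deformation. Below pi/4 the coefficient
  \<open>cos (2 * \<theta>)\<close> is positive.\<close>

lemma norm_exp_shifted_gaussian:
  fixes c :: complex
  assumes "\<bar>\<phi>\<bar> \<le> \<theta>" "\<theta> < pi / 4" "cmod d \<le> cmod c"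
  shows "cmod (exp (- (cis \<phi> * complex_of_real s - d)\<^sup>2)) \<le>
    exp ((cmod c)\<^sup>2) * exp (- cos (2 * \<theta>) * s\<^sup>2 + 2 * cmod c * \<bar>s\<bar>)"
proof -
  have c2: "cis (2 * \<phi>) = cis \<phi> * cis \<phi>"
    by (simp add: cis_mult)
  have "(cis \<phi> * complex_of_real s - d)\<^sup>2 =
      complex_of_real (s\<^sup>2) * cis (2 * \<phi>) - 2 * (cis \<phi> * complex_of_real s * d) + d\<^sup>2"
    by (subst c2) (simp add: power2_eq_square algebra_simps)
  then have "Re ((cis \<phi> * complex_of_real s - d)\<^sup>2) =
      s\<^sup>2 * cos (2 * \<phi>) - 2 * Re (cis \<phi> * complex_of_real s * d) + Re (d\<^sup>2)"
    by (simp del: of_real_power)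
  moreover have "Re (cis \<phi> * complex_of_real s * d) \<le> \<bar>s\<bar> * cmod c"
  proof -
    have "Re (cis \<phi> * complex_of_real s * d) \<le> cmod (cis \<phi> * complex_of_real s * d)"
      by (rule complex_Re_le_cmod)
    also have "\<dots> = \<bar>s\<bar> * cmod d" by (simp add: norm_mult)
    also have "\<dots> \<le> \<bar>s\<bar> * cmod c" using assms(3) by (rule mult_left_mono) simp
    finally show ?thesis .
  qed
  moreover have "- Re (d\<^sup>2) \<le> (cmod c)\<^sup>2"
  proof -
    have "- Re (d\<^sup>2) \<le> cmod (d\<^sup>2)" using abs_Re_le_cmod[of "d\<^sup>2"] by linarith
    also have "\<dots> \<le> (cmod c)\<^sup>2" using assms(3) by (simp add: norm_power power_mono)
    finally show ?thesis .
  qed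
  moreover have "s\<^sup>2 * cos (2 * \<theta>) \<le> s\<^sup>2 * cos (2 * \<phi>)"
    using assms by (intro mult_left_mono cos_le_cos_of_abs_le) auto
  ultimately have "- Re ((cis \<phi> * complex_of_real s - d)\<^sup>2) \<le>
      (cmod c)\<^sup>2 + (- cos (2 * \<theta>) * s\<^sup>2 + 2 * cmod c * \<bar>s\<bar>)"
    by (simp add: algebra_simps)
  then show ?thesis by (simp flip: exp_add)
qed

lemma integral_gaussian: "(LINT s|lborel. exp (- (s::real)\<^sup>2)) = sqrt pi"
proof -
  have "has_bochner_integral lborel (\<lambda>s::real. exp (- s\<^sup>2)) (2 *\<^sub>R (sqrt pi / 2))"
    by (rule has_bochner_integral_even_function[OF gaussian_moment_0]) simp
  then show ?thesis
    by (auto simp: has_bochner_integral_iff)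
qed

text \<open>The real line is tilted by \<open>\<theta>\<close> and shifted by \<open>c\<close> at
  the same time, and \<open>cis \<theta>\<close> is the derivative of the path. Since exp (-z^2) is
  entire and decays in the double sector of half-angle pi/4 around the real axis, the contour
  integral keeps its value sqrt pi.\<close>

lemma integral_shifted_gaussian:
  fixes c :: complex
  assumes th: "\<bar>\<theta>\<bar> < pi / 4"
  shows "integrable lborel (\<lambda>s. exp (- (cis \<theta> * complex_of_real s - c)\<^sup>2))"
    and "(LINT s|lborel. exp (- (cis \<theta> * complex_of_real s - c)\<^sup>2) * cis \<theta>) = sqrt pi"
proof -
  define C where "C = cmod c"
  \<comment> \<open>\<open>z\<close> is the path at stage \<open>l\<close> and \<open>w\<close> its
    derivative in \<open>l\<close>. \<open>G\<close> and \<open>H\<close> are exp (-z^2) times the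
    derivatives of \<open>z\<close> in \<open>s\<close> and in \<open>l\<close>, and
    \<open>D\<close> is their common cross derivative.\<close>
  define z where "z l s = cis (l * \<theta>) * complex_of_real s - of_real l * c" for l s :: real
  define w where "w l s = \<i> * of_real \<theta> * cis (l * \<theta>) * complex_of_real s - c" for l s :: real
  define G where "G l s = exp (- (z l s)\<^sup>2) * cis (l * \<theta>)" for l s :: real
  define H where "H l s = exp (- (z l s)\<^sup>2) * w l s" for l s :: real
  define D where "D l s = exp (- (z l s)\<^sup>2) *
    (- 2 * z l s * cis (l * \<theta>) * w l s + \<i> * of_real \<theta> * cis (l * \<theta>))" for l s :: real
  have "cos (2 * \<bar>\<theta>\<bar>) > 0" using th by (intro cos_gt_zero_pi) auto
  then obtain M where M: "M > 0" "\<And>s. exp (- cos (2 * \<bar>\<theta>\<bar>) * s\<^sup>2 + (2 * C) * \<bar>s\<bar>) * (1 + \<bar>s\<bar>)\<^sup>2 \<le> M / (1 + s\<^sup>2)"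
    using gaussian_majorant by blast
  \<comment> \<open>The constant collects |2 z w| <= 2 (1 + C)^2 (1 + |s|)^2 and |\<theta>| <= 1,
    the two terms in the bracket of \<open>D\<close>.\<close>
  define K where "K = exp (C\<^sup>2) * (2 * (1 + C)\<^sup>2 + 1)"
  have C0: "C \<ge> 0" by (simp add: C_def)
  have maj: "cmod (exp (- (z l s)\<^sup>2)) * p \<le> K * M * (1 / (1 + s\<^sup>2))"
    if l: "0 \<le> l" "l \<le> 1" and p: "0 \<le> p" "p \<le> (2 * (1 + C)\<^sup>2 + 1) * (1 + \<bar>s\<bar>)\<^sup>2" for l s p
  proof -
    have "\<bar>l * \<theta>\<bar> \<le> \<bar>\<theta>\<bar>" "cmod (of_real l * c) \<le> cmod c"
      using l by (auto simp: abs_mult norm_mult mult_left_le_one_le)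
    then have "cmod (exp (- (z l s)\<^sup>2)) \<le> exp (C\<^sup>2) * exp (- cos (2 * \<bar>\<theta>\<bar>) * s\<^sup>2 + 2 * C * \<bar>s\<bar>)"
      unfolding z_def C_def by (intro norm_exp_shifted_gaussian) (use th in auto)
    then have "cmod (exp (- (z l s)\<^sup>2)) * p \<le>
       (exp (C\<^sup>2) * exp (- cos (2 * \<bar>\<theta>\<bar>) * s\<^sup>2 + 2 * C * \<bar>s\<bar>)) * ((2 * (1 + C)\<^sup>2 + 1) * (1 + \<bar>s\<bar>)\<^sup>2)"
      using p by (intro mult_mono) auto
    also have "\<dots> = K * (exp (- cos (2 * \<bar>\<theta>\<bar>) * s\<^sup>2 + 2 * C * \<bar>s\<bar>) * (1 + \<bar>s\<bar>)\<^sup>2)"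
      by (simp add: K_def)
    also have "\<dots> \<le> K * (M / (1 + s\<^sup>2))"
      using M(2)[of s] by (intro mult_left_mono) (auto simp: K_def)
    finally show ?thesis by simp
  qed
  have th1: "\<bar>\<theta>\<bar> \<le> 1" using th pi_less_4 by linarith
  have nz: "cmod (z l s) \<le> (1 + C) * (1 + \<bar>s\<bar>)" if "0 \<le> l" "l \<le> 1" for l s
  proof -
    have "cmod (z l s) \<le> \<bar>s\<bar> + l * C"
      unfolding z_def C_def using that by (intro norm_triangle_le_diff) (simp add: norm_mult)
    also have "\<dots> \<le> \<bar>s\<bar> + C" using that C0 by (simp add: mult_left_le_one_le)
    also have "\<dots> \<le> (1 + C) * (1 + \<bar>s\<bar>)" using C0 by (simp add: algebra_simps)
    finally show ?thesis .
  qed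
  have nw: "cmod (w l s) \<le> (1 + C) * (1 + \<bar>s\<bar>)" for l s
  proof -
    have "cmod (w l s) \<le> \<bar>\<theta>\<bar> * \<bar>s\<bar> + C"
      unfolding w_def C_def by (intro norm_triangle_le_diff) (simp add: norm_mult)
    also have "\<dots> \<le> \<bar>s\<bar> + C" using th1 by (simp add: mult_left_le_one_le)
    also have "\<dots> \<le> (1 + C) * (1 + \<bar>s\<bar>)" using C0 by (simp add: algebra_simps)
    finally show ?thesis .
  qed
  have one_le: "1 \<le> (1 + \<bar>s\<bar>)\<^sup>2" for s :: real by (simp add: one_le_power)
  have boundD: "cmod (D l s) \<le> K * M * (1 / (1 + s\<^sup>2))" if l: "0 \<le> l" "l \<le> 1" for l s
  proof -
    have "cmod (- 2 * z l s * cis (l * \<theta>) * w l s + \<i> * of_real \<theta> * cis (l * \<theta>)) \<le>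
        2 * (cmod (z l s) * cmod (w l s)) + \<bar>\<theta>\<bar>"
      by (rule norm_triangle_le) (simp add: norm_mult)
    also have "\<dots> \<le> 2 * (((1 + C) * (1 + \<bar>s\<bar>)) * ((1 + C) * (1 + \<bar>s\<bar>))) + 1 * (1 + \<bar>s\<bar>)\<^sup>2"
      using nz[OF l] nw order_trans[OF th1 one_le[of s]] C0 by (intro add_mono mult_mono) auto
    also have "\<dots> = (2 * (1 + C)\<^sup>2 + 1) * (1 + \<bar>s\<bar>)\<^sup>2"
      by (simp add: power2_eq_square algebra_simps)
    finally show ?thesis unfolding D_def norm_mult using l by (intro maj) auto
  qed
  have sq: "(1 + C) * (1 + \<bar>s\<bar>) \<le> (2 * (1 + C)\<^sup>2 + 1) * (1 + \<bar>s\<bar>)\<^sup>2" for s :: real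
  proof (rule mult_mono)
    have "1 + C \<le> (1 + C)\<^sup>2" "1 + \<bar>s\<bar> \<le> (1 + \<bar>s\<bar>)\<^sup>2"
      using C0 by (simp_all add: self_le_power)
    then show "1 + C \<le> 2 * (1 + C)\<^sup>2 + 1" "1 + \<bar>s\<bar> \<le> (1 + \<bar>s\<bar>)\<^sup>2"
      using zero_le_power2[of "1 + C"] by linarith+
  qed auto
  have boundH: "cmod (H l s) \<le> K * M * (1 / (1 + s\<^sup>2))" if l: "0 \<le> l" "l \<le> 1" for l s
    unfolding H_def norm_mult using l nw[of l s] sq[of s] by (intro maj) auto
  have boundG: "cmod (exp (- (z l s)\<^sup>2)) \<le> K * M * (1 / (1 + s\<^sup>2))" if l: "0 \<le> l" "l \<le> 1" for l s
  proof -
    have "1 \<le> (2 * (1 + C)\<^sup>2 + 1) * (1 + \<bar>s\<bar>)\<^sup>2"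
      using mult_mono[of 1 "2 * (1 + C)\<^sup>2 + 1" 1 "(1 + \<bar>s\<bar>)\<^sup>2"] one_le[of s] by simp
    then show ?thesis using maj[of l 1 s] l by simp
  qed
  have intK: "integrable lborel (\<lambda>s. K * M * (1 / (1 + s\<^sup>2)))"
    by (intro integrable_mult_right integrable_inverse_1_plus_square_lborel)
  have intG: "integrable lborel (\<lambda>s. exp (- (z l s)\<^sup>2))" if "0 \<le> l" "l \<le> 1" for l
  proof (rule Bochner_Integration.integrable_bound[OF intK])
    show "AE s in lborel. cmod (exp (- (z l s)\<^sup>2)) \<le> norm (K * M * (1 / (1 + s\<^sup>2)))"
      unfolding real_norm_def
      by (intro AE_I2 order_trans[OF boundG[OF that] abs_ge_self])
  qed (simp add: z_def)
  then show "integrable lborel (\<lambda>s. exp (- (cis \<theta> * complex_of_real s - c)\<^sup>2))"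
    using intG[of 1] by (simp add: z_def)
  have intG': "integrable lborel (G l)" if "0 \<le> l" "l \<le> 1" for l
    unfolding G_def by (intro integrable_mult_left intG that)
  have limH: "(H l \<longlongrightarrow> 0) F" if "0 \<le> l" "l \<le> 1" "((\<lambda>s. K * M * (1 / (1 + s\<^sup>2))) \<longlongrightarrow> 0) F" for l F
    by (rule Lim_null_comparison[OF _ that(3)]) (use boundH that in auto)
  have e: "einterval (- \<infinity>) \<infinity> = UNIV" by (auto simp: einterval_iff)
  have "(LINT s:einterval (- \<infinity>) \<infinity>|lborel. G 1 s) = (LINT s:einterval (- \<infinity>) \<infinity>|lborel. G 0 s)"
  proof (rule integral_deformation[where H = H and D = D and g = "\<lambda>s. K * M * (1 / (1 + s\<^sup>2))"])
    show "((\<lambda>l. G l s) has_vector_derivative D l s) (at l within {0..1})" for l s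
    proof -
      let ?e = "\<lambda>u. exp (\<i> * (u * complex_of_real \<theta>))"
      have "((\<lambda>u. exp (- (?e u * complex_of_real s - u * c)\<^sup>2) * ?e u) has_field_derivative D l s) (at (of_real l))"
        unfolding D_def z_def w_def cis_conv_exp
        by (rule derivative_eq_intros refl)+ (simp add: algebra_simps power2_eq_square)
      from has_vector_derivative_real_field[OF this] show ?thesis
        by (simp add: G_def z_def cis_conv_exp)
    qed
    show "(H l has_vector_derivative D l s) (at s)" for l s
    proof -
      let ?z = "\<lambda>u. cis (l * \<theta>) * u - complex_of_real l * c"
      have "((\<lambda>u. exp (- (?z u)\<^sup>2) * (\<i> * of_real \<theta> * cis (l * \<theta>) * u - c)) has_field_derivative D l s) (at (of_real s))"
        unfolding D_def z_def w_def
        by (rule derivative_eq_intros refl)+ (simp add: algebra_simps power2_eq_square)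
      from has_vector_derivative_real_field[OF this] show ?thesis
        by (simp add: H_def[abs_def] z_def w_def)
    qed
    show "continuous_on ({0..1} \<times> einterval (- \<infinity>) \<infinity>) (\<lambda>(l, s). D l s)"
      unfolding D_def z_def w_def cis_conv_exp case_prod_unfold by (intro continuous_intros)
    have "((\<lambda>s::real. K * M * (1 / (1 + s\<^sup>2))) \<longlongrightarrow> 0) at_top" "((\<lambda>s::real. K * M * (1 / (1 + s\<^sup>2))) \<longlongrightarrow> 0) at_bot"
      by real_asymp+
    then show "((H l \<circ> real_of_ereal) \<longlongrightarrow> 0) (at_right (- \<infinity>))" "((H l \<circ> real_of_ereal) \<longlongrightarrow> 0) (at_left \<infinity>)"
      if "0 \<le> l" "l \<le> 1" for l
      using limH that by (simp_all add: ereal_tendsto_simps)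
  qed (use boundD intG' intK in \<open>auto simp: e set_integrable_def\<close>)
  then have "(LINT s|lborel. G 1 s) = (LINT s|lborel. G 0 s)"
    by (simp add: e set_lebesgue_integral_def)
  also have "\<dots> = (LINT s|lborel. complex_of_real (exp (- s\<^sup>2)))"
    by (simp add: G_def z_def flip: exp_of_real)
  also have "\<dots> = sqrt pi" by (simp add: integral_gaussian del: of_real_exp)
  finally show "(LINT s|lborel. exp (- (cis \<theta> * complex_of_real s - c)\<^sup>2) * cis \<theta>) = sqrt pi"
    by (simp add: G_def z_def)
qed

text \<open>Completing the square after the substitution u = sqrt(\<kappa>) s. The root of cis
  \<theta> is the principal one, cis (\<theta>/2), and halving the angle turns the sector of
  \<open>integral_shifted_gaussian\<close> into |\<theta>| < pi/2.\<close>

lemma complex_gaussian_fourier: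
  assumes k: "\<kappa> > 0" and th: "\<bar>\<theta>\<bar> < pi / 2"
  shows integrable_complex_gaussian: "integrable lborel
      (\<lambda>s. exp (\<i> * of_real (b * s) - of_real \<kappa> * cis \<theta> * of_real (s\<^sup>2)))" (is "integrable _ ?f")
    and integral_complex_gaussian:
      "(LINT s|lborel. exp (\<i> * of_real (b * s) - of_real \<kappa> * cis \<theta> * of_real (s\<^sup>2))) =
       of_real (sqrt (pi / \<kappa>)) * cis (- \<theta> / 2) * exp (- of_real (b\<^sup>2) * cis (- \<theta>) / of_real (4 * \<kappa>))"
proof -
  \<comment> \<open>Chosen so that twice the product of the shift with the rotated variable is
    exactly i b s; the leftover factor exp (-c^2) is \<open>E\<close>.\<close>
  define c where "c = \<i> * of_real b * cis (- \<theta> / 2) / (2 * of_real (sqrt \<kappa>))"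
  define E where "E = exp (of_real (b\<^sup>2) * cis (- \<theta>) / of_real (4 * \<kappa>))"
  let ?g = "\<lambda>u. exp (- (cis (\<theta> / 2) * complex_of_real u - c)\<^sup>2)"
  have sqk: "sqrt \<kappa> * sqrt \<kappa> = \<kappa>" "sqrt \<kappa> > 0" using k by auto
  have sqk': "complex_of_real (sqrt \<kappa>) * complex_of_real (sqrt \<kappa>) = of_real \<kappa>"
    using sqk by (simp flip: of_real_mult)
  have ct: "cis (\<theta> / 2) * cis (\<theta> / 2) = cis \<theta>" "cis (- \<theta> / 2) * cis (- \<theta> / 2) = cis (- \<theta>)"
    "cis (\<theta> / 2) * cis (- \<theta> / 2) = 1"
    by (simp_all add: cis_mult)
  have csq: "c\<^sup>2 = - (of_real (b\<^sup>2) * cis (- \<theta>) / of_real (4 * \<kappa>))"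
  proof -
    have "c\<^sup>2 = - (of_real (b\<^sup>2) * (cis (- \<theta> / 2) * cis (- \<theta> / 2)) /
        (4 * (complex_of_real (sqrt \<kappa>) * complex_of_real (sqrt \<kappa>))))"
      unfolding c_def by (simp add: power_mult_distrib power_divide) (simp add: power2_eq_square)
    then show ?thesis unfolding ct sqk' by simp
  qed
  \<comment> \<open>The summand 0 matches the affine substitution rule for \<open>lborel\<close>
    applied below.\<close>
  have eq: "?g (0 + sqrt \<kappa> * s) = ?f s * E" for s
  proof -
    have "2 * (cis (\<theta> / 2) * complex_of_real (sqrt \<kappa> * s) * c) =
        \<i> * of_real (b * s) * (cis (\<theta> / 2) * cis (- \<theta> / 2))"
      using sqk by (simp add: c_def)
    then have 1: "2 * (cis (\<theta> / 2) * complex_of_real (sqrt \<kappa> * s) * c) = \<i> * of_real (b * s)"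
      unfolding ct by simp
    have "(cis (\<theta> / 2) * complex_of_real (sqrt \<kappa> * s))\<^sup>2 =
        (complex_of_real (sqrt \<kappa>) * complex_of_real (sqrt \<kappa>)) * (cis (\<theta> / 2) * cis (\<theta> / 2)) * of_real (s\<^sup>2)"
      by (simp add: power2_eq_square)
    then have 2: "(cis (\<theta> / 2) * complex_of_real (sqrt \<kappa> * s))\<^sup>2 = of_real \<kappa> * cis \<theta> * of_real (s\<^sup>2)"
      unfolding ct sqk' .
    have "- (cis (\<theta> / 2) * complex_of_real (0 + sqrt \<kappa> * s) - c)\<^sup>2 =
        2 * (cis (\<theta> / 2) * complex_of_real (sqrt \<kappa> * s) * c)
        - (cis (\<theta> / 2) * complex_of_real (sqrt \<kappa> * s))\<^sup>2 - c\<^sup>2"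
      by (simp add: power2_diff algebra_simps)
    then have "- (cis (\<theta> / 2) * complex_of_real (0 + sqrt \<kappa> * s) - c)\<^sup>2 =
        (\<i> * of_real (b * s) - of_real \<kappa> * cis \<theta> * of_real (s\<^sup>2)) +
         of_real (b\<^sup>2) * cis (- \<theta>) / of_real (4 * \<kappa>)"
      unfolding 1 2 csq by simp
    then show ?thesis
      unfolding E_def by (simp only: exp_add)
  qed
  have th': "\<bar>\<theta> / 2\<bar> < pi / 4" using th by simp
  have E0: "E \<noteq> 0" by (simp add: E_def)
  have gi: "integrable lborel ?g" and gI: "(LINT u|lborel. ?g u) = sqrt pi * cis (- \<theta> / 2)"
  proof -
    show gi: "integrable lborel ?g" by (rule integral_shifted_gaussian(1)[OF th'])
    have "(LINT u|lborel. ?g u) * cis (\<theta> / 2) = sqrt pi"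
      using integral_shifted_gaussian(2)[OF th', of c] gi by simp
    then have "(LINT u|lborel. ?g u) * (cis (\<theta> / 2) * cis (- \<theta> / 2)) = sqrt pi * cis (- \<theta> / 2)"
      by (simp only: mult.assoc[symmetric])
    then show "(LINT u|lborel. ?g u) = sqrt pi * cis (- \<theta> / 2)"
      unfolding ct by simp
  qed
  have "integrable lborel (\<lambda>s. ?g (0 + sqrt \<kappa> * s))"
    using lborel_integrable_real_affine[OF gi, of "sqrt \<kappa>" 0] k by simp
  then have "integrable lborel (\<lambda>s. ?f s * E)"
    unfolding eq .
  then have "integrable lborel (\<lambda>s. ?f s * E * inverse E)"
    by (rule integrable_mult_left)
  then show fi: "integrable lborel ?f"
    using E0 by (simp add: mult.assoc)
  have "sqrt pi * cis (- \<theta> / 2) = sqrt \<kappa> *\<^sub>R (LINT s|lborel. ?g (0 + sqrt \<kappa> * s))"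
    unfolding gI[symmetric] using lborel_integral_real_affine[of "sqrt \<kappa>" ?g 0] k by simp
  also have "\<dots> = sqrt \<kappa> * (LINT s|lborel. ?f s) * E"
    unfolding eq using fi by (simp add: scaleR_conv_of_real)
  finally have "(LINT s|lborel. ?f s) = sqrt pi / sqrt \<kappa> * cis (- \<theta> / 2) * inverse E"
    using sqk E0 by (simp add: field_simps)
  then show "(LINT s|lborel. ?f s) =
      of_real (sqrt (pi / \<kappa>)) * cis (- \<theta> / 2) * exp (- of_real (b\<^sup>2) * cis (- \<theta>) / of_real (4 * \<kappa>))"
    by (simp add: E_def real_sqrt_divide flip: exp_minus)
qed

text \<open>Each coordinate carries its own angle, because the last direction will be rotated
  against the others. The inverse root of the determinant is a product of one-dimensional principal
  roots, hence its phase is minus half the sum of the angles and no choice of branch is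
  left.\<close>

lemma gaussian_fourier_lborel:
  fixes x :: "'a::euclidean_space" and \<theta> :: "'a \<Rightarrow> real"
  assumes k: "\<kappa> > 0" and th: "\<And>b. b \<in> Basis \<Longrightarrow> \<bar>\<theta> b\<bar> < pi / 2"
  shows integrable_gaussian_lborel: "integrable lborel
      (\<lambda>y. exp (\<i> * of_real (x \<bullet> y) - of_real \<kappa> * (\<Sum>b\<in>Basis. cis (\<theta> b) * of_real ((y \<bullet> b)\<^sup>2))))"
      (is "integrable _ ?f")
    and integral_gaussian_lborel: "(LINT y|lborel.
        exp (\<i> * of_real (x \<bullet> y) - of_real \<kappa> * (\<Sum>b\<in>Basis. cis (\<theta> b) * of_real ((y \<bullet> b)\<^sup>2)))) =
      of_real (sqrt (pi / \<kappa>) ^ DIM('a)) * cis (- (\<Sum>b\<in>Basis. \<theta> b) / 2) *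
      exp (- (\<Sum>b\<in>Basis. cis (- \<theta> b) * of_real ((x \<bullet> b)\<^sup>2)) / of_real (4 * \<kappa>))"
proof -
  let ?g = "\<lambda>b s. exp (\<i> * of_real ((x \<bullet> b) * s) - of_real \<kappa> * cis (\<theta> b) * of_real (s\<^sup>2))"
  have eq: "?f y = (\<Prod>b\<in>Basis. ?g b (y \<bullet> b))" for y
    by (subst exp_sum[symmetric])
      (simp_all add: sum_subtractf sum_distrib_left mult.assoc euclidean_inner[of x y])
  have g: "integrable lborel (?g b)" if "b \<in> Basis" for b
    using integrable_complex_gaussian[OF k th[OF that]] .
  show "integrable lborel ?f"
    unfolding eq by (rule integrable_lborel_prod[OF g])
  have "(LINT y|lborel. ?f y) = (\<Prod>b\<in>Basis. LINT s|lborel. ?g b s)"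
    unfolding eq by (rule integral_lborel_prod[OF g])
  also have "\<dots> = (\<Prod>b\<in>Basis. of_real (sqrt (pi / \<kappa>)) * cis (- \<theta> b / 2) *
      exp (- of_real ((x \<bullet> b)\<^sup>2) * cis (- \<theta> b) / of_real (4 * \<kappa>)))"
    by (intro prod.cong refl integral_complex_gaussian[OF k th])
  also have "\<dots> = of_real (sqrt (pi / \<kappa>) ^ DIM('a)) * cis (- (\<Sum>b\<in>Basis. \<theta> b) / 2) *
      exp (- (\<Sum>b\<in>Basis. cis (- \<theta> b) * of_real ((x \<bullet> b)\<^sup>2)) / of_real (4 * \<kappa>))"
  proof -
    have "(\<Prod>b\<in>(Basis::'a set). cis (- \<theta> b / 2)) = cis (- (\<Sum>b\<in>Basis. \<theta> b) / 2)"
      unfolding cis_conv_exp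
      by (subst exp_sum[symmetric]) (simp_all add: sum_negf sum_divide_distrib sum_distrib_left)
    moreover have "(\<Prod>b\<in>(Basis::'a set). exp (- of_real ((x \<bullet> b)\<^sup>2) * cis (- \<theta> b) / of_real (4 * \<kappa>))) =
        exp (- (\<Sum>b\<in>Basis. cis (- \<theta> b) * of_real ((x \<bullet> b)\<^sup>2)) / of_real (4 * \<kappa>))"
      by (subst exp_sum[symmetric]) (simp_all add: sum_negf sum_divide_distrib mult.commute)
    ultimately show ?thesis
      by (simp add: prod.distrib)
  qed
  finally show "(LINT y|lborel. ?f y) = of_real (sqrt (pi / \<kappa>) ^ DIM('a)) * cis (- (\<Sum>b\<in>Basis. \<theta> b) / 2) *
      exp (- (\<Sum>b\<in>Basis. cis (- \<theta> b) * of_real ((x \<bullet> b)\<^sup>2)) / of_real (4 * \<kappa>))" .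
qed

section \<open>Fourier transforms of Schwartz functions\<close>

lemma lborel_translation:
  fixes f :: "'a::euclidean_space \<Rightarrow> 'b::{banach,second_countable_topology}"
  assumes "integrable lborel f"
  shows integrable_lborel_translation: "integrable lborel (\<lambda>x. f (c + x))"
    and integral_lborel_translation: "(LINT x|lborel. f (c + x)) = (LINT x|lborel. f x)"
proof -
  have [measurable]: "f \<in> borel_measurable borel"
    using borel_measurable_integrable[OF assms] by simp
  show "integrable lborel (\<lambda>x. f (c + x))"
    using assms by (subst (asm) lborel_distr_plus[of c, symmetric]) (simp add: integrable_distr_eq)
  show "(LINT x|lborel. f (c + x)) = (LINT x|lborel. f x)"
    by (subst (2) lborel_distr_plus[of c, symmetric]) (simp add: integral_distr)
qed

lemma continuous_imp_borel_measurable_lborel: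
  fixes f :: "'a::euclidean_space \<Rightarrow> 'b::topological_space"
  shows "continuous_on UNIV f \<Longrightarrow> f \<in> borel_measurable lborel"
  by (simp add: borel_measurable_continuous_onI)

text \<open>Average \<open>f (v + x) - f x = \<integral> \<partial>\<^sub>v f (x + s v) ds\<close> over \<open>x\<close> and use translation invariance.\<close>

lemma integral_partial_deriv_eq_0:
  fixes f :: "'a::euclidean_space \<Rightarrow> complex"
  assumes diff: "\<And>x. f differentiable (at x)" and f: "integrable lborel f"
    and cont: "continuous_on UNIV (partial_deriv v f)" and df: "integrable lborel (partial_deriv v f)"
  shows "(LINT x|lborel. partial_deriv v f x) = 0"
proof -
  let ?K = "\<lambda>(s::real) x. indicator {0..1} s *\<^sub>R partial_deriv v f (s *\<^sub>R v + x)"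
  have "continuous_on UNIV (\<lambda>p::real \<times> 'a. partial_deriv v f (fst p *\<^sub>R v + snd p))"
    by (rule continuous_on_compose2[OF cont]) (auto intro!: continuous_intros)
  then have [measurable]: "(\<lambda>p::real \<times> 'a. partial_deriv v f (fst p *\<^sub>R v + snd p)) \<in> borel_measurable borel"
    by (rule borel_measurable_continuous_onI)
  have [measurable]: "(\<lambda>p::real \<times> 'a. indicator {0..1::real} (fst p) :: real) \<in> borel_measurable borel"
    using measurable_compose[OF borel_measurable_continuous_onI[OF continuous_on_fst[OF continuous_on_id]], of "indicator {0..1::real}" borel]
    by simp
  have int: "integrable (lborel \<Otimes>\<^sub>M lborel) (case_prod ?K)"
  proof (rule integrable_lborel_pair)
    show "case_prod ?K \<in> borel_measurable borel"
      unfolding case_prod_unfold by measurable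
    show "integrable lborel (?K s)" for s
      by (intro integrable_scaleR_right integrable_lborel_translation df)
    show "integrable lborel (\<lambda>s::real. indicator {0..1} s * (LINT x|lborel. norm (partial_deriv v f x)))"
      by (intro integrable_mult_left) auto
    show "(LINT x|lborel. norm (?K s x)) \<le> indicator {0..1} s * (LINT x|lborel. norm (partial_deriv v f x))" for s
      using integral_lborel_translation[OF integrable_norm[OF df], of "s *\<^sub>R v"] by simp
  qed
  have "(LINT x|lborel. partial_deriv v f x) =
      (LINT s|lborel. indicator {0..1::real} s *\<^sub>R (LINT x|lborel. partial_deriv v f x))"
    by (subst integral_scaleR_left) auto
  also have "\<dots> = (LINT s|lborel. LINT x|lborel. ?K s x)"
    using integral_lborel_translation[OF df] by simp
  also have "\<dots> = (LINT x|lborel. LINT s|lborel. ?K s x)"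
    by (rule lborel_pair.Fubini_integral[OF int, symmetric])
  also have "\<dots> = (LINT x|lborel. f (v + x) - f x)"
  proof (intro Bochner_Integration.integral_cong refl)
    fix x
    have "((\<lambda>s. f (s *\<^sub>R v + x)) has_vector_derivative partial_deriv v f (s *\<^sub>R v + x)) (at s within {0..1})" for s
    proof -
      have "(f has_derivative frechet_derivative f (at (s *\<^sub>R v + x))) (at (s *\<^sub>R v + x))"
        using diff frechet_derivative_works by blast
      then have "((\<lambda>s. f (s *\<^sub>R v + x)) has_derivative (\<lambda>h. frechet_derivative f (at (s *\<^sub>R v + x)) (h *\<^sub>R v))) (at s within {0..1})"
        by (rule has_derivative_compose[rotated]) (auto intro!: derivative_eq_intros)
      then show ?thesis
        unfolding has_vector_derivative_def partial_deriv_def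
        by (simp add: linear_scale[OF linear_frechet_derivative[OF diff]])
    qed
    moreover have "continuous_on {0..1} (\<lambda>s. partial_deriv v f (s *\<^sub>R v + x))"
      by (rule continuous_on_compose2[OF cont]) (auto intro!: continuous_intros)
    ultimately show "(LINT s|lborel. ?K s x) = f (v + x) - f x"
      by (subst integral_FTC_Icc[where F = "\<lambda>s. f (s *\<^sub>R v + x)"]) auto
  qed
  also have "\<dots> = 0"
    using integral_lborel_translation[OF f, of v] integrable_lborel_translation[OF f, of v] f by simp
  finally show ?thesis .
qed

section \<open>Inverse transforms of integrable functions and of derivatives\<close>

lemma integrable_iexp_mult:
  fixes f :: "'a::euclidean_space \<Rightarrow> complex"
  assumes "integrable lborel f"
  shows "integrable lborel (\<lambda>x. exp (\<i> * complex_of_real (\<xi> \<bullet> x)) * f x)"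
proof (rule Bochner_Integration.integrable_bound[OF assms])
  have [measurable]: "f \<in> borel_measurable borel"
    using borel_measurable_integrable[OF assms] by simp
  show "(\<lambda>x. exp (\<i> * complex_of_real (\<xi> \<bullet> x)) * f x) \<in> borel_measurable lborel"
    by simp
qed (simp add: norm_mult)

lemma norm_inv_fourier_le:
  fixes f :: "'a::euclidean_space \<Rightarrow> complex"
  assumes "integrable lborel f"
  shows "cmod (inv_fourier f \<xi>) \<le> (2 * pi) powr (- real DIM('a) / 2) * (LINT x|lborel. cmod (f x))"
proof -
  have "cmod (LINT x|lborel. exp (\<i> * complex_of_real (\<xi> \<bullet> x)) * f x) \<le> (LINT x|lborel. cmod (f x))"
    by (rule integral_norm_bound[THEN order_trans]) (simp add: norm_mult)
  then show ?thesis
    unfolding inv_fourier_def norm_mult by (intro mult_mono) auto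
qed

text \<open>Integration by parts without boundary terms: the derivative of exp (i \<xi>.x) f
  integrates to zero. The factor is -i because the kernel of the inverse transform is exp (+i
  \<xi>.x).\<close>

lemma inv_fourier_partial_deriv:
  fixes f :: "'a::euclidean_space \<Rightarrow> complex"
  assumes diff: "\<And>x. f differentiable (at x)" and f: "integrable lborel f"
    and cont: "continuous_on UNIV (partial_deriv v f)" and df: "integrable lborel (partial_deriv v f)"
  shows "inv_fourier (partial_deriv v f) \<xi> = - \<i> * complex_of_real (\<xi> \<bullet> v) * inv_fourier f \<xi>"
proof -
  let ?e = "\<lambda>x. exp (\<i> * complex_of_real (\<xi> \<bullet> x))"
  have deriv: "((\<lambda>x. ?e x * f x) has_derivative
      (\<lambda>h. ?e x * frechet_derivative f (at x) h + (\<i> * complex_of_real (\<xi> \<bullet> h)) * ?e x * f x)) (at x)" for x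
  proof -
    have "(f has_derivative frechet_derivative f (at x)) (at x)"
      using diff frechet_derivative_works by blast
    moreover have "(?e has_derivative (\<lambda>h. ?e x * (\<i> * complex_of_real (\<xi> \<bullet> h)))) (at x)"
      by (rule has_derivative_compose[OF _ DERIV_exp[THEN has_field_derivative_imp_has_derivative]])
        (auto intro!: derivative_eq_intros)
    ultimately show ?thesis
      by (auto intro!: derivative_eq_intros simp: algebra_simps)
  qed
  have pd: "partial_deriv v (\<lambda>x. ?e x * f x) = (\<lambda>x. ?e x * partial_deriv v f x + \<i> * complex_of_real (\<xi> \<bullet> v) * (?e x * f x))"
    unfolding partial_deriv_def
    by (subst frechet_derivative_at[OF deriv, symmetric]) (simp add: algebra_simps)
  have cf: "continuous_on UNIV f"
    using diff by (simp add: continuous_at_imp_continuous_on differentiable_imp_continuous_within)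
  have "(LINT x|lborel. partial_deriv v (\<lambda>x. ?e x * f x) x) = 0"
  proof (rule integral_partial_deriv_eq_0)
    show "(\<lambda>x. ?e x * f x) differentiable (at x)" for x
      using deriv by (auto simp: differentiable_def)
    show "continuous_on UNIV (partial_deriv v (\<lambda>x. ?e x * f x))"
      unfolding pd using cont cf by (intro continuous_intros)
    show "integrable lborel (partial_deriv v (\<lambda>x. ?e x * f x))"
      unfolding pd by (intro Bochner_Integration.integrable_add integrable_mult_right integrable_iexp_mult f df)
  qed (rule integrable_iexp_mult[OF f])
  then have "(LINT x|lborel. ?e x * partial_deriv v f x) + \<i> * complex_of_real (\<xi> \<bullet> v) * (LINT x|lborel. ?e x * f x) = 0"
    unfolding pd using integrable_iexp_mult[OF f] integrable_iexp_mult[OF df] by simp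
  then have "(LINT x|lborel. ?e x * partial_deriv v f x) = - \<i> * complex_of_real (\<xi> \<bullet> v) * (LINT x|lborel. ?e x * f x)"
    by (simp add: add_eq_0_iff2)
  then show ?thesis
    unfolding inv_fourier_def by simp
qed

lemma continuous_inv_fourier:
  fixes f :: "'a::euclidean_space \<Rightarrow> complex"
  assumes f: "integrable lborel f"
  shows "continuous_on UNIV (inv_fourier f)"
proof -
  have [measurable]: "f \<in> borel_measurable borel"
    using borel_measurable_integrable[OF f] by simp
  have "continuous_on UNIV (\<lambda>\<xi>. LINT x|lborel. exp (\<i> * complex_of_real (\<xi> \<bullet> x)) * f x)"
    unfolding continuous_on_sequentially comp_def
  proof (intro ballI allI impI, elim conjE)
    fix \<xi> :: 'a and u assume u: "u \<longlonglongrightarrow> \<xi>"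
    show "(\<lambda>n. LINT x|lborel. exp (\<i> * complex_of_real (u n \<bullet> x)) * f x)
        \<longlonglongrightarrow> (LINT x|lborel. exp (\<i> * complex_of_real (\<xi> \<bullet> x)) * f x)"
    proof (rule integral_dominated_convergence)
      show "integrable lborel (\<lambda>x. cmod (f x))" using f by (rule integrable_norm)
      show "AE x in lborel. (\<lambda>n. exp (\<i> * complex_of_real (u n \<bullet> x)) * f x)
          \<longlonglongrightarrow> exp (\<i> * complex_of_real (\<xi> \<bullet> x)) * f x"
        using u by (intro AE_I2 tendsto_intros)
    qed (simp_all add: norm_mult)
  qed
  then show ?thesis
    unfolding inv_fourier_def[abs_def] by (intro continuous_intros)
qed

text \<open>Every factor 1 + (x.b)^2 is at most 1 + |x|^2, so the weight lies below a product of
  one-dimensional Cauchy densities. This replaces polar coordinates.\<close>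

lemma integrable_weight:
  assumes "N \<ge> DIM('a::euclidean_space)"
  shows "integrable lborel (\<lambda>x::'a. 1 / (1 + (norm x)\<^sup>2) ^ N)"
proof (rule Bochner_Integration.integrable_bound)
  show "integrable lborel (\<lambda>x::'a. \<Prod>b\<in>Basis. 1 / (1 + (x \<bullet> b)\<^sup>2))"
    by (rule integrable_lborel_prod[OF integrable_inverse_1_plus_square_lborel])
  show "(\<lambda>x::'a. 1 / (1 + (norm x)\<^sup>2) ^ N) \<in> borel_measurable lborel"
    by simp
  have "1 / (1 + (norm x)\<^sup>2) ^ N \<le> (\<Prod>b\<in>Basis. 1 / (1 + (x \<bullet> b)\<^sup>2))" for x :: 'a
  proof -
    have "1 / (1 + (norm x)\<^sup>2) ^ N \<le> 1 / (1 + (norm x)\<^sup>2) ^ DIM('a)"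
      using assms by (intro divide_left_mono power_increasing) (auto simp: add_pos_nonneg)
    also have "\<dots> = (\<Prod>b\<in>(Basis::'a set). 1 / (1 + (norm x)\<^sup>2))"
      by (simp add: power_one_over)
    also have "\<dots> \<le> (\<Prod>b\<in>Basis. 1 / (1 + (x \<bullet> b)\<^sup>2))"
    proof (rule prod_mono)
      fix b :: 'a assume "b \<in> Basis"
      then have "\<bar>x \<bullet> b\<bar> \<le> \<bar>norm x\<bar>" using Basis_le_norm by fastforce
      then have "(x \<bullet> b)\<^sup>2 \<le> (norm x)\<^sup>2" by (simp only: abs_le_square_iff)
      then show "0 \<le> 1 / (1 + (norm x)\<^sup>2) \<and> 1 / (1 + (norm x)\<^sup>2) \<le> 1 / (1 + (x \<bullet> b)\<^sup>2)"
        by (auto intro!: divide_left_mono simp: add_pos_nonneg)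
    qed
    finally show ?thesis .
  qed
  moreover have "0 \<le> 1 / (1 + (norm x)\<^sup>2) ^ N" for x :: 'a by simp
  ultimately show "AE x::'a in lborel. norm (1 / (1 + (norm x)\<^sup>2) ^ N) \<le> norm (\<Prod>b\<in>Basis. 1 / (1 + (x \<bullet> b)\<^sup>2))"
    by (intro AE_I2) (smt (verit) real_norm_def)
qed

lemma one_plus_square_power_le: "(1 + x\<^sup>2) ^ N \<le> 2 ^ N * (1 + (\<bar>x\<bar> :: real) ^ (2 * N))"
proof -
  have "1 + x\<^sup>2 \<le> 2 * max 1 (x\<^sup>2)" by (auto simp: max_def)
  then have "(1 + x\<^sup>2) ^ N \<le> (2 * max 1 (x\<^sup>2)) ^ N" by (rule power_mono) simp
  also have "\<dots> = 2 ^ N * max 1 (x\<^sup>2) ^ N" by (rule power_mult_distrib)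
  also have "max 1 (x\<^sup>2) ^ N \<le> 1 + \<bar>x\<bar> ^ (2 * N)" by (auto simp: max_def power_mult)
  finally show ?thesis by simp
qed

text \<open>The defining seminorms bound separate powers of the norm; those of order 0 and 2N
  together give the weight (1 + |x|^2)^N, by \<open>one_plus_square_power_le\<close>.\<close>

lemma schwartz_decay:
  fixes f :: "'a::euclidean_space \<Rightarrow> complex"
  assumes "schwartz f" "vs \<in> lists Basis"
  obtains C where "C \<ge> 0" "\<And>x. cmod (iter_partial vs f x) \<le> C / (1 + (norm x)\<^sup>2) ^ N"
proof -
  obtain A where A: "\<And>x. norm x ^ 0 * cmod (iter_partial vs f x) \<le> A"
    using assms unfolding schwartz_def by meson
  obtain B where B: "\<And>x. norm x ^ (2 * N) * cmod (iter_partial vs f x) \<le> B"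
    using assms unfolding schwartz_def by meson
  have "cmod (iter_partial vs f x) \<le> (2 ^ N * (A + B)) / (1 + (norm x)\<^sup>2) ^ N" for x
  proof -
    have "(1 + (norm x)\<^sup>2) ^ N * cmod (iter_partial vs f x) \<le> 2 ^ N * (1 + \<bar>norm x\<bar> ^ (2 * N)) * cmod (iter_partial vs f x)"
      by (intro mult_right_mono one_plus_square_power_le) simp
    also have "\<dots> = 2 ^ N * (norm x ^ 0 * cmod (iter_partial vs f x) + norm x ^ (2 * N) * cmod (iter_partial vs f x))"
      by (simp add: algebra_simps)
    also have "\<dots> \<le> 2 ^ N * (A + B)"
      using A[of x] B[of x] by (intro mult_left_mono) auto
    finally show ?thesis
      by (simp add: pos_le_divide_eq add_pos_nonneg mult.commute)
  qed
  moreover have "0 \<le> 2 ^ N * (A + B)"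
    using order_trans[OF _ A[of 0]] order_trans[OF _ B[of 0]] by simp
  ultimately show ?thesis using that by blast
qed

lemma smooth_iter_partial_continuous:
  assumes "smooth f" "vs \<in> lists Basis"
  shows "continuous_on UNIV (iter_partial vs f)"
  using assms unfolding smooth_def
  by (simp add: continuous_at_imp_continuous_on differentiable_imp_continuous_within)

lemma schwartz_integrable:
  fixes f :: "'a::euclidean_space \<Rightarrow> complex"
  assumes f: "schwartz f" and vs: "vs \<in> lists Basis"
  shows "integrable lborel (iter_partial vs f)"
proof -
  obtain C where C: "\<And>x. cmod (iter_partial vs f x) \<le> C / (1 + (norm x)\<^sup>2) ^ DIM('a)"
    using schwartz_decay[OF assms] by metis
  show ?thesis
  proof (rule Bochner_Integration.integrable_bound)
    show "integrable lborel (\<lambda>x::'a. C * (1 / (1 + (norm x)\<^sup>2) ^ DIM('a)))"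
      by (intro integrable_mult_right integrable_weight) simp
    show "iter_partial vs f \<in> borel_measurable lborel"
      using f vs by (intro continuous_imp_borel_measurable_lborel smooth_iter_partial_continuous)
        (auto simp: schwartz_def)
    show "AE x in lborel. cmod (iter_partial vs f x) \<le> norm (C * (1 / (1 + (norm x)\<^sup>2) ^ DIM('a)))"
      unfolding real_norm_def using C by (intro AE_I2 order_trans[OF _ abs_ge_self]) simp
  qed
qed

lemma inv_fourier_iter_partial:
  fixes f :: "'a::euclidean_space \<Rightarrow> complex"
  assumes f: "schwartz f" and vs: "vs \<in> lists Basis"
  shows "inv_fourier (iter_partial vs f) \<xi> = (\<Prod>v\<leftarrow>vs. - \<i> * complex_of_real (\<xi> \<bullet> v)) * inv_fourier f \<xi>"
  using vs
proof (induction vs)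
  case (Cons v vs)
  have "inv_fourier (partial_deriv v (iter_partial vs f)) \<xi> =
      - \<i> * complex_of_real (\<xi> \<bullet> v) * inv_fourier (iter_partial vs f) \<xi>"
  proof (rule inv_fourier_partial_deriv)
    show "iter_partial vs f differentiable (at x)" for x
      using f Cons(2) unfolding schwartz_def smooth_def by blast
    show "integrable lborel (iter_partial vs f)"
      by (rule schwartz_integrable[OF f Cons(2)])
    show "integrable lborel (partial_deriv v (iter_partial vs f))"
      using schwartz_integrable[OF f, of "v # vs"] Cons(1,2) by simp
    show "continuous_on UNIV (partial_deriv v (iter_partial vs f))"
      using smooth_iter_partial_continuous[of f "v # vs"] f Cons(1,2) by (simp add: schwartz_def)
  qed
  with Cons show ?case by simp
qed simp

text \<open>Differentiating repeatedly in one basis direction yields decay of the transform in that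
  coordinate; this inequality assembles decay in the norm from decay in the coordinates.\<close>

lemma norm_power_le_sum_Basis:
  fixes x :: "'a::euclidean_space"
  shows "norm x ^ k \<le> real DIM('a) ^ k * (\<Sum>b\<in>Basis. \<bar>x \<bullet> b\<bar> ^ k)"
proof -
  let ?A = "(\<lambda>b. \<bar>x \<bullet> b\<bar>) ` (Basis :: 'a set)"
  have "Max ?A \<in> ?A" by (intro Max_in) auto
  then obtain c where "c \<in> Basis" "Max ?A = \<bar>x \<bullet> c\<bar>" by blast
  then have c: "c \<in> Basis" "\<And>b. b \<in> Basis \<Longrightarrow> \<bar>x \<bullet> b\<bar> \<le> \<bar>x \<bullet> c\<bar>"
    using Max_ge[of ?A] by auto
  have "norm x \<le> (\<Sum>b\<in>Basis. \<bar>x \<bullet> b\<bar>)" by (rule norm_le_l1)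
  also have "\<dots> \<le> real DIM('a) * \<bar>x \<bullet> c\<bar>" by (rule sum_bounded_above) (rule c(2))
  finally have "norm x ^ k \<le> (real DIM('a) * \<bar>x \<bullet> c\<bar>) ^ k" by (rule power_mono) simp
  also have "\<dots> = real DIM('a) ^ k * \<bar>x \<bullet> c\<bar> ^ k" by (rule power_mult_distrib)
  also have "\<dots> \<le> real DIM('a) ^ k * (\<Sum>b\<in>Basis. \<bar>x \<bullet> b\<bar> ^ k)"
    by (intro mult_left_mono member_le_sum c) auto
  finally show ?thesis .
qed

text \<open>Pure derivatives of order 2N along the basis directions suffice: their transforms are
  bounded by L1 norms and equal, up to sign, (\<xi>.b)^(2N) times the transform of
  \<open>f\<close>.\<close>

lemma inv_fourier_decay:
  fixes f :: "'a::euclidean_space \<Rightarrow> complex"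
  assumes f: "schwartz f"
  obtains C where "C \<ge> 0" "\<And>\<xi>. cmod (inv_fourier f \<xi>) \<le> C / (1 + (norm \<xi>)\<^sup>2) ^ N"
proof -
  let ?p = "(2 * pi) powr (- real DIM('a) / 2)"
  let ?I = "\<lambda>vs. ?p * (LINT x|lborel. cmod (iter_partial vs f x))"
  have bd: "cmod (inv_fourier (iter_partial vs f) \<xi>) \<le> ?I vs" if "vs \<in> lists Basis" for vs \<xi>
    by (rule norm_inv_fourier_le[OF schwartz_integrable[OF f that]])
  define C where "C = 2 ^ N * (?I [] + real DIM('a) ^ (2 * N) * (\<Sum>b\<in>Basis. ?I (replicate (2 * N) b)))"
  have "cmod (inv_fourier f \<xi>) \<le> C / (1 + (norm \<xi>)\<^sup>2) ^ N" for \<xi>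
  proof -
    have "\<bar>\<xi> \<bullet> b\<bar> ^ (2 * N) * cmod (inv_fourier f \<xi>) \<le> ?I (replicate (2 * N) b)" if b: "b \<in> Basis" for b
    proof -
      have "replicate (2 * N) b \<in> lists Basis" using b by auto
      from bd[OF this, of \<xi>] inv_fourier_iter_partial[OF f this, of \<xi>] show ?thesis
        by (simp add: norm_mult norm_power)
    qed
    note coord = this
    have "norm \<xi> ^ (2 * N) * cmod (inv_fourier f \<xi>) \<le>
        real DIM('a) ^ (2 * N) * (\<Sum>b\<in>Basis. \<bar>\<xi> \<bullet> b\<bar> ^ (2 * N)) * cmod (inv_fourier f \<xi>)"
      by (intro mult_right_mono norm_power_le_sum_Basis) simp
    also have "\<dots> = real DIM('a) ^ (2 * N) * (\<Sum>b\<in>Basis. \<bar>\<xi> \<bullet> b\<bar> ^ (2 * N) * cmod (inv_fourier f \<xi>))"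
      by (simp only: mult.assoc sum_distrib_right)
    also have "\<dots> \<le> real DIM('a) ^ (2 * N) * (\<Sum>b\<in>Basis. ?I (replicate (2 * N) b))"
      by (intro mult_left_mono sum_mono coord) auto
    finally have "norm \<xi> ^ (2 * N) * cmod (inv_fourier f \<xi>) \<le>
        real DIM('a) ^ (2 * N) * (\<Sum>b\<in>Basis. ?I (replicate (2 * N) b))" .
    moreover have "cmod (inv_fourier f \<xi>) \<le> ?I []"
      using bd[of "[]" \<xi>] by simp
    moreover have "(1 + (norm \<xi>)\<^sup>2) ^ N * cmod (inv_fourier f \<xi>) \<le>
        2 ^ N * (1 + \<bar>norm \<xi>\<bar> ^ (2 * N)) * cmod (inv_fourier f \<xi>)"
      by (intro mult_right_mono one_plus_square_power_le) simp
    moreover have "2 ^ N * (1 + \<bar>norm \<xi>\<bar> ^ (2 * N)) * cmod (inv_fourier f \<xi>) =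
        2 ^ N * (cmod (inv_fourier f \<xi>) + norm \<xi> ^ (2 * N) * cmod (inv_fourier f \<xi>))"
      by (simp add: algebra_simps)
    ultimately have "(1 + (norm \<xi>)\<^sup>2) ^ N * cmod (inv_fourier f \<xi>) \<le> C"
      unfolding C_def by (smt (verit) mult_left_mono zero_le_power)
    then show ?thesis
      by (simp add: pos_le_divide_eq add_pos_nonneg mult.commute)
  qed
  moreover have "C \<ge> 0"
    unfolding C_def by (intro mult_nonneg_nonneg add_nonneg_nonneg sum_nonneg) auto
  ultimately show ?thesis using that by blast
qed

text \<open>Closedness of \<open>K\<close> makes \<open>f\<close> vanish on a whole neighbourhood of
  \<open>x\<close>, so the derivatives see the zero function.\<close>

lemma iter_partial_eq_0:
  fixes f :: "'a::euclidean_space \<Rightarrow> complex"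
  assumes "closed K" "\<And>x. x \<notin> K \<Longrightarrow> f x = 0" "x \<notin> K"
  shows "iter_partial vs f x = 0"
  using assms(3)
proof (induction vs arbitrary: x)
  case (Cons v vs)
  have "((\<lambda>_. 0) has_derivative (\<lambda>_. 0)) (at x)" by simp
  then have "(iter_partial vs f has_derivative (\<lambda>_. 0)) (at x)"
    by (rule has_derivative_transform_within_open[where s = "- K"])
      (use assms(1) Cons in \<open>auto simp: open_Compl\<close>)
  then show ?case
    by (simp add: partial_deriv_def frechet_derivative_at[symmetric])
qed (use assms(2) in simp)

lemma test_function_imp_schwartz:
  fixes f :: "'a::euclidean_space \<Rightarrow> complex"
  assumes "test_function f"
  shows "schwartz f"
proof -
  obtain K where sm: "smooth f" and K: "compact K" "\<And>x. x \<notin> K \<Longrightarrow> f x = 0"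
    using assms by (auto simp: test_function_def)
  have "\<exists>C. \<forall>x. norm x ^ k * cmod (iter_partial vs f x) \<le> C" if vs: "vs \<in> lists Basis" for vs k
  proof -
    let ?g = "\<lambda>x. norm x ^ k * cmod (iter_partial vs f x)"
    have "compact (?g ` K)"
      by (intro compact_continuous_image K continuous_intros
          continuous_on_subset[OF smooth_iter_partial_continuous[OF sm vs]]) simp
    then have "bounded (?g ` K)" by (rule compact_imp_bounded)
    then obtain C where C: "\<forall>y\<in>?g ` K. norm y \<le> C" unfolding bounded_iff ..
    have "?g x \<le> max C 0" for x
    proof (cases "x \<in> K")
      case True
      with C have "norm (?g x) \<le> C" by blast
      then show ?thesis by simp
    next
      case False
      with iter_partial_eq_0[OF compact_imp_closed[OF K(1)] K(2)] show ?thesis by simp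
    qed
    then show ?thesis by blast
  qed
  with sm show ?thesis by (simp add: schwartz_def)
qed

section \<open>Gaussian regularisation and inversion at the origin\<close>

lemma integral_lborel_scale:
  fixes f :: "'a::euclidean_space \<Rightarrow> 'b::{banach,second_countable_topology}"
  assumes c: "c \<noteq> 0" and [measurable]: "f \<in> borel_measurable borel"
  shows "(LINT x|lborel. f x) = \<bar>c\<bar> ^ DIM('a) *\<^sub>R (LINT x|lborel. f (c *\<^sub>R x))"
  by (subst lborel_affine[OF c, of 0]) (simp add: integral_density integral_distr)

lemma gaussian_norm_fourier:
  fixes x :: "'a::euclidean_space"
  assumes k: "\<kappa> > 0"
  shows "integrable lborel (\<lambda>y. exp (\<i> * of_real (x \<bullet> y)) * of_real (exp (- \<kappa> * (norm y)\<^sup>2)))"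
    and "(LINT y|lborel. exp (\<i> * of_real (x \<bullet> y)) * of_real (exp (- \<kappa> * (norm y)\<^sup>2))) =
      complex_of_real (sqrt (pi / \<kappa>) ^ DIM('a) * exp (- (norm x)\<^sup>2 / (4 * \<kappa>)))"
proof -
  have nrm: "(\<Sum>b\<in>Basis. complex_of_real ((y \<bullet> b)\<^sup>2)) = of_real ((norm y)\<^sup>2)" for y :: 'a
  proof -
    have "(norm y)\<^sup>2 = (\<Sum>b\<in>Basis. (y \<bullet> b)\<^sup>2)"
      unfolding power2_norm_eq_inner by (subst euclidean_inner) (simp only: power2_eq_square)
    then show ?thesis by simp
  qed
  have eq: "exp (\<i> * of_real (x \<bullet> y) - of_real \<kappa> * (\<Sum>b\<in>Basis. cis 0 * of_real ((y \<bullet> b)\<^sup>2))) =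
     exp (\<i> * of_real (x \<bullet> y)) * of_real (exp (- \<kappa> * (norm y)\<^sup>2))" for y
    using nrm[of y] by (simp add: exp_diff exp_minus field_simps flip: exp_of_real)
  show "integrable lborel (\<lambda>y. exp (\<i> * of_real (x \<bullet> y)) * of_real (exp (- \<kappa> * (norm y)\<^sup>2)))"
    using integrable_gaussian_lborel[OF k, of "\<lambda>_. 0" x] unfolding eq by simp
  show "(LINT y|lborel. exp (\<i> * of_real (x \<bullet> y)) * of_real (exp (- \<kappa> * (norm y)\<^sup>2))) =
      complex_of_real (sqrt (pi / \<kappa>) ^ DIM('a) * exp (- (norm x)\<^sup>2 / (4 * \<kappa>)))"
    using integral_gaussian_lborel[OF k, of "\<lambda>_. 0" x] nrm[of x] unfolding eq
    by (simp flip: exp_of_real)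
qed

lemma gaussian_norm_integral:
  assumes k: "\<kappa> > 0"
  shows "integrable lborel (\<lambda>y::'a::euclidean_space. exp (- \<kappa> * (norm y)\<^sup>2))"
    and "(LINT y::'a|lborel. exp (- \<kappa> * (norm y)\<^sup>2)) = sqrt (pi / \<kappa>) ^ DIM('a)"
proof -
  have "integrable lborel (\<lambda>y::'a. complex_of_real (exp (- \<kappa> * (norm y)\<^sup>2)))"
    using gaussian_norm_fourier(1)[OF k, of "0::'a"] by simp
  then show "integrable lborel (\<lambda>y::'a. exp (- \<kappa> * (norm y)\<^sup>2))"
    by (simp only: complex_of_real_integrable_eq)
  have "complex_of_real (LINT y::'a|lborel. exp (- \<kappa> * (norm y)\<^sup>2)) = complex_of_real (sqrt (pi / \<kappa>) ^ DIM('a))"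
    using gaussian_norm_fourier(2)[OF k, of "0::'a"]
    by (simp del: of_real_exp flip: integral_complex_of_real)
  then show "(LINT y::'a|lborel. exp (- \<kappa> * (norm y)\<^sup>2)) = sqrt (pi / \<kappa>) ^ DIM('a)"
    by (simp only: of_real_eq_iff)
qed

text \<open>Fubini moves the transform from \<open>f\<close> to \<open>g\<close>. The side of
  \<open>g\<close> is left unnormalised, as the Gaussian integrals are computed without the factor
  (2 pi)^(-n/2).\<close>

lemma integral_mult_inv_fourier:
  fixes f g :: "'a::euclidean_space \<Rightarrow> complex"
  assumes f: "integrable lborel f" and g: "integrable lborel g"
  shows "(LINT \<xi>|lborel. g \<xi> * inv_fourier f \<xi>) = complex_of_real ((2 * pi) powr (- real DIM('a) / 2)) *
    (LINT x|lborel. f x * (LINT \<xi>|lborel. exp (\<i> * complex_of_real (x \<bullet> \<xi>)) * g \<xi>))"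
proof -
  let ?K = "\<lambda>\<xi> x. g \<xi> * (exp (\<i> * complex_of_real (\<xi> \<bullet> x)) * f x)"
  have [measurable]: "f \<in> borel_measurable borel" "g \<in> borel_measurable borel"
    using borel_measurable_integrable[OF f] borel_measurable_integrable[OF g] by simp_all
  have [measurable]: "(\<lambda>p::'a \<times> 'a. f (snd p)) \<in> borel_measurable borel"
      "(\<lambda>p::'a \<times> 'a. g (fst p)) \<in> borel_measurable borel"
    by (rule measurable_compose[OF borel_measurable_continuous_onI];
        simp add: continuous_on_fst continuous_on_snd continuous_on_id)+
  have [measurable]: "(\<lambda>p::'a \<times> 'a. fst p \<bullet> snd p) \<in> borel_measurable borel"
    by (intro borel_measurable_continuous_onI continuous_intros)
  have int: "integrable (lborel \<Otimes>\<^sub>M lborel) (case_prod ?K)"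
  proof (rule integrable_lborel_pair)
    show "case_prod ?K \<in> borel_measurable borel"
      unfolding case_prod_unfold by measurable
    show "integrable lborel (?K \<xi>)" for \<xi>
      by (intro integrable_mult_right integrable_iexp_mult f)
    show "integrable lborel (\<lambda>\<xi>. cmod (g \<xi>) * (LINT x|lborel. cmod (f x)))"
      by (intro integrable_mult_left integrable_norm g)
  qed (simp add: norm_mult)
  have "(LINT \<xi>|lborel. g \<xi> * inv_fourier f \<xi>) = complex_of_real ((2 * pi) powr (- real DIM('a) / 2)) *
      (LINT \<xi>|lborel. LINT x|lborel. ?K \<xi> x)"
  proof -
    have "(LINT \<xi>|lborel. g \<xi> * inv_fourier f \<xi>) =
        (LINT \<xi>|lborel. complex_of_real ((2 * pi) powr (- real DIM('a) / 2)) * (LINT x|lborel. ?K \<xi> x))"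
      unfolding inv_fourier_def
      by (intro Bochner_Integration.integral_cong refl, subst integral_mult_right_zero) (rule mult.left_commute)
    then show ?thesis by (simp only: integral_mult_right_zero)
  qed
  also have "(LINT \<xi>|lborel. LINT x|lborel. ?K \<xi> x) = (LINT x|lborel. LINT \<xi>|lborel. ?K \<xi> x)"
    by (rule lborel_pair.Fubini_integral[OF int, symmetric])
  also have "\<dots> = (LINT x|lborel. f x * (LINT \<xi>|lborel. exp (\<i> * complex_of_real (x \<bullet> \<xi>)) * g \<xi>))"
  proof (intro Bochner_Integration.integral_cong refl)
    fix x
    have eq: "?K \<xi> x = f x * (exp (\<i> * complex_of_real (x \<bullet> \<xi>)) * g \<xi>)" for \<xi>
      by (simp add: inner_commute)
    show "(LINT \<xi>|lborel. ?K \<xi> x) = f x * (LINT \<xi>|lborel. exp (\<i> * complex_of_real (x \<bullet> \<xi>)) * g \<xi>)"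
      unfolding eq by (rule integral_mult_right_zero)
  qed
  finally show ?thesis .
qed

text \<open>The integrand is damped by a Gaussian, the transform is moved onto that Gaussian, and
  the resulting approximate identity concentrates at the origin. The value at 0 is the one that the
  delta distribution tests.\<close>

lemma fourier_inversion_0:
  fixes f :: "'a::euclidean_space \<Rightarrow> complex"
  assumes f: "integrable lborel f" and cont: "continuous_on UNIV f"
    and bdd: "\<And>x. cmod (f x) \<le> M" and ff: "integrable lborel (inv_fourier f)"
  shows "(LINT \<xi>|lborel. inv_fourier f \<xi>) = complex_of_real ((2 * pi) powr (real DIM('a) / 2)) * f 0"
proof -
  define p where "p = complex_of_real ((2 * pi) powr (- real DIM('a) / 2))"
  have [measurable]: "f \<in> borel_measurable borel"
    using cont by (rule borel_measurable_continuous_onI)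
  have [measurable]: "inv_fourier f \<in> borel_measurable borel"
    using borel_measurable_integrable[OF ff] by simp
  \<comment> \<open>With this choice 4 k j = (j + 1)^(-2), so the transformed Gaussian is a multiple
    of exp (-(j + 1)^2 |x|^2), and rescaling by 1 / (j + 1) removes j from the exponent.\<close>
  define k where "k j = 1 / (4 * (real (Suc j))\<^sup>2)" for j
  have k: "k j > 0" for j by (simp add: k_def)
  let ?g = "\<lambda>j \<xi>::'a. complex_of_real (exp (- k j * (norm \<xi>)\<^sup>2))"
  have "(\<lambda>j. LINT \<xi>|lborel. ?g j \<xi> * inv_fourier f \<xi>) \<longlonglongrightarrow> (LINT \<xi>|lborel. inv_fourier f \<xi>)"
  proof (rule integral_dominated_convergence)
    show "integrable lborel (\<lambda>\<xi>. cmod (inv_fourier f \<xi>))"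
      using ff by (rule integrable_norm)
    have "k \<longlonglongrightarrow> 0" unfolding k_def by real_asymp
    then have "(\<lambda>j. ?g j \<xi> * inv_fourier f \<xi>) \<longlonglongrightarrow> of_real (exp (- 0 * (norm \<xi>)\<^sup>2)) * inv_fourier f \<xi>" for \<xi>
      by (intro tendsto_intros)
    then show "AE \<xi> in lborel. (\<lambda>j. ?g j \<xi> * inv_fourier f \<xi>) \<longlonglongrightarrow> inv_fourier f \<xi>"
      by simp
    show "AE \<xi> in lborel. cmod (?g j \<xi> * inv_fourier f \<xi>) \<le> cmod (inv_fourier f \<xi>)" for j
      using k[of j] by (intro AE_I2) (auto simp: norm_mult less_imp_le intro!: mult_left_le_one_le)
  qed measurable
  moreover have "(\<lambda>j. LINT \<xi>|lborel. ?g j \<xi> * inv_fourier f \<xi>) \<longlonglongrightarrow>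
      p * of_real ((2 * sqrt pi) ^ DIM('a)) * (LINT y|lborel. f 0 * of_real (exp (- (norm (y::'a))\<^sup>2)))"
  proof -
    have eq: "(LINT \<xi>|lborel. ?g j \<xi> * inv_fourier f \<xi>) =
        p * of_real ((2 * sqrt pi) ^ DIM('a)) * (LINT y|lborel. f ((1 / real (Suc j)) *\<^sub>R y) * of_real (exp (- (norm (y::'a))\<^sup>2)))" for j
    proof -
      let ?G = "\<lambda>x::'a. f x * complex_of_real (sqrt (pi / k j) ^ DIM('a) * exp (- (norm x)\<^sup>2 / (4 * k j)))"
      have int: "integrable lborel (?g j)"
        using gaussian_norm_fourier(1)[OF k, of "0::'a" j] by simp
      have "(LINT \<xi>|lborel. ?g j \<xi> * inv_fourier f \<xi>) = p * (LINT x|lborel. ?G x)"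
        unfolding p_def integral_mult_inv_fourier[OF f int] gaussian_norm_fourier(2)[OF k] ..
      also have "(LINT x|lborel. ?G x) = (1 / real (Suc j)) ^ DIM('a) *\<^sub>R (LINT y|lborel. ?G ((1 / real (Suc j)) *\<^sub>R y))"
        by (subst integral_lborel_scale[of "1 / real (Suc j)"]) simp_all
      also have "(\<lambda>y. ?G ((1 / real (Suc j)) *\<^sub>R y)) =
          (\<lambda>y. of_real ((2 * sqrt pi) ^ DIM('a) * real (Suc j) ^ DIM('a)) *
             (f ((1 / real (Suc j)) *\<^sub>R y) * of_real (exp (- (norm y)\<^sup>2))))"
      proof
        fix y :: 'a
        have "pi / k j = (2 * sqrt pi * real (Suc j))\<^sup>2"
          by (simp add: k_def power_mult_distrib)
        then have 1: "sqrt (pi / k j) = 2 * sqrt pi * real (Suc j)"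
          by simp
        have "4 * k j = (1 / real (Suc j))\<^sup>2"
          by (simp add: k_def power_divide)
        then have 2: "(norm ((1 / real (Suc j)) *\<^sub>R y))\<^sup>2 / (4 * k j) = (norm y)\<^sup>2"
          by (simp add: power_mult_distrib power_divide)
        show "?G ((1 / real (Suc j)) *\<^sub>R y) = of_real ((2 * sqrt pi) ^ DIM('a) * real (Suc j) ^ DIM('a)) *
             (f ((1 / real (Suc j)) *\<^sub>R y) * of_real (exp (- (norm y)\<^sup>2)))"
          unfolding minus_divide_left[symmetric] 1 2 by (simp only: power_mult_distrib of_real_mult mult_ac)
      qed
      finally show ?thesis
        by (simp add: scaleR_conv_of_real power_one_over del: of_nat_Suc)
    qed
    have "(\<lambda>j. LINT y|lborel. f ((1 / real (Suc j)) *\<^sub>R y) * of_real (exp (- (norm (y::'a))\<^sup>2)))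
        \<longlonglongrightarrow> (LINT y|lborel. f 0 * of_real (exp (- (norm (y::'a))\<^sup>2)))"
    proof (rule integral_dominated_convergence)
      show "integrable lborel (\<lambda>y::'a. M * exp (- (norm y)\<^sup>2))"
        using gaussian_norm_integral(1)[of 1, where 'a = 'a] by simp
      show "AE y::'a in lborel. (\<lambda>j. f ((1 / real (Suc j)) *\<^sub>R y) * of_real (exp (- (norm y)\<^sup>2)))
          \<longlonglongrightarrow> f 0 * of_real (exp (- (norm y)\<^sup>2))"
      proof (intro AE_I2 tendsto_mult_right)
        fix y :: 'a
        have "(\<lambda>j. 1 / real (Suc j)) \<longlonglongrightarrow> 0" by real_asymp
        then have "(\<lambda>j. (1 / real (Suc j)) *\<^sub>R y) \<longlonglongrightarrow> 0 *\<^sub>R y" by (intro tendsto_intros)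
        moreover have "isCont f 0" using cont by (simp add: continuous_on_eq_continuous_at)
        ultimately show "(\<lambda>j. f ((1 / real (Suc j)) *\<^sub>R y)) \<longlonglongrightarrow> f 0"
          by (intro isCont_tendsto_compose[of 0 f]) simp_all
      qed
      show "AE y::'a in lborel. cmod (f ((1 / real (Suc j)) *\<^sub>R y) * of_real (exp (- (norm y)\<^sup>2))) \<le> M * exp (- (norm y)\<^sup>2)" for j
        using bdd by (intro AE_I2) (simp add: norm_mult)
    qed measurable
    then show ?thesis unfolding eq by (rule tendsto_mult_left)
  qed
  ultimately have "(LINT \<xi>|lborel. inv_fourier f \<xi>) =
      p * of_real ((2 * sqrt pi) ^ DIM('a)) * (LINT y|lborel. f 0 * of_real (exp (- (norm (y::'a))\<^sup>2)))"
    by (rule LIMSEQ_unique)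
  also have "(LINT y|lborel. f 0 * of_real (exp (- (norm (y::'a))\<^sup>2))) = f 0 * of_real (sqrt pi ^ DIM('a))"
    using gaussian_norm_fourier(2)[of 1 "0::'a"] by simp
  also have "p * of_real ((2 * sqrt pi) ^ DIM('a)) * (f 0 * of_real (sqrt pi ^ DIM('a))) =
      of_real ((2 * pi) powr (- real DIM('a) / 2) * ((2 * sqrt pi) ^ DIM('a) * sqrt pi ^ DIM('a))) * f 0"
    by (simp add: p_def)
  also have "(2 * sqrt pi) ^ DIM('a) * sqrt pi ^ DIM('a) = (2 * pi) powr real DIM('a)"
  proof -
    have "(2 * sqrt pi) ^ DIM('a) * sqrt pi ^ DIM('a) = (2 * pi) ^ DIM('a)"
      by (simp only: power_mult_distrib[symmetric] mult.assoc) simp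
    then show ?thesis by (simp add: powr_realpow)
  qed
  also have "(2 * pi) powr (- real DIM('a) / 2) * (2 * pi) powr real DIM('a) = (2 * pi) powr (real DIM('a) / 2)"
    by (simp flip: powr_add)
  finally show ?thesis .
qed

section \<open>The Gaussian superposition\<close>

lemma sum_Basis_prod:
  fixes f :: "'a::euclidean_space \<times> 'b::euclidean_space \<Rightarrow> 'c::comm_monoid_add"
  shows "(\<Sum>b\<in>Basis. f b) = (\<Sum>u\<in>Basis. f (u, 0)) + (\<Sum>v\<in>Basis. f (0, v))"
proof -
  have "(\<Sum>b\<in>Basis. f b) = (\<Sum>b\<in>(\<lambda>u. (u, 0)) ` Basis. f b) + (\<Sum>b\<in>(\<lambda>v. (0, v)) ` Basis. f b)"
    unfolding Basis_prod_def by (rule sum.union_disjoint) auto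
  then show ?thesis
    by (simp add: sum.reindex inj_on_def)
qed

definition heat :: "real \<Rightarrow> real \<Rightarrow> (real ^ 'm::finite) \<times> real \<Rightarrow> complex" where
  "heat \<theta> \<kappa> \<xi> = exp (- of_real \<kappa> *
     (cis \<theta> * of_real ((norm (fst \<xi>))\<^sup>2) + cis (- \<theta>) * of_real ((snd \<xi>)\<^sup>2)))"

text \<open>The transform of \<open>heat\<close> without the factor (2 pi)^(-n/2), see
  \<open>heat_fourier\<close>. Here n = CARD('m) + 1; the angles in the exponent change sign, and
  CARD('m) - 1 counts the angles of \<open>heat\<close> with their signs.\<close>

definition heat_hat :: "real \<Rightarrow> real \<Rightarrow> (real ^ 'm::finite) \<times> real \<Rightarrow> complex" where
  "heat_hat \<theta> \<kappa> x = of_real (sqrt (pi / \<kappa>) ^ (CARD('m) + 1)) * cis (- (real CARD('m) - 1) * \<theta> / 2) *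
     exp (- (cis (- \<theta>) * of_real ((norm (fst x))\<^sup>2) + cis \<theta> * of_real ((snd x)\<^sup>2)) / of_real (4 * \<kappa>))"

lemma heat_fourier:
  fixes x :: "(real ^ 'm::finite) \<times> real"
  assumes k: "\<kappa> > 0" and th: "\<bar>\<theta>\<bar> < pi / 2"
  shows "integrable lborel (\<lambda>\<xi>. exp (\<i> * of_real (x \<bullet> \<xi>)) * heat \<theta> \<kappa> \<xi>)"
    and "(LINT \<xi>|lborel. exp (\<i> * of_real (x \<bullet> \<xi>)) * heat \<theta> \<kappa> \<xi>) = heat_hat \<theta> \<kappa> x"
proof -
  \<comment> \<open>A basis vector has vanishing last component exactly when it comes from the first
    factor.\<close>
  define ang :: "(real ^ 'm) \<times> real \<Rightarrow> real" where "ang b = (if snd b = 0 then \<theta> else - \<theta>)" for b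
  have ang: "\<bar>ang b\<bar> < pi / 2" for b using th by (simp add: ang_def)
  have nrm: "(\<Sum>u\<in>Basis. (y \<bullet> u)\<^sup>2) = (norm y)\<^sup>2" for y :: "real ^ 'm"
    unfolding power2_norm_eq_inner by (subst (2) euclidean_inner) (simp only: power2_eq_square)
  \<comment> \<open>Used with s = 1 before the transform and with s = -1 after it.\<close>
  have S: "(\<Sum>b\<in>Basis. cis (s * ang b) * of_real ((y \<bullet> b)\<^sup>2)) =
      cis (s * \<theta>) * of_real ((norm (fst y))\<^sup>2) + cis (- (s * \<theta>)) * of_real ((snd y)\<^sup>2)"
    for s and y :: "(real ^ 'm) \<times> real"
    unfolding sum_Basis_prod
    by (simp add: ang_def inner_prod_def flip: nrm sum_distrib_left)
  have A: "(\<Sum>b\<in>Basis. ang b) = (real CARD('m) - 1) * \<theta>"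
    unfolding sum_Basis_prod by (simp add: ang_def algebra_simps)
  have eq: "exp (\<i> * of_real (x \<bullet> y) - of_real \<kappa> * (\<Sum>b\<in>Basis. cis (ang b) * of_real ((y \<bullet> b)\<^sup>2))) =
      exp (\<i> * of_real (x \<bullet> y)) * heat \<theta> \<kappa> y" for y
    using S[of 1 y] unfolding heat_def by (simp only: mult_1 exp_add[symmetric] mult_minus_left diff_conv_add_uminus)
  show "integrable lborel (\<lambda>\<xi>. exp (\<i> * of_real (x \<bullet> \<xi>)) * heat \<theta> \<kappa> \<xi>)"
    using integrable_gaussian_lborel[OF k, of ang x] ang unfolding eq by simp
  have "(LINT \<xi>|lborel. exp (\<i> * of_real (x \<bullet> \<xi>)) * heat \<theta> \<kappa> \<xi>) =
      of_real (sqrt (pi / \<kappa>) ^ DIM((real ^ 'm) \<times> real)) * cis (- (\<Sum>b\<in>Basis. ang b) / 2) *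
      exp (- (\<Sum>b\<in>Basis. cis (- ang b) * of_real ((x \<bullet> b)\<^sup>2)) / of_real (4 * \<kappa>))"
    using integral_gaussian_lborel[OF k, of ang x] ang unfolding eq by simp
  also have "\<dots> = heat_hat \<theta> \<kappa> x"
    using S[of "-1" x] unfolding A heat_hat_def mult_minus_left by simp
  finally show "(LINT \<xi>|lborel. exp (\<i> * of_real (x \<bullet> \<xi>)) * heat \<theta> \<kappa> \<xi>) = heat_hat \<theta> \<kappa> x" .
qed

lemma norm_pair_square: "(norm x)\<^sup>2 = (norm (fst x))\<^sup>2 + (norm (snd x))\<^sup>2"
  by (simp add: norm_prod_def)

text \<open>The opposite angles \<theta> and -\<theta> have the same cosine, so the modulus is an
  isotropic real Gaussian although the exponent is not isotropic.\<close>

lemma norm_heat: "cmod (heat \<theta> \<kappa> \<xi>) = exp (- (\<kappa> * cos \<theta>) * (norm \<xi>)\<^sup>2)"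
  unfolding heat_def by (simp add: norm_pair_square algebra_simps del: of_real_power)

lemma norm_heat_hat:
  fixes x :: "(real ^ 'm::finite) \<times> real"
  assumes "\<kappa> > 0"
  shows "cmod (heat_hat \<theta> \<kappa> x) = sqrt (pi / \<kappa>) ^ (CARD('m) + 1) * exp (- (cos \<theta> / (4 * \<kappa>)) * (norm x)\<^sup>2)"
proof -
  let ?z = "- (cis (- \<theta>) * of_real ((norm (fst x))\<^sup>2) + cis \<theta> * of_real ((snd x)\<^sup>2)) / complex_of_real (4 * \<kappa>)"
  have "Re ?z = - (cos \<theta> / (4 * \<kappa>)) * (norm x)\<^sup>2"
    unfolding Re_divide_of_real norm_pair_square[of x]
    by (simp add: algebra_simps add_divide_distrib diff_divide_distrib del: of_real_power)
  moreover have "sqrt (pi / \<kappa>) \<ge> 0" using assms by simp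
  ultimately show ?thesis
    unfolding heat_hat_def by (simp only: norm_mult norm_of_real norm_cis norm_exp_eq_Re abs_of_nonneg zero_le_power mult_1_right)
qed

text \<open>The integrals over \<open>k \<in> (0, \<infinity>)\<close> below converge at both ends through this bound, which
  replaces the natural condition \<open>n > 4\<close> by \<open>n \<ge> 6\<close> in exchange for a simple majorant.\<close>

lemma cutoff_majorant:
  fixes y A B \<kappa> :: real
  assumes k: "\<kappa> > 0" and n: "n \<ge> 6" and AB: "A \<ge> 0" "B \<ge> 0"
    and 1: "y \<le> A * \<kappa>" and 2: "y \<le> B * (\<kappa> * sqrt (1 / \<kappa>) ^ n)"
  shows "y \<le> 2 * (A + B) / (1 + \<kappa>\<^sup>2)"
proof (cases "\<kappa> \<le> 1")
  case True
  then have k2: "\<kappa>\<^sup>2 \<le> 1" using k by (simp add: power_le_one)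
  have "y * (1 + \<kappa>\<^sup>2) \<le> (A * \<kappa>) * (1 + \<kappa>\<^sup>2)"
    using 1 by (rule mult_right_mono) simp
  also have "\<dots> \<le> (A * 1) * 2"
    using True k k2 AB by (intro mult_mono) auto
  also have "\<dots> \<le> 2 * (A + B)" using AB by simp
  finally show ?thesis by (simp add: pos_le_divide_eq add_pos_nonneg)
next
  case False
  \<comment> \<open>For \<kappa> > 1 the sixth power of sqrt(1/\<kappa>) is \<kappa>^(-3), which
    leads to the integrable bound B / \<kappa>^2.\<close>
  have "sqrt (1 / \<kappa>) ^ n \<le> sqrt (1 / \<kappa>) ^ 6"
    using False n by (intro power_decreasing) auto
  also have "\<dots> = (1 / \<kappa>) ^ 3"
  proof -
    have "sqrt (1 / \<kappa>) ^ 6 = ((sqrt (1 / \<kappa>))\<^sup>2) ^ 3" by (simp only: power_mult[symmetric]) simp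
    then show ?thesis using k by simp
  qed
  finally have "\<kappa> * sqrt (1 / \<kappa>) ^ n \<le> \<kappa> * (1 / \<kappa>) ^ 3"
    using k by (intro mult_left_mono) auto
  also have "\<dots> = 1 / \<kappa>\<^sup>2" using k by (simp add: field_simps power2_eq_square power3_eq_cube)
  finally have "y \<le> B * (1 / \<kappa>\<^sup>2)" using 2 AB by (meson mult_left_mono order_trans)
  then have "y * (1 + \<kappa>\<^sup>2) \<le> B * (1 / \<kappa>\<^sup>2) * (1 + \<kappa>\<^sup>2)"
    by (rule mult_right_mono) simp
  also have "\<dots> = B * (1 / \<kappa>\<^sup>2 + 1)" using k by (simp add: field_simps)
  also have "\<dots> \<le> B * 2"
    using False AB by (intro mult_left_mono) (auto simp: divide_le_eq one_le_power)
  also have "\<dots> \<le> 2 * (A + B)" using AB by simp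
  finally show ?thesis by (simp add: pos_le_divide_eq add_pos_nonneg)
qed

section \<open>Integration over the angle (first component) and the scale (second component)\<close>

definition param_set :: "real \<Rightarrow> (real \<times> real) set" where
  "param_set a = {- a..a} \<times> {0<..}"

lemma param_set_borel [measurable]: "param_set a \<in> sets borel"
  unfolding param_set_def by (simp add: borel_Times)

lemma param_cos_ge:
  assumes "p \<in> param_set a" "a \<le> pi"
  shows "cos a \<le> cos (fst p)"
  using assms by (intro cos_le_cos_of_abs_le) (auto simp: param_set_def)

lemma integrable_param_majorant:
  fixes a C :: real
  shows "integrable lborel (\<lambda>p::real \<times> real. indicator {- a..a} (fst p) * (C / (1 + (snd p)\<^sup>2)) :: real)"
proof -
  have "integrable (lborel \<Otimes>\<^sub>M lborel) (\<lambda>(x::real, y::real). indicator {- a..a} x * (C / (1 + y\<^sup>2)) :: real)"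
  proof (rule integrable_lborel_pair)
    have i: "integrable lborel (\<lambda>y::real. C / (1 + y\<^sup>2))"
      using integrable_mult_right[OF integrable_inverse_1_plus_square_lborel, of C] by simp
    show "integrable lborel (\<lambda>y. indicator {- a..a} x * (C / (1 + y\<^sup>2)))" for x
      by (intro integrable_mult_right i)
    show "integrable lborel (\<lambda>x::real. indicator {- a..a} x * (LINT y|lborel. \<bar>C / (1 + (y::real)\<^sup>2)\<bar>))"
      by (intro integrable_mult_left integrable_real_indicator) (auto simp: emeasure_lborel_Icc_eq)
    have [measurable]: "(\<lambda>p::real \<times> real. indicator {- a..a} (fst p) :: real) \<in> borel_measurable borel"
      using measurable_compose[OF borel_measurable_continuous_onI[OF continuous_on_fst[OF continuous_on_id]], of "indicator {- a..a}" borel]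
      by simp
    have [measurable]: "(snd :: real \<times> real \<Rightarrow> real) \<in> borel_measurable borel"
      by (intro borel_measurable_continuous_onI continuous_intros)
    show "(\<lambda>(x::real, y::real). indicator {- a..a} x * (C / (1 + y\<^sup>2)) :: real) \<in> borel_measurable borel"
      unfolding case_prod_unfold by measurable
    show "(LINT y|lborel. norm (indicator {- a..a} x * (C / (1 + y\<^sup>2)))) \<le>
        indicator {- a..a} x * (LINT y|lborel. \<bar>C / (1 + (y::real)\<^sup>2)\<bar>)" for x
      by (cases "x \<in> {- a..a}") simp_all
  qed
  then show ?thesis
    by (simp only: lborel_prod case_prod_unfold)
qed

text \<open>The two bounds are for small and for large scales: the first is linear in k, the second
  decays like k^(1 - n/2). Together they give a majorant that is integrable over the parameter
  set.\<close>

lemma integrable_param_pair: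
  fixes K :: "real \<times> real \<Rightarrow> 'a::euclidean_space \<Rightarrow> complex"
  assumes n: "n \<ge> 6" and AB: "A \<ge> 0" "B \<ge> 0"
    and meas: "(\<lambda>(p, x). indicator (param_set a) p *\<^sub>R K p x) \<in> borel_measurable borel"
    and int: "\<And>p. p \<in> param_set a \<Longrightarrow> integrable lborel (K p)"
    and bd: "\<And>p. p \<in> param_set a \<Longrightarrow> (LINT x|lborel. cmod (K p x)) \<le> A * snd p"
      "\<And>p. p \<in> param_set a \<Longrightarrow> (LINT x|lborel. cmod (K p x)) \<le> B * (snd p * sqrt (1 / snd p) ^ n)"
  shows "integrable (lborel \<Otimes>\<^sub>M lborel) (\<lambda>(p, x). indicator (param_set a) p *\<^sub>R K p x)"
proof (rule integrable_lborel_pair[OF meas])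
  show "integrable lborel (\<lambda>p. indicator {- a..a} (fst p) * (2 * (A + B) / (1 + (snd p)\<^sup>2)) :: real)"
    by (rule integrable_param_majorant)
  show "integrable lborel (\<lambda>x. indicator (param_set a) p *\<^sub>R K p x)" for p
    using int[of p] by (cases "p \<in> param_set a") auto
  show "(LINT x|lborel. cmod (indicator (param_set a) p *\<^sub>R K p x)) \<le>
      indicator {- a..a} (fst p) * (2 * (A + B) / (1 + (snd p)\<^sup>2))" for p
  proof (cases "p \<in> param_set a")
    case True
    then have "snd p > 0" "indicator {- a..a} (fst p) = (1::real)"
      by (auto simp: param_set_def)
    then show ?thesis
      using cutoff_majorant[OF _ n AB bd[OF True]] True by simp
  qed (use AB in simp)
qed

section \<open>The superposition formula for 1/Q\<close>

lemma integral_linear_exp: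
  assumes s: "Re s > 0"
  shows "(LINT k|lborel. indicator {0<..} k *\<^sub>R (of_real k * exp (- of_real k * s))) = 1 / s\<^sup>2"
proof -
  define r where "r = Re s"
  have r: "r > 0" and s0: "s \<noteq> 0" using s by (auto simp: r_def)
  \<comment> \<open>An elementary antiderivative. The weight k in the superposition is there to
    produce the power s^(-2), the one whose integral over the angle is a multiple of 1/Q.\<close>
  let ?F = "\<lambda>k::real. - (of_real k / s + 1 / s\<^sup>2) * exp (- of_real k * s)"
  have "((\<lambda>k::real. k * exp (- k * r) * (1 + k\<^sup>2)) \<longlongrightarrow> 0) at_top"
    using r by real_asymp
  moreover have "continuous_on {0..} (\<lambda>k::real. k * exp (- k * r) * (1 + k\<^sup>2))"
    by (intro continuous_intros)
  ultimately obtain M where M: "\<And>k. k \<ge> 0 \<Longrightarrow> \<bar>k * exp (- k * r) * (1 + k\<^sup>2)\<bar> \<le> M"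
    using bounded_of_tendsto_at_top by meson
  have bd: "k * exp (- k * r) \<le> M * (1 / (1 + k\<^sup>2))" if "k \<ge> 0" for k
    using M[OF that] that by (simp add: pos_le_divide_eq add_pos_nonneg abs_mult)
  have M0: "M \<ge> 0" using M[of 0] by simp
  have e: "einterval 0 \<infinity> = {0<..}" by (auto simp: einterval_iff)
  have int: "integrable lborel (\<lambda>k. indicator {0<..} k *\<^sub>R (of_real k * exp (- of_real k * s)))"
  proof (rule Bochner_Integration.integrable_bound)
    show "integrable lborel (\<lambda>k. M * (1 / (1 + k\<^sup>2)))"
      by (intro integrable_mult_right integrable_inverse_1_plus_square_lborel)
    show "AE k in lborel. cmod (indicator {0<..} k *\<^sub>R (of_real k * exp (- of_real k * s))) \<le> norm (M * (1 / (1 + k\<^sup>2)))"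
      using bd M0 by (intro AE_I2) (auto simp: indicator_def norm_mult r_def abs_mult)
    show "(\<lambda>k. indicator {0<..} k *\<^sub>R (complex_of_real k * exp (- of_real k * s))) \<in> borel_measurable lborel"
      by measurable
  qed
  have "(LBINT k=0..\<infinity>. of_real k * exp (- of_real k * s)) = 0 - (- 1 / s\<^sup>2)"
  proof (rule interval_integral_FTC_integrable)
    show "(?F has_vector_derivative of_real k * exp (- of_real k * s)) (at k)" for k
    proof -
      have "((\<lambda>z. - (z / s + 1 / s\<^sup>2) * exp (- z * s)) has_field_derivative of_real k * exp (- of_real k * s)) (at (of_real k))"
        using s0 by (auto intro!: derivative_eq_intros simp: field_simps power2_eq_square)
      from has_vector_derivative_real_field[OF this] show ?thesis .
    qed
    show "isCont (\<lambda>k. complex_of_real k * exp (- of_real k * s)) k" for k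
      by (intro continuous_intros)
    show "set_integrable lborel (einterval 0 \<infinity>) (\<lambda>k. complex_of_real k * exp (- of_real k * s))"
      using int by (simp add: e set_integrable_def)
    have "(?F \<longlongrightarrow> ?F 0) (at_right 0)"
      by (rule tendsto_within_subset[of _ _ _ UNIV, OF isContD]) (use s0 in \<open>auto intro!: continuous_intros\<close>)
    then show "((?F \<circ> real_of_ereal) \<longlongrightarrow> - 1 / s\<^sup>2) (at_right 0)"
      unfolding zero_ereal_def by (simp add: ereal_tendsto_simps)
    have "(?F \<longlongrightarrow> 0) at_top"
    proof (rule Lim_null_comparison)
      show "eventually (\<lambda>k. cmod (?F k) \<le> (k / cmod s + 1 / (cmod s)\<^sup>2) * exp (- k * r)) at_top"
        using eventually_ge_at_top[of 0]
      proof eventually_elim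
        case (elim k)
        have "cmod (of_real k / s + 1 / s\<^sup>2) \<le> k / cmod s + 1 / (cmod s)\<^sup>2"
          by (rule norm_triangle_le) (use elim in \<open>simp add: norm_divide norm_power\<close>)
        then show ?case
          by (simp only: norm_mult norm_minus_cancel norm_exp_eq_Re) (auto simp: r_def intro!: mult_right_mono)
      qed
      have "cmod s > 0" using s0 by simp
      then show "((\<lambda>k. (k / cmod s + 1 / (cmod s)\<^sup>2) * exp (- k * r)) \<longlongrightarrow> 0) at_top"
        using r by real_asymp
    qed
    then show "((?F \<circ> real_of_ereal) \<longlongrightarrow> 0) (at_left \<infinity>)"
      by (simp add: ereal_tendsto_simps)
  qed simp
  then show ?thesis
    by (simp add: interval_lebesgue_integral_le_eq e) (simp add: set_lebesgue_integral_def)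
qed

text \<open>Both sin t and s(t) solve u'' = -u, so the derivative of sin t / s(t) is their constant
  Wronskian divided by s(t)^2. At t = 0 the Wronskian is s(0) = A + B, which explains the
  normalisation of \<open>G\<close>.\<close>

lemma integral_inverse_square_cis:
  fixes A B g :: real
  assumes AB: "A \<ge> 0" "B \<ge> 0" "A + B > 0" and g: "0 < g" "g < pi"
  shows "(LINT t|lborel. indicator {- (g / 2)..g / 2} t *\<^sub>R (1 / (cis t * of_real A + cis (- t) * of_real B)\<^sup>2)) =
    complex_of_real (sin g / (A\<^sup>2 + 2 * cos g * A * B + B\<^sup>2))"
proof -
  define s where "s t = cis t * of_real A + cis (- t) * of_real B" for t
  define s' where "s' t = \<i> * cis t * of_real A - \<i> * cis (- t) * of_real B" for t
  define G where "G t = of_real (sin t) / (of_real (A + B) * s t)" for t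
  have s0: "s t \<noteq> 0" if "t \<in> {- (g / 2)..g / 2}" for t
  proof -
    have "Re (s t) = cos t * (A + B)" by (simp add: s_def algebra_simps)
    moreover have "cos t > 0" using that g by (intro cos_gt_zero_pi) auto
    ultimately show ?thesis using AB by (metis less_irrefl mult_pos_pos zero_complex.simps(1))
  qed
  have "(LINT t|lborel. indicator {- (g / 2)..g / 2} t *\<^sub>R (1 / (s t)\<^sup>2)) = G (g / 2) - G (- (g / 2))"
  proof (rule integral_FTC_Icc)
    show "- (g / 2) \<le> g / 2" using g by simp
    fix t assume t: "- (g / 2) \<le> t" "t \<le> g / 2"
    show "(G has_vector_derivative 1 / (s t)\<^sup>2) (at t within {- (g / 2)..g / 2})"
    proof -
      let ?S = "\<lambda>z. exp (\<i> * z) * complex_of_real A + exp (- (\<i> * z)) * complex_of_real B"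
      let ?T = "\<lambda>z. \<i> * exp (\<i> * z) * complex_of_real A - \<i> * exp (- (\<i> * z)) * complex_of_real B"
      have S: "?S (of_real t) = s t" "?T (of_real t) = s' t" for t
        by (simp_all add: s_def s'_def cis_conv_exp)
      have st: "s t \<noteq> 0" using s0 t by simp
      have AB': "complex_of_real A + complex_of_real B \<noteq> 0"
        using AB by (simp flip: of_real_add)
      have dS: "(?S has_field_derivative ?T z) (at z)" for z
        by (auto intro!: derivative_eq_intros simp: algebra_simps)
      have "((\<lambda>z. sin z / (of_real (A + B) * ?S z)) has_field_derivative
          (cos (of_real t) * (of_real (A + B) * s t) - sin (of_real t) * (of_real (A + B) * s' t)) /
          ((of_real (A + B) * s t) * (of_real (A + B) * s t))) (at (of_real t))"
        unfolding S[symmetric]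
        by (rule DERIV_divide[OF DERIV_sin DERIV_cmult[OF dS]]) (use st AB' in \<open>simp add: S\<close>)
      moreover have "(cos (of_real t) * (of_real (A + B) * s t) - sin (of_real t) * (of_real (A + B) * s' t)) /
          ((of_real (A + B) * s t) * (of_real (A + B) * s t)) = 1 / (s t)\<^sup>2"
      proof -
        have "cis t * cis (- t) = 1" by (simp add: cis_mult)
        then have "cos (of_real t) * s t - sin (of_real t) * s' t = of_real (A + B)"
          unfolding s_def s'_def cos_of_real sin_of_real
          by (simp add: complex_eq_iff algebra_simps flip: power2_eq_square)
             (simp flip: distrib_left)
        then have "cos (of_real t) * (of_real (A + B) * s t) - sin (of_real t) * (of_real (A + B) * s' t) =
            of_real (A + B) * of_real (A + B)"
          by (metis (no_types, lifting) mult.left_commute right_diff_distrib)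
        then show ?thesis using st AB' by (simp add: power2_eq_square)
      qed
      ultimately have "((\<lambda>z. sin z / (of_real (A + B) * ?S z)) has_field_derivative 1 / (s t)\<^sup>2) (at (of_real t))"
        by simp
      from has_vector_derivative_real_field[OF this] show ?thesis
        by (simp add: G_def[abs_def] S sin_of_real)
    qed
  next
    show "continuous_on {- (g / 2)..g / 2} (\<lambda>t. 1 / (s t)\<^sup>2)"
      using s0 unfolding s_def cis_conv_exp by (intro continuous_intros) auto
  qed
  also have "\<dots> = of_real (sin (g / 2)) / of_real (A + B) * (1 / s (g / 2) + 1 / s (- (g / 2)))"
    by (simp add: G_def distrib_left del: of_real_add)
  also have "1 / s (g / 2) + 1 / s (- (g / 2)) = (s (g / 2) + s (- (g / 2))) / (s (g / 2) * s (- (g / 2)))"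
    using s0[of "g / 2"] s0[of "- (g / 2)"] g by (simp add: field_simps)
  also have "s (g / 2) + s (- (g / 2)) = of_real (2 * cos (g / 2) * (A + B))"
    by (simp add: s_def complex_eq_iff algebra_simps)
  \<comment> \<open>The complex factorisation of the symbol: its two factors are the values of
    \<open>s\<close> at the ends of the angular interval.\<close>
  also have "s (g / 2) * s (- (g / 2)) = of_real (A\<^sup>2 + 2 * cos g * A * B + B\<^sup>2)"
  proof -
    have "s (g / 2) * s (- (g / 2)) =
        of_real (A\<^sup>2 + B\<^sup>2) * (cis (g / 2) * cis (- (g / 2))) +
        of_real (A * B) * (cis (g / 2) * cis (g / 2) + cis (- (g / 2)) * cis (- (g / 2)))"
      by (simp add: s_def algebra_simps power2_eq_square)
    also have "\<dots> = of_real (A\<^sup>2 + B\<^sup>2) + of_real (A * B) * (cis g + cis (- g))"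
      by (simp add: cis_mult)
    also have "cis g + cis (- g) = of_real (2 * cos g)"
      by (simp add: complex_eq_iff)
    finally show ?thesis by simp
  qed
  also have "of_real (sin (g / 2)) / of_real (A + B) *
      (of_real (2 * cos (g / 2) * (A + B)) / of_real (A\<^sup>2 + 2 * cos g * A * B + B\<^sup>2)) =
      complex_of_real ((2 * sin (g / 2) * cos (g / 2)) / (A\<^sup>2 + 2 * cos g * A * B + B\<^sup>2))"
    by (simp only: of_real_mult[symmetric] of_real_divide[symmetric]) (use AB in simp)
  also have "2 * sin (g / 2) * cos (g / 2) = sin g"
    using sin_double[of "g / 2"] by simp
  finally show ?thesis by (simp add: s_def)
qed

text \<open>Integrability in the parameters is an assumption because it is supplied for almost every
  \<xi>, by Fubini for the paired integrand in \<open>integral_inverse_symbol\<close>.\<close>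

lemma integral_param_heat:
  fixes \<xi> :: "(real ^ 'm::finite) \<times> real"
  assumes g: "0 < g" "g < pi" and xi: "\<xi> \<noteq> 0"
    and int: "integrable lborel (\<lambda>p. indicator (param_set (g / 2)) p *\<^sub>R (of_real (snd p) * heat (fst p) (snd p) \<xi>))"
  shows "(LINT p|lborel. indicator (param_set (g / 2)) p *\<^sub>R (of_real (snd p) * heat (fst p) (snd p) \<xi>)) =
    complex_of_real (sin g / Q_symbol g \<xi>)"
proof -
  let ?I = "{- (g / 2)..g / 2}"
  define A B where "A = (norm (fst \<xi>))\<^sup>2" and "B = (snd \<xi>)\<^sup>2"
  have AB: "A \<ge> 0" "B \<ge> 0" by (simp_all add: A_def B_def)
  have "(norm \<xi>)\<^sup>2 > 0" using xi by simp
  then have AB0: "A + B > 0" by (simp add: A_def B_def norm_pair_square)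
  let ?s = "\<lambda>t. cis t * of_real A + cis (- t) * of_real B"
  let ?f = "\<lambda>t k. indicator (param_set (g / 2)) (t, k) *\<^sub>R (of_real k * heat t k \<xi>)"
  have "(LINT p|lborel. indicator (param_set (g / 2)) p *\<^sub>R (of_real (snd p) * heat (fst p) (snd p) \<xi>)) =
      (LINT p|(lborel \<Otimes>\<^sub>M lborel). (\<lambda>(t, k). ?f t k) p)"
    by (simp add: lborel_prod case_prod_unfold)
  also have "\<dots> = (LINT t|lborel. LINT k|lborel. ?f t k)"
    by (rule lborel_pair.integral_fst[symmetric]) (use int in \<open>simp add: lborel_prod case_prod_unfold\<close>)
  also have "\<dots> = (LINT t|lborel. indicator ?I t *\<^sub>R (1 / (?s t)\<^sup>2))"
  proof (intro Bochner_Integration.integral_cong refl)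
    fix t
    show "(LINT k|lborel. ?f t k) = indicator ?I t *\<^sub>R (1 / (?s t)\<^sup>2)"
    proof (cases "t \<in> ?I")
      case True
      have "cos t > 0" using True g by (intro cos_gt_zero_pi) auto
      then have "Re (?s t) > 0" using AB0 by (simp flip: distrib_left)
      from integral_linear_exp[OF this] True show ?thesis
        by (simp add: param_set_def heat_def A_def B_def indicator_times)
    qed (simp add: param_set_def indicator_times)
  qed
  also have "\<dots> = complex_of_real (sin g / (A\<^sup>2 + 2 * cos g * A * B + B\<^sup>2))"
    by (rule integral_inverse_square_cis[OF AB AB0 g])
  also have "A\<^sup>2 + 2 * cos g * A * B + B\<^sup>2 = Q_symbol g \<xi>"
    by (simp add: Q_symbol_def A_def B_def case_prod_unfold power_mult[symmetric])
  finally show ?thesis .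
qed

text \<open>The same product is estimated twice: with the supremum of the kernel against the L1 norm
  of \<open>f\<close>, and with the supremum of \<open>f\<close> against the mass of the Gaussian.
  Which of the two serves small scales depends on the side of the transform.\<close>

lemma gaussian_weighted_integral:
  fixes f k :: "'a::euclidean_space \<Rightarrow> complex"
  assumes f: "integrable lborel f" and bdd: "\<And>x. cmod (f x) \<le> M"
    and k: "k \<in> borel_measurable borel" "\<And>x. cmod (k x) \<le> P * exp (- \<mu> * (norm x)\<^sup>2)"
    and P: "P \<ge> 0" and mu: "\<mu> > 0"
  shows "integrable lborel (\<lambda>x. k x * f x)"
    and "(LINT x|lborel. cmod (k x * f x)) \<le> P * (LINT x|lborel. cmod (f x))"
    and "(LINT x|lborel. cmod (k x * f x)) \<le> P * M * sqrt (pi / \<mu>) ^ DIM('a)"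
proof -
  have [measurable]: "f \<in> borel_measurable borel" "k \<in> borel_measurable borel"
    using borel_measurable_integrable[OF f] k(1) by simp_all
  have M0: "M \<ge> 0" using order_trans[OF norm_ge_zero bdd[of 0]] .
  have kP: "cmod (k x) \<le> P" for x
    using k(2)[of x] P mu by (elim order_trans) (auto intro!: mult_left_le)
  have 1: "cmod (k x * f x) \<le> P * cmod (f x)" for x
    using kP[of x] by (simp add: norm_mult mult_right_mono)
  have 2: "cmod (k x * f x) \<le> P * M * exp (- \<mu> * (norm x)\<^sup>2)" for x
    using mult_mono[OF k(2)[of x] bdd[of x]] P M0 by (simp add: norm_mult mult_ac)
  have intP: "integrable lborel (\<lambda>x. P * cmod (f x))"
    using f by (intro integrable_mult_right integrable_norm)
  show i: "integrable lborel (\<lambda>x. k x * f x)"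
    by (rule Bochner_Integration.integrable_bound[OF intP])
      (use 1 P in \<open>auto simp: abs_mult intro!: AE_I2\<close>)
  show "(LINT x|lborel. cmod (k x * f x)) \<le> P * (LINT x|lborel. cmod (f x))"
    using integral_mono[OF integrable_norm[OF i] intP 1] by simp
  have "(LINT x|lborel. cmod (k x * f x)) \<le> (LINT x::'a|lborel. P * M * exp (- \<mu> * (norm x)\<^sup>2))"
    by (rule integral_mono[OF integrable_norm[OF i] _ 2])
      (intro integrable_mult_right gaussian_norm_integral mu)
  also have "\<dots> = P * M * sqrt (pi / \<mu>) ^ DIM('a)"
    by (simp only: integral_mult_right_zero gaussian_norm_integral[OF mu])
  finally show "(LINT x|lborel. cmod (k x * f x)) \<le> P * M * sqrt (pi / \<mu>) ^ DIM('a)" .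
qed

text \<open>Continuity is asked on the parameter set alone, since the transformed Gaussian divides
  by the scale; the indicator makes the product measurable on the whole space.\<close>

lemma param_kernel_measurable:
  fixes k :: "real \<times> real \<Rightarrow> 'a::euclidean_space \<Rightarrow> complex"
  assumes k: "continuous_on (param_set a \<times> UNIV) (\<lambda>q. k (fst q) (snd q))" and f: "f \<in> borel_measurable borel"
  shows "(\<lambda>(p, x). indicator (param_set a) p *\<^sub>R (k p x * f x)) \<in> borel_measurable borel"
proof -
  have "param_set a \<times> (UNIV :: 'a set) \<in> sets borel"
    by (intro borel_Times) auto
  then have 1: "(\<lambda>q. indicator (param_set a \<times> UNIV) q *\<^sub>R k (fst q) (snd q)) \<in> borel_measurable borel"
    by (rule borel_measurable_continuous_on_indicator[OF _ k])
  have 2: "(\<lambda>q::(real \<times> real) \<times> 'a. f (snd q)) \<in> borel_measurable borel"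
    by (rule measurable_compose[OF borel_measurable_continuous_onI f]) (intro continuous_intros)
  have eq: "(\<lambda>(p, x). indicator (param_set a) p *\<^sub>R (k p x * f x)) =
      (\<lambda>q. (indicator (param_set a \<times> UNIV) q *\<^sub>R k (fst q) (snd q)) * f (snd q))"
    by (auto simp: fun_eq_iff indicator_def)
  show ?thesis unfolding eq using 1 2 by (rule borel_measurable_times)
qed

lemma heat_continuous: "continuous_on S (\<lambda>q. complex_of_real (snd (fst q)) * heat (fst (fst q)) (snd (fst q)) (snd q))"
  unfolding heat_def cis_conv_exp by (intro continuous_intros)

lemma heat_hat_continuous:
  "continuous_on (param_set a \<times> S) (\<lambda>q. complex_of_real (snd (fst q)) * heat_hat (fst (fst q)) (snd (fst q)) (snd q))"
  unfolding heat_hat_def cis_conv_exp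
  by (intro continuous_intros) (auto simp: param_set_def)

text \<open>For small k the L1 norm of \<open>f\<close> is used and the weight k gives the
  smallness; for large k the Gaussian is narrow, with mass of order k^(-n/2).\<close>

lemma integrable_heat_pair:
  fixes f :: "(real ^ 'm::finite) \<times> real \<Rightarrow> complex"
  assumes m: "CARD('m) \<ge> 5" and a: "0 < a" "a < pi / 2"
    and f: "integrable lborel f" and bdd: "\<And>x. cmod (f x) \<le> M"
  shows "integrable (lborel \<Otimes>\<^sub>M lborel)
    (\<lambda>(p, \<xi>). indicator (param_set a) p *\<^sub>R (of_real (snd p) * heat (fst p) (snd p) \<xi> * f \<xi>))"
proof -
  let ?n = "CARD('m) + 1"
  have c: "cos a > 0" using a by (intro cos_gt_zero_pi) auto
  have M0: "M \<ge> 0" using order_trans[OF norm_ge_zero bdd[of 0]] .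
  have [measurable]: "f \<in> borel_measurable borel"
    using borel_measurable_integrable[OF f] by simp
  have *: "integrable lborel (\<lambda>\<xi>. of_real (snd p) * heat (fst p) (snd p) \<xi> * f \<xi>)"
      "(LINT \<xi>|lborel. cmod (of_real (snd p) * heat (fst p) (snd p) \<xi> * f \<xi>)) \<le> (LINT x|lborel. cmod (f x)) * snd p"
      "(LINT \<xi>|lborel. cmod (of_real (snd p) * heat (fst p) (snd p) \<xi> * f \<xi>)) \<le>
        (M * sqrt (pi / cos a) ^ ?n) * (snd p * sqrt (1 / snd p) ^ ?n)"
    if p: "p \<in> param_set a" for p
  proof -
    have k: "snd p > 0" using p by (auto simp: param_set_def)
    have bd: "cmod (of_real (snd p) * heat (fst p) (snd p) \<xi>) \<le> snd p * exp (- (snd p * cos a) * (norm \<xi>)\<^sup>2)" for \<xi> :: "(real ^ 'm) \<times> real"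
      using k param_cos_ge[OF p] a by (auto simp: norm_mult norm_heat intro!: mult_left_mono mult_right_mono)
    have meas: "(\<lambda>\<xi>::(real ^ 'm) \<times> real. of_real (snd p) * heat (fst p) (snd p) \<xi>) \<in> borel_measurable borel"
      unfolding heat_def cis_conv_exp by (intro borel_measurable_continuous_onI continuous_intros)
    note G = gaussian_weighted_integral[OF f bdd meas bd less_imp_le[OF k] mult_pos_pos[OF k c]]
    show "integrable lborel (\<lambda>\<xi>. of_real (snd p) * heat (fst p) (snd p) \<xi> * f \<xi>)" by (rule G(1))
    show "(LINT \<xi>|lborel. cmod (of_real (snd p) * heat (fst p) (snd p) \<xi> * f \<xi>)) \<le> (LINT x|lborel. cmod (f x)) * snd p"
      using G(2) by (simp add: mult.commute)
    have "sqrt (pi / (snd p * cos a)) = sqrt (pi / cos a) * sqrt (1 / snd p)"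
      by (simp add: real_sqrt_mult[symmetric] mult.commute)
    then show "(LINT \<xi>|lborel. cmod (of_real (snd p) * heat (fst p) (snd p) \<xi> * f \<xi>)) \<le>
        (M * sqrt (pi / cos a) ^ ?n) * (snd p * sqrt (1 / snd p) ^ ?n)"
      using G(3) by (simp add: power_mult_distrib mult_ac)
  qed
  show ?thesis
    by (rule integrable_param_pair[where n = ?n and A = "LINT x|lborel. cmod (f x)" and B = "M * sqrt (pi / cos a) ^ ?n"])
      (use m M0 c * in \<open>auto intro!: param_kernel_measurable heat_continuous\<close>)
qed

text \<open>Dual to \<open>integrable_heat_pair\<close>: the transformed Gaussian is narrow for
  small k, where its height of order k^(-n/2) and its volume of order k^(n/2) cancel, and wide for
  large k, where the height is paired with the L1 norm of \<open>f\<close>.\<close>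

lemma integrable_heat_hat_pair:
  fixes f :: "(real ^ 'm::finite) \<times> real \<Rightarrow> complex"
  assumes m: "CARD('m) \<ge> 5" and a: "0 < a" "a < pi / 2"
    and f: "integrable lborel f" and bdd: "\<And>x. cmod (f x) \<le> M"
  shows "integrable (lborel \<Otimes>\<^sub>M lborel)
    (\<lambda>(p, x). indicator (param_set a) p *\<^sub>R (of_real (snd p) * heat_hat (fst p) (snd p) x * f x))"
proof -
  let ?n = "CARD('m) + 1"
  have c: "cos a > 0" using a by (intro cos_gt_zero_pi) auto
  have M0: "M \<ge> 0" using order_trans[OF norm_ge_zero bdd[of 0]] .
  have [measurable]: "f \<in> borel_measurable borel"
    using borel_measurable_integrable[OF f] by simp
  have *: "integrable lborel (\<lambda>x. of_real (snd p) * heat_hat (fst p) (snd p) x * f x)"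
      "(LINT x|lborel. cmod (of_real (snd p) * heat_hat (fst p) (snd p) x * f x)) \<le>
        (M * sqrt (4 * pi\<^sup>2 / cos a) ^ ?n) * snd p"
      "(LINT x|lborel. cmod (of_real (snd p) * heat_hat (fst p) (snd p) x * f x)) \<le>
        (sqrt pi ^ ?n * (LINT x|lborel. cmod (f x))) * (snd p * sqrt (1 / snd p) ^ ?n)"
    if p: "p \<in> param_set a" for p
  proof -
    let ?P = "snd p * sqrt (pi / snd p) ^ ?n"
    have k: "snd p > 0" using p by (auto simp: param_set_def)
    have bd: "cmod (of_real (snd p) * heat_hat (fst p) (snd p) x) \<le> ?P * exp (- (cos a / (4 * snd p)) * (norm x)\<^sup>2)" for x :: "(real ^ 'm) \<times> real"
      using k param_cos_ge[OF p] a
      by (auto simp: norm_mult norm_heat_hat mult.assoc intro!: mult_left_mono mult_right_mono divide_right_mono)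
    have meas: "(\<lambda>x::(real ^ 'm) \<times> real. of_real (snd p) * heat_hat (fst p) (snd p) x) \<in> borel_measurable borel"
      unfolding heat_hat_def cis_conv_exp using k by (intro borel_measurable_continuous_onI continuous_intros) auto
    have P0: "?P \<ge> 0" using k by simp
    have mu: "cos a / (4 * snd p) > 0" using k c by simp
    note G = gaussian_weighted_integral[OF f bdd meas bd P0 mu]
    show "integrable lborel (\<lambda>x. of_real (snd p) * heat_hat (fst p) (snd p) x * f x)" by (rule G(1))
    have "sqrt (pi / snd p) = sqrt pi * sqrt (1 / snd p)"
      by (simp add: real_sqrt_mult[symmetric])
    then show "(LINT x|lborel. cmod (of_real (snd p) * heat_hat (fst p) (snd p) x * f x)) \<le>
        (sqrt pi ^ ?n * (LINT x|lborel. cmod (f x))) * (snd p * sqrt (1 / snd p) ^ ?n)"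
      using G(2) by (simp only: power_mult_distrib mult_ac)
    have "sqrt (pi / snd p) * sqrt (pi / (cos a / (4 * snd p))) = sqrt (4 * pi\<^sup>2 / cos a)"
      unfolding real_sqrt_mult[symmetric] using k c by (simp add: field_simps power2_eq_square)
    then have "sqrt (pi / snd p) ^ ?n * sqrt (pi / (cos a / (4 * snd p))) ^ ?n = sqrt (4 * pi\<^sup>2 / cos a) ^ ?n"
      by (simp only: power_mult_distrib[symmetric])
    moreover have "DIM((real ^ 'm) \<times> real) = ?n" by simp
    ultimately show "(LINT x|lborel. cmod (of_real (snd p) * heat_hat (fst p) (snd p) x * f x)) \<le>
        (M * sqrt (4 * pi\<^sup>2 / cos a) ^ ?n) * snd p"
      using G(3) by (simp only: mult_ac)
  qed
  show ?thesis
    by (rule integrable_param_pair[where n = ?n and A = "M * sqrt (4 * pi\<^sup>2 / cos a) ^ ?n" and B = "sqrt pi ^ ?n * (LINT x|lborel. cmod (f x))"])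
      (use m M0 c * in \<open>auto intro!: param_kernel_measurable heat_hat_continuous\<close>)
qed

section \<open>Half-integer powers of the scale against exp (- A / k)\<close>

lemma sqrt_power_exp_bounded:
  fixes A :: real
  assumes A: "A > 0"
  shows "\<exists>C\<ge>0. \<forall>u\<ge>0. sqrt u ^ n * u ^ j * exp (- A * u) \<le> C"
proof -
  have lim: "((\<lambda>u. u ^ k * exp (- A * u)) \<longlongrightarrow> 0) at_top" for k
    using A by real_asymp
  have cont: "continuous_on {0..} (\<lambda>u. u ^ k * exp (- A * u))" for k
    by (intro continuous_intros)
  obtain C1 where C1: "C1 > 0" "\<And>u. u \<ge> 0 \<Longrightarrow> \<bar>u ^ j * exp (- A * u)\<bar> \<le> C1"
    using bounded_of_tendsto_at_top[OF cont lim] by meson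
  obtain C2 where C2: "C2 > 0" "\<And>u. u \<ge> 0 \<Longrightarrow> \<bar>u ^ (n + j) * exp (- A * u)\<bar> \<le> C2"
    using bounded_of_tendsto_at_top[OF cont lim] by meson
  have "sqrt u ^ n * u ^ j * exp (- A * u) \<le> C1 + C2" if u: "u \<ge> 0" for u
  proof -
    have "sqrt u \<le> max 1 u"
      by (rule real_le_lsqrt) (use u in \<open>auto simp: max_def power2_eq_square\<close>)
    then have "sqrt u ^ n \<le> (max 1 u) ^ n" using u by (intro power_mono) auto
    also have "\<dots> \<le> 1 + u ^ n" using u by (auto simp: max_def)
    finally have "sqrt u ^ n * (u ^ j * exp (- A * u)) \<le> (1 + u ^ n) * (u ^ j * exp (- A * u))"
      using u by (intro mult_right_mono) auto
    also have "\<dots> = u ^ j * exp (- A * u) + u ^ (n + j) * exp (- A * u)"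
      by (simp add: algebra_simps power_add)
    also have "\<dots> \<le> C1 + C2"
      using C1(2)[OF u] C2(2)[OF u] by (intro add_mono) auto
    finally show ?thesis by (simp add: mult.assoc)
  qed
  then show ?thesis using C1(1) C2(1) by (intro exI[of _ "C1 + C2"]) auto
qed

text \<open>In u = 1/k the powers times exp (-A u) are bounded, so away from the pole the
  exponential tames the singularity at k = 0. The power \<open>j\<close> provides for the factor 1/k
  that appears when the coefficient in the exponent is differentiated.\<close>

lemma kernel_majorant:
  fixes A :: real
  assumes A: "A > 0" and n: "n \<ge> 6"
  obtains C where "C \<ge> 0"
    "\<And>\<kappa>. \<kappa> > 0 \<Longrightarrow> \<kappa> * sqrt (1 / \<kappa>) ^ n * (1 / \<kappa>) ^ j * exp (- A / \<kappa>) \<le> C * (1 / (1 + \<kappa>\<^sup>2))"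
proof -
  obtain C1 where C1: "C1 \<ge> 0" "\<And>u. u \<ge> 0 \<Longrightarrow> sqrt u ^ n * u ^ j * exp (- A * u) \<le> C1"
    using sqrt_power_exp_bounded[OF A] by meson
  obtain C2 where C2: "C2 \<ge> 0" "\<And>u. u \<ge> 0 \<Longrightarrow> sqrt u ^ 0 * u ^ j * exp (- A * u) \<le> C2"
    using sqrt_power_exp_bounded[OF A] by meson
  have "\<kappa> * sqrt (1 / \<kappa>) ^ n * (1 / \<kappa>) ^ j * exp (- A / \<kappa>) \<le> 2 * (C1 + C2) / (1 + \<kappa>\<^sup>2)" if k: "\<kappa> > 0" for \<kappa>
  proof (rule cutoff_majorant[OF k n C1(1) C2(1)])
    have u: "1 / \<kappa> \<ge> 0" "exp (- A / \<kappa>) = exp (- A * (1 / \<kappa>))" using k by simp_all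
    show "\<kappa> * sqrt (1 / \<kappa>) ^ n * (1 / \<kappa>) ^ j * exp (- A / \<kappa>) \<le> C1 * \<kappa>"
      using mult_left_mono[OF C1(2)[OF u(1)] less_imp_le[OF k]] unfolding u(2) by (simp only: mult_ac)
    have "0 \<le> \<kappa> * sqrt (1 / \<kappa>) ^ n" using k by simp
    from mult_left_mono[OF C2(2)[OF u(1)] this]
    show "\<kappa> * sqrt (1 / \<kappa>) ^ n * (1 / \<kappa>) ^ j * exp (- A / \<kappa>) \<le> C2 * (\<kappa> * sqrt (1 / \<kappa>) ^ n)"
      unfolding u(2) by (simp only: mult_ac power_0 mult_1)
  qed
  then show ?thesis
    using that[of "2 * (C1 + C2)"] C1(1) C2(1) by simp
qed

text \<open>At the pole the integral diverges, and \<open>kernel_integral a 0\<close> carries no meaning.\<close>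

definition kernel_integral :: "real \<Rightarrow> (real ^ 'm::finite) \<times> real \<Rightarrow> complex" where
  "kernel_integral a x =
     (LINT p|lborel. indicator (param_set a) p *\<^sub>R (of_real (snd p) * heat_hat (fst p) (snd p) x))"

text \<open>Integrability across the pole is a by-product of Fubini: the absolutely convergent
  double integral replaces an estimate of the singularity |x|^(4 - n).\<close>

lemma integrable_kernel_integral_mult:
  fixes f :: "(real ^ 'm::finite) \<times> real \<Rightarrow> complex"
  assumes m: "CARD('m) \<ge> 5" and a: "0 < a" "a < pi / 2"
    and f: "integrable lborel f" and bdd: "\<And>x. cmod (f x) \<le> M"
  shows "integrable lborel (\<lambda>x. kernel_integral a x * f x)"
proof -
  let ?K = "\<lambda>p x. indicator (param_set a) p *\<^sub>R (of_real (snd p) * heat_hat (fst p) (snd p) x * f x)"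
  have "integrable (lborel \<Otimes>\<^sub>M lborel) (case_prod ?K)"
    using integrable_heat_hat_pair[OF assms] by simp
  then have "integrable lborel (\<lambda>x. LINT p|lborel. ?K p x)"
    by (rule lborel_pair.integrable_snd)
  moreover have "(LINT p|lborel. ?K p x) = kernel_integral a x * f x" for x
    unfolding kernel_integral_def by (simp only: mult_scaleR_left[symmetric] integral_mult_left_zero)
  ultimately show ?thesis by simp
qed

lemma Q_symbol_measurable [measurable]: "Q_symbol g \<in> borel_measurable borel"
  unfolding Q_symbol_def case_prod_unfold
  by (intro borel_measurable_continuous_onI continuous_intros)

text \<open>Two uses of Fubini surround the multiplication formula: \<xi> and the parameters are
  exchanged, for each parameter the transform moves from \<open>f\<close> to the Gaussian, and then
  x and the parameters are exchanged back.\<close>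

lemma integral_inverse_symbol:
  fixes f :: "(real ^ 'm::finite) \<times> real \<Rightarrow> complex"
  assumes m: "CARD('m) \<ge> 5" and g: "0 < g" "g < pi"
    and f: "integrable lborel f" and bdd: "\<And>x. cmod (f x) \<le> M"
    and ff: "integrable lborel (inv_fourier f)"
  shows "(LINT \<xi>|lborel. complex_of_real (1 / Q_symbol g \<xi>) * inv_fourier f \<xi>) =
    complex_of_real ((2 * pi) powr (- real DIM((real ^ 'm) \<times> real) / 2) / sin g) *
    (LINT x|lborel. kernel_integral (g / 2) x * f x)"
proof -
  define c where "c = complex_of_real ((2 * pi) powr (- real DIM((real ^ 'm) \<times> real) / 2))"
  let ?S = "param_set (g / 2)"
  let ?h = "\<lambda>p x. indicator ?S p *\<^sub>R (of_real (snd p) * heat (fst p) (snd p) (x :: (real ^ 'm) \<times> real))"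
  let ?H = "\<lambda>p x. indicator ?S p *\<^sub>R (of_real (snd p) * heat (fst p) (snd p) x * inv_fourier f x)"
  let ?K = "\<lambda>p x. indicator ?S p *\<^sub>R (of_real (snd p) * heat_hat (fst p) (snd p) x * f x)"
  have a: "0 < g / 2" "g / 2 < pi / 2" using g by auto
  have intH: "integrable (lborel \<Otimes>\<^sub>M lborel) (case_prod ?H)"
    using integrable_heat_pair[OF m a ff norm_inv_fourier_le[OF f]] by simp
  have intK: "integrable (lborel \<Otimes>\<^sub>M lborel) (case_prod ?K)"
    using integrable_heat_hat_pair[OF m a f bdd] by simp
  \<comment> \<open>Two null sets are removed: the one where Fubini gives no integrability in the
    parameters, and the point 0, where Q vanishes.\<close>
  have "AE \<xi> in lborel. (LINT p|lborel. ?H p \<xi>) = of_real (sin g / Q_symbol g \<xi>) * inv_fourier f \<xi>"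
    using lborel_pair.AE_integrable_snd[OF intH] AE_lborel_singleton[of 0]
  proof eventually_elim
    case (elim \<xi>)
    have eq: "?H p \<xi> = ?h p \<xi> * inv_fourier f \<xi>" for p by simp
    show ?case
    \<comment> \<open>Integrability is known for the integrand multiplied by the transform of
      \<open>f\<close>. Where that number is nonzero it can be divided out; where it is zero both
      sides vanish.\<close>
    proof (cases "inv_fourier f \<xi> = 0")
      case False
      have "integrable lborel (\<lambda>p. ?h p \<xi> * inv_fourier f \<xi> * inverse (inv_fourier f \<xi>))"
        using elim(1) unfolding eq by (rule integrable_mult_left)
      then have "integrable lborel (\<lambda>p. ?h p \<xi>)"
        using False by (simp add: mult.assoc)
      from integral_param_heat[OF g elim(2) this] show ?thesis
        unfolding eq by (simp only: integral_mult_left_zero)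
    qed simp
  qed
  then have "(LINT \<xi>|lborel. LINT p|lborel. ?H p \<xi>) =
      (LINT \<xi>|lborel. of_real (sin g / Q_symbol g \<xi>) * inv_fourier f \<xi>)"
    by (intro integral_cong_AE) (use borel_measurable_integrable[OF lborel_pair.integrable_snd[OF intH]] borel_measurable_integrable[OF ff]
      in simp_all)
  also have "\<dots> = of_real (sin g) * (LINT \<xi>|lborel. complex_of_real (1 / Q_symbol g \<xi>) * inv_fourier f \<xi>)"
    by (subst integral_mult_right_zero[symmetric]) simp
  finally have L: "of_real (sin g) * (LINT \<xi>|lborel. complex_of_real (1 / Q_symbol g \<xi>) * inv_fourier f \<xi>) =
      (LINT \<xi>|lborel. LINT p|lborel. ?H p \<xi>)" ..
  also have "\<dots> = (LINT p|lborel. LINT \<xi>|lborel. ?H p \<xi>)"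
    by (rule lborel_pair.Fubini_integral[OF intH])
  also have "\<dots> = (LINT p|lborel. c * (LINT x|lborel. ?K p x))"
  proof (intro Bochner_Integration.integral_cong refl)
    fix p
    show "(LINT \<xi>|lborel. ?H p \<xi>) = c * (LINT x|lborel. ?K p x)"
    proof (cases "p \<in> ?S")
      case True
      then have k: "snd p > 0" and th: "\<bar>fst p\<bar> < pi / 2"
        using g by (auto simp: param_set_def)
      have hi: "integrable lborel (heat (fst p) (snd p) :: (real ^ 'm) \<times> real \<Rightarrow> complex)"
        using heat_fourier(1)[OF k th, of "0 :: (real ^ 'm) \<times> real"] by simp
      have "(LINT \<xi>|lborel. ?H p \<xi>) = of_real (snd p) * (LINT \<xi>|lborel. heat (fst p) (snd p) \<xi> * inv_fourier f \<xi>)"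
        using True by (simp add: mult.assoc)
      also have "\<dots> = of_real (snd p) * (c * (LINT x|lborel. f x * heat_hat (fst p) (snd p) x))"
        unfolding integral_mult_inv_fourier[OF f hi] heat_fourier(2)[OF k th] c_def ..
      also have "\<dots> = c * (LINT x|lborel. of_real (snd p) * (f x * heat_hat (fst p) (snd p) x))"
        by (subst integral_mult_right_zero) (rule mult.left_commute)
      also have "\<dots> = c * (LINT x|lborel. ?K p x)"
        using True by (simp add: mult_ac)
      finally show ?thesis .
    qed simp
  qed
  also have "\<dots> = c * (LINT p|lborel. LINT x|lborel. ?K p x)"
    by (rule integral_mult_right_zero)
  also have "(LINT p|lborel. LINT x|lborel. ?K p x) = (LINT x|lborel. LINT p|lborel. ?K p x)"
    by (rule lborel_pair.Fubini_integral[OF intK, symmetric])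
  also have "\<dots> = (LINT x|lborel. kernel_integral (g / 2) x * f x)"
    unfolding kernel_integral_def by (simp only: mult_scaleR_left[symmetric] integral_mult_left_zero)
  finally show ?thesis
    using sin_gt_zero[OF g] by (simp add: c_def field_simps)
qed

text \<open>For |x| >= r the factor exp (- cos a r^2 / (4 k)) suppresses small scales uniformly,
  while large scales decay by the prefactor. The bound depends on the parameters alone, as dominated
  convergence requires.\<close>

lemma heat_hat_dominated:
  assumes m: "CARD('m::finite) \<ge> 5" and a: "0 < a" "a < pi / 2" and r: "r > 0"
  obtains C where "C \<ge> 0" "\<And>p (x :: (real ^ 'm) \<times> real). \<lbrakk>p \<in> param_set a; r \<le> norm x\<rbrakk> \<Longrightarrow>
    cmod (of_real (snd p) * heat_hat (fst p) (snd p) x) \<le> C / (1 + (snd p)\<^sup>2)"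
proof -
  let ?n = "CARD('m) + 1"
  have c: "cos a > 0" using a by (intro cos_gt_zero_pi) auto
  then have "cos a * r\<^sup>2 / 4 > 0" using r by simp
  moreover have "?n \<ge> 6" using m by simp
  ultimately obtain C where C: "C \<ge> 0" "\<And>\<kappa>. \<kappa> > 0 \<Longrightarrow>
      \<kappa> * sqrt (1 / \<kappa>) ^ ?n * (1 / \<kappa>) ^ 0 * exp (- (cos a * r\<^sup>2 / 4) / \<kappa>) \<le> C * (1 / (1 + \<kappa>\<^sup>2))"
    by (rule kernel_majorant[where j = 0]) blast
  have "cmod (of_real (snd p) * heat_hat (fst p) (snd p) x) \<le> (sqrt pi ^ ?n * C) / (1 + (snd p)\<^sup>2)"
    if p: "p \<in> param_set a" and x: "r \<le> norm x" for p and x :: "(real ^ 'm) \<times> real"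
  proof -
    have k: "snd p > 0" using p by (auto simp: param_set_def)
    have "cos a * r\<^sup>2 \<le> cos (fst p) * (norm x)\<^sup>2"
      using param_cos_ge[OF p] a x r c by (intro mult_mono power_mono) auto
    then have "exp (- (cos (fst p) / (4 * snd p)) * (norm x)\<^sup>2) \<le> exp (- (cos a * r\<^sup>2 / 4) / snd p)"
      using k by (simp add: field_simps)
    moreover have "sqrt (pi / snd p) = sqrt pi * sqrt (1 / snd p)"
      by (simp add: real_sqrt_mult[symmetric])
    ultimately have "cmod (of_real (snd p) * heat_hat (fst p) (snd p) x) \<le>
        sqrt pi ^ ?n * (snd p * sqrt (1 / snd p) ^ ?n * (1 / snd p) ^ 0 * exp (- (cos a * r\<^sup>2 / 4) / snd p))"
      using k by (simp add: norm_mult norm_heat_hat power_mult_distrib mult_ac)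
    also have "\<dots> \<le> sqrt pi ^ ?n * (C * (1 / (1 + (snd p)\<^sup>2)))"
      by (intro mult_left_mono C k) auto
    finally show ?thesis by simp
  qed
  moreover have "sqrt pi ^ ?n * C \<ge> 0" using C(1) by simp
  ultimately show ?thesis by (rule that[rotated])
qed

section \<open>Regularity and symmetry of the kernel off the pole\<close>

lemma heat_hat_param_measurable:
  "(\<lambda>p. indicator (param_set a) p *\<^sub>R (of_real (snd p) * heat_hat (fst p) (snd p) x)) \<in> borel_measurable borel"
proof (rule borel_measurable_continuous_on_indicator[OF param_set_borel])
  show "continuous_on (param_set a) (\<lambda>p. complex_of_real (snd p) * heat_hat (fst p) (snd p) x)"
    by (rule continuous_on_compose2[OF heat_hat_continuous[of a UNIV], of _ "\<lambda>p. (p, x)", simplified])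
      (auto intro!: continuous_intros)
qed

lemma kernel_integral_integrable:
  fixes x :: "(real ^ 'm::finite) \<times> real"
  assumes m: "CARD('m) \<ge> 5" and a: "0 < a" "a < pi / 2" and x: "x \<noteq> 0"
  shows "integrable lborel (\<lambda>p. indicator (param_set a) p *\<^sub>R (of_real (snd p) * heat_hat (fst p) (snd p) x))"
proof -
  obtain C where C: "\<And>p (y :: (real ^ 'm) \<times> real). \<lbrakk>p \<in> param_set a; norm x \<le> norm y\<rbrakk> \<Longrightarrow>
      cmod (of_real (snd p) * heat_hat (fst p) (snd p) y) \<le> C / (1 + (snd p)\<^sup>2)"
    using heat_hat_dominated[OF m a, of "norm x"] x by (metis zero_less_norm_iff)
  show ?thesis
  proof (rule Bochner_Integration.integrable_bound[OF integrable_param_majorant])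
    show "AE p in lborel. cmod (indicator (param_set a) p *\<^sub>R (of_real (snd p) * heat_hat (fst p) (snd p) x)) \<le>
        norm (indicator {- a..a} (fst p) * (C / (1 + (snd p)\<^sup>2)))"
    proof (intro AE_I2)
      fix p
      show "cmod (indicator (param_set a) p *\<^sub>R (of_real (snd p) * heat_hat (fst p) (snd p) x)) \<le>
        norm (indicator {- a..a} (fst p) * (C / (1 + (snd p)\<^sup>2)))"
      proof (cases "p \<in> param_set a")
        case True
        then have "indicator {- a..a} (fst p) = (1::real)" by (auto simp: param_set_def)
        then show ?thesis
          using C[OF True order_refl] True abs_ge_self[of "C / (1 + (snd p)\<^sup>2)"] by simp
      qed simp
    qed
  qed (use heat_hat_param_measurable in simp)
qed

lemma kernel_integral_continuous:
  assumes m: "CARD('m::finite) \<ge> 5" and a: "0 < a" "a < pi / 2"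
  shows "continuous_on (- {0}) (kernel_integral a :: (real ^ 'm) \<times> real \<Rightarrow> complex)"
proof -
  have "isCont (kernel_integral a) x" if x: "x \<noteq> 0" for x :: "(real ^ 'm) \<times> real"
  proof -
    \<comment> \<open>Half the distance to the pole, so that one majorant serves a whole
      neighbourhood of \<open>x\<close>.\<close>
    define r where "r = norm x / 2"
    have r: "r > 0" "r < norm x" using x by (auto simp: r_def)
    obtain C where "C \<ge> 0" and C: "\<And>p (y :: (real ^ 'm) \<times> real). \<lbrakk>p \<in> param_set a; r \<le> norm y\<rbrakk> \<Longrightarrow>
        cmod (of_real (snd p) * heat_hat (fst p) (snd p) y) \<le> C / (1 + (snd p)\<^sup>2)"
      using heat_hat_dominated[OF m a r(1)] by blast
    let ?U = "{y :: (real ^ 'm) \<times> real. r < norm y}"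
    have "open ?U" by (intro open_Collect_less continuous_intros)
    moreover have "continuous_on ?U (kernel_integral a)"
      unfolding continuous_on_sequentially comp_def
    proof (intro ballI allI impI, elim conjE)
      fix y :: "(real ^ 'm) \<times> real" and u
      assume y: "y \<in> ?U" and u: "\<forall>j. u j \<in> ?U" "u \<longlonglongrightarrow> y"
      show "(\<lambda>j. kernel_integral a (u j)) \<longlonglongrightarrow> kernel_integral a y"
        unfolding kernel_integral_def
      proof (rule integral_dominated_convergence[OF _ _ integrable_param_majorant[of a C]])
        show "AE p in lborel. (\<lambda>j. indicator (param_set a) p *\<^sub>R (of_real (snd p) * heat_hat (fst p) (snd p) (u j)))
            \<longlonglongrightarrow> indicator (param_set a) p *\<^sub>R (of_real (snd p) * heat_hat (fst p) (snd p) y)"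
        proof (intro AE_I2)
          fix p :: "real \<times> real"
          show "(\<lambda>j. indicator (param_set a) p *\<^sub>R (of_real (snd p) * heat_hat (fst p) (snd p) (u j)))
            \<longlonglongrightarrow> indicator (param_set a) p *\<^sub>R (of_real (snd p) * heat_hat (fst p) (snd p) y)"
          proof (cases "p \<in> param_set a")
            case True
            then have "complex_of_real (4 * snd p) \<noteq> 0" by (auto simp: param_set_def)
            then show ?thesis
              unfolding heat_hat_def using u(2) by (intro tendsto_intros)
          qed simp
        qed
        show "AE p in lborel. cmod (indicator (param_set a) p *\<^sub>R (of_real (snd p) * heat_hat (fst p) (snd p) (u j))) \<le>
            indicator {- a..a} (fst p) * (C / (1 + (snd p)\<^sup>2))" for j
        proof (intro AE_I2)
          fix p
          show "cmod (indicator (param_set a) p *\<^sub>R (of_real (snd p) * heat_hat (fst p) (snd p) (u j))) \<le>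
            indicator {- a..a} (fst p) * (C / (1 + (snd p)\<^sup>2))"
          proof (cases "p \<in> param_set a")
            case True
            then have "indicator {- a..a} (fst p) = (1::real)" by (auto simp: param_set_def)
            moreover have "r \<le> norm (u j)" using u(1) by (simp add: less_imp_le)
            ultimately show ?thesis
              using C[OF True] True by simp
          next
            case False
            with \<open>C \<ge> 0\<close> show ?thesis by simp
          qed
        qed
      qed (use heat_hat_param_measurable in simp_all)
    qed
    moreover have "x \<in> ?U" using r by simp
    ultimately show ?thesis using continuous_on_eq_continuous_at by blast
  qed
  then show ?thesis by (simp add: continuous_at_imp_continuous_on)
qed

lemma kernel_integral_iterated:
  fixes x :: "(real ^ 'm::finite) \<times> real"
  assumes m: "CARD('m) \<ge> 5" and a: "0 < a" "a < pi / 2" and x: "x \<noteq> 0"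
  shows "kernel_integral a x = (LINT t|lborel. indicator {- a..a} t *\<^sub>R
    (LINT k|lborel. indicator {0<..} k *\<^sub>R (of_real k * heat_hat t k x)))"
proof -
  let ?f = "\<lambda>t k. indicator (param_set a) (t, k) *\<^sub>R (of_real k * heat_hat t k x)"
  have "kernel_integral a x = (LINT p|(lborel \<Otimes>\<^sub>M lborel). (\<lambda>(t, k). ?f t k) p)"
    by (simp add: kernel_integral_def lborel_prod case_prod_unfold)
  also have "\<dots> = (LINT t|lborel. LINT k|lborel. ?f t k)"
    by (rule lborel_pair.integral_fst[symmetric])
      (use kernel_integral_integrable[OF assms] in \<open>simp add: lborel_prod case_prod_unfold\<close>)
  finally show ?thesis
    by (simp add: param_set_def indicator_times flip: scaleR_scaleR)
qed

lemma heat_hat_minus: "heat_hat (- t) k x = cnj (heat_hat t k x)"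
  unfolding heat_hat_def by (simp add: cis_cnj exp_cnj)

text \<open>Reflecting the angle t to -t preserves the interval and conjugates the transformed
  Gaussian, hence the integral equals its own conjugate.\<close>

lemma kernel_integral_real:
  fixes x :: "(real ^ 'm::finite) \<times> real"
  assumes m: "CARD('m) \<ge> 5" and a: "0 < a" "a < pi / 2" and x: "x \<noteq> 0"
  shows "kernel_integral a x = of_real (Re (kernel_integral a x))"
proof -
  let ?h = "\<lambda>t. LINT k|lborel. indicator {0<..} k *\<^sub>R (of_real k * heat_hat t k x)"
  have h: "?h (- t) = cnj (?h t)" for t
    by (subst Bochner_Integration.integral_cnj[symmetric]) (simp add: heat_hat_minus)
  have "kernel_integral a x = (LINT t|lborel. indicator {- a..a} (0 + (-1) * t) *\<^sub>R ?h (0 + (-1) * t))"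
    unfolding kernel_integral_iterated[OF assms]
    by (subst lborel_integral_real_affine[of "-1" _ 0]) simp_all
  also have "\<dots> = (LINT t|lborel. cnj (indicator {- a..a} t *\<^sub>R ?h t))"
  proof (intro Bochner_Integration.integral_cong refl)
    fix t
    have "indicator {- a..a} (- t) = (indicator {- a..a} t :: real)"
      by (auto simp: indicator_def)
    then show "indicator {- a..a} (0 + (-1) * t) *\<^sub>R ?h (0 + (-1) * t) = cnj (indicator {- a..a} t *\<^sub>R ?h t)"
      using h[of t] by simp
  qed
  also have "\<dots> = cnj (kernel_integral a x)"
    unfolding kernel_integral_iterated[OF assms] by (rule Bochner_Integration.integral_cnj)
  finally show ?thesis by (simp add: complex_eq_iff)
qed

section \<open>Values on the axis\<close>

text \<open>This is the derivative of k^(2 - n/2), written with \<open>sqrt\<close> because the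
  Gaussian prefactor occurs in that form. Its constant is minus the exponent \<open>q\<close> of the
  rotation argument below.\<close>

lemma has_real_derivative_power_sqrt_inverse:
  fixes k :: real
  assumes k: "k > 0"
  shows "((\<lambda>k. k\<^sup>2 * sqrt (1 / k) ^ n) has_real_derivative (2 - real n / 2) * (k * sqrt (1 / k) ^ n)) (at k)"
proof -
  have eq: "sqrt (1 / k) ^ n = k powr (- real n / 2)" if "k > 0" for k :: real
  proof -
    have "sqrt (1 / k) = k powr (- 1 / 2)"
      using that by (simp add: powr_minus_divide powr_half_sqrt real_sqrt_divide)
    then show ?thesis using that by (simp add: powr_realpow[symmetric] powr_powr)
  qed
  have 1: "k\<^sup>2 * sqrt (1 / k) ^ n = k powr (2 - real n / 2)" if "k > 0" for k :: real
    using that by (simp add: eq powr_diff powr_minus_divide)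
  have 2: "k * sqrt (1 / k) ^ n = k powr (1 - real n / 2)"
    using k by (simp add: eq powr_diff powr_minus_divide)
  have "((\<lambda>k. k powr (2 - real n / 2)) has_real_derivative (2 - real n / 2) * k powr (2 - real n / 2 - 1)) (at k)"
    using k by (rule has_real_derivative_powr)
  then have "((\<lambda>k. k powr (2 - real n / 2)) has_real_derivative (2 - real n / 2) * (k * sqrt (1 / k) ^ n)) (at k)"
    unfolding 2 by (simp add: algebra_simps)
  then show ?thesis
    by (rule has_field_derivative_transform_within_open[of _ _ _ "{0<..}"]) (use k 1 in auto)
qed

text \<open>Formally \<open>\<integral> k^(1 - n/2) exp (- c b / k) dk = Gamma (n/2 - 2) (c b)^(2 - n/2)\<close> for \<open>c = cis t\<close>;
  only the phase of the right-hand side is needed.\<close>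

lemma rotated_gamma_integral:
  fixes b t :: real
  assumes b: "b > 0" and n: "n \<ge> 6" and t: "\<bar>t\<bar> < pi / 2"
  shows "cis ((real n / 2 - 2) * t) * (LINT k|lborel. indicator {0<..} k *\<^sub>R
      (of_real (k * sqrt (1 / k) ^ n) * exp (- (cis t * of_real b) / of_real k))) =
    of_real (LINT k|lborel. indicator {0<..} k *\<^sub>R (k * sqrt (1 / k) ^ n * exp (- b / k)))"
proof -
  \<comment> \<open>The path at stage \<open>l\<close> is \<zeta> = k cis (-l t), the function is
    \<zeta>^(1 - n/2) exp (-b / \<zeta>). Complex powers are avoided by writing out the phase: (n/2
    - 1) l t from the function and -l t from the derivative of the path leave
    \<open>q * (l * t)\<close>.\<close>
  define q where "q = real n / 2 - 2"
  define w where "w k = k * sqrt (1 / k) ^ n" for k :: real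
  define E where "E l k = exp (- (cis (l * t) * of_real b) / complex_of_real k)" for l k :: real
  define G where "G l k = cis (q * (l * t)) * (of_real (w k) * E l k)" for l k
  define H where "H l k = - \<i> * of_real t * cis (q * (l * t)) * (of_real (k\<^sup>2 * sqrt (1 / k) ^ n) * E l k)" for l k
  define D where "D l k = \<i> * of_real t * (of_real q - cis (l * t) * of_real b / of_real k) * G l k" for l k
  have c: "cos t > 0" using t by (intro cos_gt_zero_pi) auto
  then have cb: "cos t * b > 0" using b by simp
  \<comment> \<open>The exponent 0 bounds \<open>G\<close>; the exponent 1 is for the factor 1/k
    which \<open>D\<close> has in addition.\<close>
  obtain C0 where C0: "C0 \<ge> 0" "\<And>k. k > 0 \<Longrightarrow>
      k * sqrt (1 / k) ^ n * (1 / k) ^ 0 * exp (- (cos t * b) / k) \<le> C0 * (1 / (1 + k\<^sup>2))"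
    by (rule kernel_majorant[OF cb n, where j = 0]) blast
  obtain C1 where C1: "C1 \<ge> 0" "\<And>k. k > 0 \<Longrightarrow>
      k * sqrt (1 / k) ^ n * (1 / k) ^ 1 * exp (- (cos t * b) / k) \<le> C1 * (1 / (1 + k\<^sup>2))"
    by (rule kernel_majorant[OF cb n, where j = 1]) blast
  have q: "q \<ge> 0" using n by (simp add: q_def)
  have w0: "w k \<ge> 0" if "k > 0" for k using that by (simp add: w_def)
  have E: "cmod (E l k) \<le> exp (- (cos t * b) / k)" if "0 \<le> l" "l \<le> 1" "k > 0" for l k
  proof -
    have "cos t = cos \<bar>t\<bar>" by simp
    also have "\<dots> \<le> cos (l * t)"
      using that t by (intro cos_le_cos_of_abs_le) (auto simp: abs_mult mult_left_le_one_le)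
    finally have "cos t * b / k \<le> cos (l * t) * b / k"
      using b that by (intro divide_right_mono mult_right_mono) auto
    then show ?thesis by (simp add: E_def)
  qed
  have G0: "cmod (G l k) \<le> C0 * (1 / (1 + k\<^sup>2))" if "0 \<le> l" "l \<le> 1" "k > 0" for l k
  proof -
    have "cmod (G l k) = w k * cmod (E l k)"
      using w0[OF that(3)] by (simp add: G_def norm_mult)
    also have "\<dots> \<le> w k * exp (- (cos t * b) / k)"
      by (intro mult_left_mono E that w0)
    also have "\<dots> \<le> C0 * (1 / (1 + k\<^sup>2))"
      using C0(2)[OF that(3)] by (simp add: w_def)
    finally show ?thesis .
  qed
  have G1: "cmod (G l k) * (1 / k) \<le> C1 * (1 / (1 + k\<^sup>2))" if "0 \<le> l" "l \<le> 1" "k > 0" for l k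
  proof -
    have "cmod (G l k) = w k * cmod (E l k)"
      using w0[OF that(3)] by (simp add: G_def norm_mult)
    also have "\<dots> \<le> w k * exp (- (cos t * b) / k)"
      by (intro mult_left_mono E that w0)
    finally have "cmod (G l k) * (1 / k) \<le> w k * exp (- (cos t * b) / k) * (1 / k)"
      using that by (intro mult_right_mono) auto
    also have "\<dots> \<le> C1 * (1 / (1 + k\<^sup>2))"
      using C1(2)[OF that(3)] by (simp only: w_def mult_ac power_one_right)
    finally show ?thesis .
  qed
  define K where "K = \<bar>t\<bar> * (q * C0 + b * C1)"
  have DK: "cmod (D l k) \<le> K * (1 / (1 + k\<^sup>2))" if "0 \<le> l" "l \<le> 1" "k > 0" for l k
  proof -
    have "cmod (of_real q - cis (l * t) * of_real b / of_real k) \<le> q + b * (1 / k)"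
      by (rule norm_triangle_le_diff) (use q b that in \<open>simp add: norm_mult norm_divide\<close>)
    then have "cmod (D l k) \<le> \<bar>t\<bar> * (q + b * (1 / k)) * cmod (G l k)"
      unfolding D_def by (auto simp: norm_mult intro!: mult_right_mono mult_left_mono)
    also have "\<dots> = \<bar>t\<bar> * (q * cmod (G l k) + b * (cmod (G l k) * (1 / k)))"
      by (simp add: algebra_simps)
    also have "\<dots> \<le> \<bar>t\<bar> * (q * (C0 * (1 / (1 + k\<^sup>2))) + b * (C1 * (1 / (1 + k\<^sup>2))))"
      using q b by (intro mult_left_mono add_mono G0 G1 that) auto
    also have "\<dots> = K * (1 / (1 + k\<^sup>2))"
      by (simp add: K_def algebra_simps add_divide_distrib)
    finally show ?thesis .
  qed
  \<comment> \<open>\<open>H\<close> is k times \<open>G\<close> up to a factor of modulus |t|. The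
    resulting bound by a multiple of k / (1 + k^2) is not integrable, but it vanishes at 0 and at
    infinity, which is what the boundary terms ask for.\<close>
  have HK: "cmod (H l k) \<le> \<bar>t\<bar> * C0 * (k / (1 + k\<^sup>2))" if "0 \<le> l" "l \<le> 1" "k > 0" for l k
  proof -
    have "H l k = - \<i> * of_real t * (of_real k * G l k)"
      by (simp add: H_def G_def w_def power2_eq_square)
    then have "cmod (H l k) = \<bar>t\<bar> * (k * cmod (G l k))"
      using that by (simp add: norm_mult)
    also have "\<dots> \<le> \<bar>t\<bar> * (k * (C0 * (1 / (1 + k\<^sup>2))))"
      using that by (intro mult_left_mono G0) auto
    finally show ?thesis by (simp add: mult_ac)
  qed
  have e: "einterval 0 \<infinity> = {0<..}" by (auto simp: einterval_iff)
  have "(LINT k:einterval 0 \<infinity>|lborel. G 1 k) = (LINT k:einterval 0 \<infinity>|lborel. G 0 k)"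
  proof (rule integral_deformation[where H = H and D = D and g = "\<lambda>k. K * (1 / (1 + k\<^sup>2))"])
    show "((\<lambda>l. G l k) has_vector_derivative D l k) (at l within {0..1})"
      if "k \<in> einterval 0 \<infinity>" for l k
    proof -
      let ?e = "\<lambda>r u. exp (\<i> * (of_real r * (u * complex_of_real t)))"
      have k: "complex_of_real k \<noteq> 0" using that by (simp add: e)
      have "((\<lambda>u. ?e q u * (of_real (w k) * exp (- (?e 1 u * of_real b) / of_real k))) has_field_derivative D l k) (at (of_real l))"
        unfolding D_def G_def E_def cis_conv_exp
        by (rule derivative_eq_intros refl k)+ (use k in \<open>simp add: field_simps\<close>)
      from has_vector_derivative_real_field[OF this] show ?thesis
        by (simp add: G_def E_def cis_conv_exp)
    qed
    show "(H l has_vector_derivative D l k) (at k)" if "k \<in> einterval 0 \<infinity>" for l k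
    proof -
      have k: "k > 0" "complex_of_real k \<noteq> 0" using that by (simp_all add: e)
      have "((\<lambda>k. complex_of_real (k\<^sup>2 * sqrt (1 / k) ^ n)) has_vector_derivative of_real (- q * w k)) (at k)"
        using has_real_derivative_power_sqrt_inverse[OF k(1), of n]
        by (intro has_vector_derivative_of_real) (simp add: q_def w_def algebra_simps)
      moreover have "(E l has_vector_derivative E l k * (cis (l * t) * of_real b / (of_real k)\<^sup>2)) (at k)"
      proof -
        have "((\<lambda>u. exp (- (cis (l * t) * of_real b) / u)) has_field_derivative
            E l k * (cis (l * t) * of_real b / (of_real k)\<^sup>2)) (at (of_real k))"
          unfolding E_def by (rule derivative_eq_intros refl k)+ (use k in \<open>simp add: field_simps power2_eq_square\<close>)
        from has_vector_derivative_real_field[OF this] show ?thesis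
          by (simp add: E_def[abs_def])
      qed
      ultimately have "(H l has_vector_derivative (- \<i> * of_real t * cis (q * (l * t))) *
          (of_real (k\<^sup>2 * sqrt (1 / k) ^ n) * (E l k * (cis (l * t) * of_real b / (of_real k)\<^sup>2)) + of_real (- q * w k) * E l k)) (at k)"
        unfolding H_def[abs_def] by (intro has_vector_derivative_mult_right has_vector_derivative_mult)
      moreover have "(- \<i> * of_real t * cis (q * (l * t))) *
          (of_real (k\<^sup>2 * sqrt (1 / k) ^ n) * (E l k * (cis (l * t) * of_real b / (of_real k)\<^sup>2)) + of_real (- q * w k) * E l k) = D l k"
      proof -
        have R: "complex_of_real (k\<^sup>2 * sqrt (1 / k) ^ n) = of_real k * of_real (w k)"
          by (simp add: w_def power2_eq_square)
        show ?thesis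
          unfolding R D_def G_def using k by (simp add: field_simps power2_eq_square)
      qed
      ultimately show ?thesis by simp
    qed
    show "continuous_on ({0..1} \<times> einterval 0 \<infinity>) (\<lambda>(l, k). D l k)"
      unfolding D_def G_def E_def w_def cis_conv_exp case_prod_unfold
      by (intro continuous_intros) (auto simp: e)
    have "((\<lambda>k. \<bar>t\<bar> * C0 * (k / (1 + k\<^sup>2))) \<longlongrightarrow> \<bar>t\<bar> * C0 * (0 / (1 + 0\<^sup>2))) (at_right 0)"
      by (intro tendsto_intros) auto
    then have lim: "((\<lambda>k. \<bar>t\<bar> * C0 * (k / (1 + k\<^sup>2))) \<longlongrightarrow> 0) (at_right 0)" by simp
    have "(H l \<longlongrightarrow> 0) (at_right 0)" if "0 \<le> l" "l \<le> 1" for l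
      by (rule Lim_null_comparison[OF eventually_mono[OF eventually_at_right_less HK[OF that]] lim])
    then show "((H l \<circ> real_of_ereal) \<longlongrightarrow> 0) (at_right 0)" if "0 \<le> l" "l \<le> 1" for l
      unfolding zero_ereal_def using that by (simp add: ereal_tendsto_simps)
    have "((\<lambda>k::real. \<bar>t\<bar> * C0 * (k / (1 + k\<^sup>2))) \<longlongrightarrow> \<bar>t\<bar> * C0 * 0) at_top"
      by (intro tendsto_mult_left) real_asymp
    then have lim: "((\<lambda>k. \<bar>t\<bar> * C0 * (k / (1 + k\<^sup>2))) \<longlongrightarrow> 0) at_top" by simp
    have "(H l \<longlongrightarrow> 0) at_top" if "0 \<le> l" "l \<le> 1" for l
      by (rule Lim_null_comparison[OF eventually_mono[OF eventually_gt_at_top HK[OF that]] lim])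
    then show "((H l \<circ> real_of_ereal) \<longlongrightarrow> 0) (at_left \<infinity>)" if "0 \<le> l" "l \<le> 1" for l
      using that by (simp add: ereal_tendsto_simps)
    have intG: "set_integrable lborel (einterval 0 \<infinity>) (G l)" if "0 \<le> l" "l \<le> 1" for l
      unfolding set_integrable_def e
    proof (rule Bochner_Integration.integrable_bound)
      show "integrable lborel (\<lambda>k::real. C0 * (1 / (1 + k\<^sup>2)))"
        by (intro integrable_mult_right integrable_inverse_1_plus_square_lborel)
      show "AE k in lborel. cmod (indicator {0<..} k *\<^sub>R G l k) \<le> norm (C0 * (1 / (1 + k\<^sup>2)))"
        using G0[OF that] C0(1) by (intro AE_I2) (auto simp: indicator_def)
      have "continuous_on {0<..} (G l)"
        unfolding G_def E_def w_def by (intro continuous_intros) auto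
      then show "(\<lambda>k. indicator {0<..} k *\<^sub>R G l k) \<in> borel_measurable lborel"
        by (simp add: borel_measurable_continuous_on_indicator)
    qed
    show "set_integrable lborel (einterval 0 \<infinity>) (G 0)" "set_integrable lborel (einterval 0 \<infinity>) (G 1)"
      using intG by simp_all
    show "set_integrable lborel (einterval 0 \<infinity>) (\<lambda>k. K * (1 / (1 + k\<^sup>2)))"
      using integrable_mult_indicator[OF _ integrable_mult_right[OF integrable_inverse_1_plus_square_lborel, of K], of "{0<..}"]
      by (simp add: set_integrable_def e)
  qed (use DK in \<open>auto simp: e\<close>)
  then have "(LINT k|lborel. indicator {0<..} k *\<^sub>R G 1 k) = (LINT k|lborel. indicator {0<..} k *\<^sub>R G 0 k)"
    by (simp add: e set_lebesgue_integral_def)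
  also have "\<dots> = (LINT k|lborel. complex_of_real (indicator {0<..} k *\<^sub>R (w k * exp (- b / k))))"
    by (intro Bochner_Integration.integral_cong refl)
      (simp add: G_def E_def scaleR_conv_of_real flip: exp_of_real)
  also have "\<dots> = of_real (LINT k|lborel. indicator {0<..} k *\<^sub>R (w k * exp (- b / k)))"
    by (rule integral_complex_of_real)
  also have "(LINT k|lborel. indicator {0<..} k *\<^sub>R G 1 k) =
      cis (q * t) * (LINT k|lborel. indicator {0<..} k *\<^sub>R (of_real (w k) * exp (- (cis t * of_real b) / of_real k)))"
    by (subst integral_mult_right_zero[symmetric]) (simp add: G_def E_def scaleR_conv_of_real mult.left_commute)
  finally show ?thesis by (simp add: q_def w_def)
qed

text \<open>On the axis a single angle is left in the exponent, so one rotation of the scale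
  integral removes it and leaves a pure phase. The integral of this phase over the symmetric
  interval is a multiple of the sine.\<close>

lemma kernel_integral_axis:
  fixes t :: real
  assumes m: "CARD('m::finite) \<ge> 5" and a: "0 < a" "a < pi / 2" and t: "t \<noteq> 0"
  obtains h where "h > 0" "Re (kernel_integral a (0 :: real ^ 'm, t)) = h * sin ((real CARD('m) - 2) * a)"
proof -
  let ?n = "CARD('m) + 1"
  define p where "p = real CARD('m) - 2"
  define b where "b = t\<^sup>2 / 4"
  have b: "b > 0" using t by (simp add: b_def)
  have p: "p > 0" using m by (simp add: p_def)
  have n: "?n \<ge> 6" using m by simp
  let ?w = "\<lambda>k. indicator {0<..} k *\<^sub>R (k * sqrt (1 / k) ^ ?n * exp (- b / k))"
  define h where "h = (LINT k|lborel. ?w k)"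
  have h0: "h > 0"
  proof -
    obtain C where C: "C \<ge> 0" "\<And>k. k > 0 \<Longrightarrow> k * sqrt (1 / k) ^ ?n * (1 / k) ^ 0 * exp (- b / k) \<le> C * (1 / (1 + k\<^sup>2))"
      by (rule kernel_majorant[OF b n, where j = 0]) blast
    have int: "integrable lborel ?w"
    proof (rule Bochner_Integration.integrable_bound)
      show "integrable lborel (\<lambda>k::real. C * (1 / (1 + k\<^sup>2)))"
        by (intro integrable_mult_right integrable_inverse_1_plus_square_lborel)
      have "continuous_on {0<..} (\<lambda>k. k * sqrt (1 / k) ^ ?n * exp (- b / k))"
        by (intro continuous_intros) auto
      then show "?w \<in> borel_measurable lborel"
        unfolding measurable_lborel2 by (intro borel_measurable_continuous_on_indicator) auto
      show "AE k in lborel. norm (?w k) \<le> norm (C * (1 / (1 + k\<^sup>2)))"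
      proof (intro AE_I2)
        fix k :: real
        show "norm (?w k) \<le> norm (C * (1 / (1 + k\<^sup>2)))"
          using C(2)[of k] C(1) by (cases "k > 0") (simp_all add: abs_mult)
      qed
    qed
    \<comment> \<open>A lower bound of the integrand on [1, 2], which makes the integral strictly
      positive: the root is smallest at k = 2, the exponential at k = 1.\<close>
    define d where "d = sqrt (1 / 2) ^ ?n * exp (- b)"
    have "d * indicator {1..2} k \<le> ?w k" for k :: real
    proof (cases "1 \<le> k \<and> k \<le> 2")
      case True
      have "sqrt (1 / 2) ^ ?n \<le> sqrt (1 / k) ^ ?n"
        using True by (intro power_mono real_sqrt_le_mono divide_left_mono) auto
      moreover have "exp (- b) \<le> exp (- b / k)"
        using True b by (simp add: divide_le_eq)
      ultimately have "d \<le> sqrt (1 / k) ^ ?n * exp (- b / k)"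
        unfolding d_def using True by (intro mult_mono) auto
      also have "\<dots> \<le> k * (sqrt (1 / k) ^ ?n * exp (- b / k))"
        using True by (intro mult_right_mono[of 1 k, simplified]) auto
      finally show ?thesis using True by (simp add: mult.assoc)
    qed (auto simp: indicator_def)
    then have "(LINT k|lborel. d * indicator {1..2} (k::real)) \<le> h"
      unfolding h_def by (intro integral_mono int) auto
    moreover have "(LINT k|lborel. d * indicator {1..2} (k::real)) = d"
      by simp
    moreover have "d > 0" by (simp add: d_def)
    ultimately show ?thesis by linarith
  qed
  have inner: "(LINT k|lborel. indicator {0<..} k *\<^sub>R (of_real k * heat_hat s k (0 :: real ^ 'm, t))) =
      of_real (sqrt pi ^ ?n * h) * cis (- (p * s))" if s: "\<bar>s\<bar> < pi / 2" for s
  proof -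
    let ?J = "LINT k|lborel. indicator {0<..} k *\<^sub>R (of_real (k * sqrt (1 / k) ^ ?n) * exp (- (cis s * of_real b) / of_real k))"
    let ?c = "of_real (sqrt pi ^ ?n) * cis (- (real CARD('m) - 1) * s / 2)"
    have "of_real k * heat_hat s k (0 :: real ^ 'm, t) =
        ?c * (of_real (k * sqrt (1 / k) ^ ?n) * exp (- (cis s * of_real b) / of_real k))" for k
    proof -
      have "sqrt (pi / k) = sqrt pi * sqrt (1 / k)" by (simp add: real_sqrt_mult[symmetric])
      then show ?thesis
        by (simp add: heat_hat_def b_def power_mult_distrib mult_ac)
    qed
    then have "(LINT k|lborel. indicator {0<..} k *\<^sub>R (of_real k * heat_hat s k (0 :: real ^ 'm, t))) = ?c * ?J"
      by (subst integral_mult_right_zero[symmetric]) (simp only: mult_scaleR_right)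
    moreover have "?J = cis (- ((real ?n / 2 - 2) * s)) * of_real h"
    proof -
      have "cis (- ((real ?n / 2 - 2) * s)) * (cis ((real ?n / 2 - 2) * s) * ?J) = cis (- ((real ?n / 2 - 2) * s)) * of_real h"
        unfolding h_def by (subst rotated_gamma_integral[OF b n s]) (rule refl)
      then show ?thesis
        by (simp only: mult.assoc[symmetric] cis_mult) simp
    qed
    moreover have "cis (- (real CARD('m) - 1) * s / 2) * cis (- ((real ?n / 2 - 2) * s)) = cis (- (p * s))"
      unfolding cis_mult by (rule arg_cong[where f = cis]) (simp add: p_def field_simps)
    ultimately show ?thesis
      by (simp add: mult_ac)
  qed
  have "kernel_integral a (0 :: real ^ 'm, t) =
      (LINT s|lborel. of_real (sqrt pi ^ ?n * h) * (indicator {- a..a} s *\<^sub>R cis (- (p * s))))"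
  proof (subst kernel_integral_iterated[OF m a])
    show "(0 :: real ^ 'm, t) \<noteq> 0" using t by (simp add: zero_prod_def)
    show "(LINT s|lborel. indicator {- a..a} s *\<^sub>R (LINT k|lborel. indicator {0<..} k *\<^sub>R (of_real k * heat_hat s k (0 :: real ^ 'm, t)))) =
      (LINT s|lborel. of_real (sqrt pi ^ ?n * h) * (indicator {- a..a} s *\<^sub>R cis (- (p * s))))"
    proof (intro Bochner_Integration.integral_cong refl)
      fix s
      show "indicator {- a..a} s *\<^sub>R (LINT k|lborel. indicator {0<..} k *\<^sub>R (of_real k * heat_hat s k (0 :: real ^ 'm, t))) =
        of_real (sqrt pi ^ ?n * h) * (indicator {- a..a} s *\<^sub>R cis (- (p * s)))"
      proof (cases "s \<in> {- a..a}")
        case True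
        then have "\<bar>s\<bar> < pi / 2" using a by auto
        from inner[OF this] True show ?thesis by simp
      qed simp
    qed
  qed
  also have "\<dots> = of_real (sqrt pi ^ ?n * h) * (LINT s|lborel. indicator {- a..a} s *\<^sub>R cis (- (p * s)))"
    by (rule integral_mult_right_zero)
  also have "(LINT s|lborel. indicator {- a..a} s *\<^sub>R cis (- (p * s))) =
      \<i> / of_real p * cis (- (p * a)) - \<i> / of_real p * cis (- (p * (- a)))"
  proof (rule integral_FTC_Icc)
    show "((\<lambda>s. \<i> / of_real p * cis (- (p * s))) has_vector_derivative cis (- (p * s))) (at s within {- a..a})" for s
    proof -
      have "((\<lambda>u. \<i> / of_real p * exp (\<i> * (- (of_real p * u)))) has_field_derivative cis (- (p * s))) (at (of_real s))"
        unfolding cis_conv_exp using p by (auto intro!: derivative_eq_intros simp: field_simps)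
      from has_vector_derivative_real_field[OF this] show ?thesis
        by (simp add: cis_conv_exp)
    qed
    show "continuous_on {- a..a} (\<lambda>s. cis (- (p * s)))"
      unfolding cis_conv_exp by (intro continuous_intros)
  qed (use a in simp)
  also have "\<dots> = of_real (2 * sin (p * a) / p)"
    using p by (simp add: complex_eq_iff Re_divide_of_real Im_divide_of_real)
  finally have "Re (kernel_integral a (0 :: real ^ 'm, t)) = sqrt pi ^ ?n * h * (2 / p) * sin (p * a)"
    by (simp flip: of_real_mult of_real_power)
  moreover have "sqrt pi ^ ?n * h * (2 / p) > 0" using h0 p by simp
  ultimately show ?thesis using that unfolding p_def by blast
qed

section \<open>Uniqueness\<close>

lemma real_polynomial_function_partial:
  assumes "real_polynomial_function p"
  shows "\<exists>q. real_polynomial_function q \<and> (\<forall>x. \<exists>D. (p has_derivative D) (at x) \<and> D v = q x)"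
  using assms
proof (induction rule: real_polynomial_function.induct)
  case (linear f)
  then show ?case
    by (intro exI[of _ "\<lambda>_. f v"]) (auto intro: bounded_linear_imp_has_derivative)
next
  case (const c)
  show ?case by (intro exI[of _ "\<lambda>_. 0"]) (auto intro!: exI[of _ "\<lambda>_. 0"])
next
  case (add f g)
  then obtain f' g' where f': "real_polynomial_function f'" "\<And>x. \<exists>D. (f has_derivative D) (at x) \<and> D v = f' x"
    and g': "real_polynomial_function g'" "\<And>x. \<exists>D. (g has_derivative D) (at x) \<and> D v = g' x"
    by blast
  have "\<exists>D. ((\<lambda>x. f x + g x) has_derivative D) (at x) \<and> D v = f' x + g' x" for x
  proof -
    obtain D E where "(f has_derivative D) (at x)" "D v = f' x" "(g has_derivative E) (at x)" "E v = g' x"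
      using f'(2)[of x] g'(2)[of x] by blast
    then show ?thesis
      by (intro exI[of _ "\<lambda>h. D h + E h"] conjI has_derivative_add) simp_all
  qed
  with f'(1) g'(1) show ?case
    by (intro exI[of _ "\<lambda>x. f' x + g' x"]) auto
next
  case (mult f g)
  then obtain f' g' where f': "real_polynomial_function f'" "\<And>x. \<exists>D. (f has_derivative D) (at x) \<and> D v = f' x"
    and g': "real_polynomial_function g'" "\<And>x. \<exists>D. (g has_derivative D) (at x) \<and> D v = g' x"
    by blast
  have "\<exists>D. ((\<lambda>x. f x * g x) has_derivative D) (at x) \<and> D v = f x * g' x + f' x * g x" for x
  proof -
    obtain D E where "(f has_derivative D) (at x)" "D v = f' x" "(g has_derivative E) (at x)" "E v = g' x"
      using f'(2)[of x] g'(2)[of x] by blast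
    then show ?thesis
      by (intro exI[of _ "\<lambda>h. f x * E h + D h * g x"] conjI has_derivative_mult) simp_all
  qed
  with f'(1) g'(1) mult.hyps show ?case
    by (intro exI[of _ "\<lambda>x. f x * g' x + f' x * g x"]) auto
qed

lemma real_polynomial_function_growth:
  assumes "real_polynomial_function p"
  shows "\<exists>C k. 0 \<le> C \<and> (\<forall>x. \<bar>p x\<bar> \<le> C * (1 + norm x) ^ k)"
  using assms
proof (induction rule: real_polynomial_function.induct)
  case (linear f)
  then obtain K where K: "K > 0" "\<And>x. norm (f x) \<le> norm x * K"
    using bounded_linear.pos_bounded by blast
  have "\<bar>f x\<bar> \<le> K * (1 + norm x) ^ 1" for x
    using K(2)[of x] K(1) by (simp add: algebra_simps)
  with K(1) show ?case by (meson less_imp_le)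
next
  case (const c)
  show ?case by (intro exI[of _ "\<bar>c\<bar>"] exI[of _ 0]) auto
next
  case (add f g)
  then obtain C k D l where f: "0 \<le> C" "\<And>x. \<bar>f x\<bar> \<le> C * (1 + norm x) ^ k"
    and g: "0 \<le> D" "\<And>x. \<bar>g x\<bar> \<le> D * (1 + norm x) ^ l"
    by blast
  have "\<bar>f x + g x\<bar> \<le> (C + D) * (1 + norm x) ^ (k + l)" for x
  proof -
    have "\<bar>f x + g x\<bar> \<le> C * (1 + norm x) ^ k + D * (1 + norm x) ^ l"
      using f(2)[of x] g(2)[of x] by linarith
    also have "\<dots> \<le> C * (1 + norm x) ^ (k + l) + D * (1 + norm x) ^ (k + l)"
      using f(1) g(1) by (intro add_mono mult_left_mono power_increasing) auto
    finally show ?thesis by (simp add: algebra_simps)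
  qed
  with f(1) g(1) show ?case by (meson add_nonneg_nonneg)
next
  case (mult f g)
  then obtain C k D l where f: "0 \<le> C" "\<And>x. \<bar>f x\<bar> \<le> C * (1 + norm x) ^ k"
    and g: "0 \<le> D" "\<And>x. \<bar>g x\<bar> \<le> D * (1 + norm x) ^ l"
    by blast
  have "\<bar>f x * g x\<bar> \<le> (C * D) * (1 + norm x) ^ (k + l)" for x
    using mult_mono[OF f(2)[of x] g(2)[of x]] f(1) by (simp add: abs_mult power_add mult_ac)
  with f(1) g(1) show ?case by (meson mult_nonneg_nonneg)
qed

text \<open>Polynomials times the Gaussian are closed under directional derivatives, so all iterated
  derivatives stay in this class, and their polynomial growth loses against exp (-l |y -
  x0|^2).\<close>

lemma schwartz_gaussian:
  fixes x0 :: "'a::euclidean_space"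
  assumes l: "l > 0"
  shows "schwartz (\<lambda>y. complex_of_real (exp (- l * (norm (y - x0))\<^sup>2)))"
proof -
  let ?e = "\<lambda>y. exp (- l * (norm (y - x0))\<^sup>2)"
  have de: "(?e has_derivative (\<lambda>h. - 2 * l * ((y - x0) \<bullet> h) * ?e y)) (at y)" for y
    unfolding power2_norm_eq_inner
    by (auto intro!: derivative_eq_intros simp: inner_commute algebra_simps)
  have step: "\<exists>q. real_polynomial_function q \<and>
      (\<forall>y. ((\<lambda>y. complex_of_real (p y * ?e y)) differentiable (at y)) \<and>
        partial_deriv v (\<lambda>y. complex_of_real (p y * ?e y)) y = of_real (q y * ?e y))"
    if p: "real_polynomial_function p" for p and v :: 'a
  proof -
    obtain q where q: "real_polynomial_function q" "\<And>y. \<exists>D. (p has_derivative D) (at y) \<and> D v = q y"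
      using real_polynomial_function_partial[OF p] by meson
    \<comment> \<open>Leibniz rule; the second summand is \<open>p\<close> times the logarithmic
      derivative of the Gaussian.\<close>
    define r where "r y = q y + p y * (- 2 * l * ((y - x0) \<bullet> v))" for y
    have "real_polynomial_function (\<lambda>y. y \<bullet> v + (- (x0 \<bullet> v)))"
      by (intro real_polynomial_function.intros bounded_linear_inner_left)
    then have "real_polynomial_function (\<lambda>y. (y - x0) \<bullet> v)"
      by (simp add: inner_diff_left)
    then have "real_polynomial_function r"
      unfolding r_def[abs_def]
      by (intro real_polynomial_function.intros(2-4) q(1) p)
    moreover have "((\<lambda>y. complex_of_real (p y * ?e y)) differentiable (at y)) \<and>
        partial_deriv v (\<lambda>y. complex_of_real (p y * ?e y)) y = of_real (r y * ?e y)" for y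
    proof -
      obtain D where D: "(p has_derivative D) (at y)" "D v = q y" using q(2) by blast
      have "((\<lambda>y. complex_of_real (p y * ?e y)) has_derivative
          (\<lambda>h. complex_of_real (p y * (- 2 * l * ((y - x0) \<bullet> h) * ?e y) + D h * ?e y))) (at y)"
        by (intro has_derivative_of_real has_derivative_mult D de)
      from this frechet_derivative_at[OF this] show ?thesis
        unfolding partial_deriv_def differentiable_def using D(2)
        by (auto simp: r_def algebra_simps fun_eq_iff dest: spec[of _ v])
    qed
    ultimately show ?thesis by blast
  qed
  have iter: "\<exists>p. real_polynomial_function p \<and>
      iter_partial vs (\<lambda>y. complex_of_real (?e y)) = (\<lambda>y. complex_of_real (p y * ?e y))" for vs
  proof (induction vs)
    case Nil
    show ?case by (intro exI[of _ "\<lambda>_. 1"]) auto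
  next
    case (Cons v vs)
    then obtain p where p: "real_polynomial_function p"
      "iter_partial vs (\<lambda>y. complex_of_real (?e y)) = (\<lambda>y. complex_of_real (p y * ?e y))" by blast
    from step[OF p(1), of v] obtain q where "real_polynomial_function q"
      "\<And>y. partial_deriv v (\<lambda>y. complex_of_real (p y * ?e y)) y = of_real (q y * ?e y)" by blast
    then show ?case unfolding iter_partial.simps p(2) by blast
  qed
  have "smooth (\<lambda>y. complex_of_real (?e y))"
    unfolding smooth_def
  proof (intro ballI allI)
    fix vs and y :: 'a
    from iter[of vs] obtain p where p: "real_polynomial_function p"
      "iter_partial vs (\<lambda>y. complex_of_real (?e y)) = (\<lambda>y. complex_of_real (p y * ?e y))" by blast
    show "iter_partial vs (\<lambda>y. complex_of_real (?e y)) differentiable (at y)"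
      unfolding p(2) using step[OF p(1)] by blast
  qed
  moreover have "\<exists>C. \<forall>y. norm y ^ k * cmod (iter_partial vs (\<lambda>y. complex_of_real (?e y)) y) \<le> C" for vs k
  proof -
    from iter[of vs] obtain p where p: "real_polynomial_function p"
      "iter_partial vs (\<lambda>y. complex_of_real (?e y)) = (\<lambda>y. complex_of_real (p y * ?e y))" by blast
    obtain C j where C: "0 \<le> C" "\<And>y. \<bar>p y\<bar> \<le> C * (1 + norm y) ^ j"
      using real_polynomial_function_growth[OF p(1)] by blast
    \<comment> \<open>With this constant 1 + |y| <= c + |y - x0|, so all growth is measured from the
      centre of the Gaussian.\<close>
    define c where "c = 1 + norm x0"
    have c: "c > 0" by (simp add: c_def add_pos_nonneg)
    have "((\<lambda>s. (c + s) ^ (k + j) * exp (- l * s\<^sup>2)) \<longlongrightarrow> 0) at_top"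
      using c l by real_asymp
    moreover have "continuous_on {0..} (\<lambda>s. (c + s) ^ (k + j) * exp (- l * s\<^sup>2))"
      by (intro continuous_intros)
    ultimately obtain M where M: "\<And>s. s \<ge> 0 \<Longrightarrow> \<bar>(c + s) ^ (k + j) * exp (- l * s\<^sup>2)\<bar> \<le> M"
      using bounded_of_tendsto_at_top by meson
    have "norm y ^ k * cmod (complex_of_real (p y * ?e y)) \<le> C * M" for y
    proof -
      have n: "1 + norm y \<le> c + norm (y - x0)"
        unfolding c_def using norm_triangle_sub[of y x0] by linarith
      have "norm y ^ k * cmod (complex_of_real (p y * ?e y)) = norm y ^ k * \<bar>p y\<bar> * ?e y"
        by (simp add: norm_mult abs_mult del: of_real_mult)
      also have "\<dots> \<le> (c + norm (y - x0)) ^ k * (C * (c + norm (y - x0)) ^ j) * ?e y"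
      proof (intro mult_right_mono mult_mono)
        show "norm y ^ k \<le> (c + norm (y - x0)) ^ k"
          using n by (intro power_mono) auto
        have "(1 + norm y) ^ j \<le> (c + norm (y - x0)) ^ j"
          using n by (intro power_mono) auto
        then show "\<bar>p y\<bar> \<le> C * (c + norm (y - x0)) ^ j"
          using C order_trans mult_left_mono by blast
      qed (use c in auto)
      also have "\<dots> = C * ((c + norm (y - x0)) ^ (k + j) * ?e y)"
        by (simp add: power_add)
      also have "\<dots> \<le> C * M"
        using M[of "norm (y - x0)"] C(1) by (intro mult_left_mono) auto
      finally show ?thesis .
    qed
    then show ?thesis unfolding p(2) by blast
  qed
  ultimately show ?thesis by (simp add: schwartz_def)
qed

text \<open>Test with \<open>w l y = exp (- l (|y - x0|^2 - \<eta>^2))\<close>: as \<open>l\<close> grows this tends to infinity near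
  \<open>x0\<close>, while outside the ball of radius \<open>\<eta>\<close> it stays below \<open>w 1\<close>.\<close>

lemma distr_le_imp_le:
  fixes F1 F2 :: "'a::euclidean_space \<Rightarrow> real"
  assumes cont: "continuous_on (- {0}) F1" "continuous_on (- {0}) F2"
    and int: "\<And>\<phi>. schwartz \<phi> \<Longrightarrow> integrable lborel (\<lambda>x. complex_of_real (F1 x) * \<phi> x)"
      "\<And>\<phi>. schwartz \<phi> \<Longrightarrow> integrable lborel (\<lambda>x. complex_of_real (F2 x) * \<phi> x)"
    and eq: "\<And>\<phi>. schwartz \<phi> \<Longrightarrow> regular_distr F1 \<phi> = regular_distr F2 \<phi>"
    and x0: "x0 \<noteq> 0"
  shows "F1 x0 \<le> F2 x0"
proof (rule ccontr)
  assume "\<not> F1 x0 \<le> F2 x0"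
  define D where "D x = F1 x - F2 x" for x
  define d where "d = D x0 / 2"
  have d: "d > 0" using \<open>\<not> F1 x0 \<le> F2 x0\<close> by (simp add: d_def D_def)
  have "isCont D x0"
    unfolding D_def using cont x0
    by (intro continuous_intros) (simp_all add: continuous_on_eq_continuous_at open_Compl)
  then obtain r where r: "r > 0" "\<And>y. dist y x0 < r \<Longrightarrow> dist (D y) (D x0) < d"
    using d unfolding continuous_at_eps_delta by blast
  have Dd: "D y \<ge> d" if "norm (y - x0) < r" for y
    using r(2)[of y] that by (auto simp: dist_norm dist_real_def d_def abs_if split: if_splits)
  \<comment> \<open>\<open>D\<close> is at least \<open>d\<close> on the ball of radius r = 2
    \<eta>, while the weight passes through 1 at radius \<eta>; the shell in between contributes a
    nonnegative amount.\<close>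
  define \<eta> where "\<eta> = r / 2"
  have eta: "\<eta> > 0" "r = 2 * \<eta>" using r by (simp_all add: \<eta>_def)
  define w where "w l y = exp (- l * ((norm (y - x0))\<^sup>2 - \<eta>\<^sup>2))" for l :: real and y
  have w: "integrable lborel (\<lambda>y. D y * w l y)" "(LINT y|lborel. D y * w l y) = 0" if l: "l > 0" for l
  proof -
    let ?e = "\<lambda>y. exp (- l * (norm (y - x0))\<^sup>2)"
    note s = schwartz_gaussian[OF l, of x0]
    have i: "integrable lborel (\<lambda>y. F1 y * ?e y)" "integrable lborel (\<lambda>y. F2 y * ?e y)"
      using int[OF s] by (simp_all only: of_real_mult[symmetric] complex_of_real_integrable_eq)
    have "(LINT y|lborel. F1 y * ?e y) = (LINT y|lborel. F2 y * ?e y)"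
      using eq[OF s] unfolding regular_distr_def
      by (simp only: of_real_mult[symmetric] integral_complex_of_real of_real_eq_iff)
    then have 0: "integrable lborel (\<lambda>y. D y * ?e y)" "(LINT y|lborel. D y * ?e y) = 0"
      using i by (simp_all add: D_def left_diff_distrib)
    have weq: "D y * w l y = exp (l * \<eta>\<^sup>2) * (D y * ?e y)" for y
      by (simp add: w_def algebra_simps flip: exp_add)
    show "integrable lborel (\<lambda>y. D y * w l y)" "(LINT y|lborel. D y * w l y) = 0"
      unfolding weq using 0 by simp_all
  qed
  have int1: "integrable lborel (\<lambda>y. \<bar>D y * w 1 y\<bar>)"
    using w(1)[of 1] by simp
  define B where "B = ball x0 (\<eta> / 2)"
  define V where "V = measure lborel B"
  have V: "V > 0" unfolding V_def B_def using eta by (simp add: content_ball_pos)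
  have key: "d * (l * (3 * \<eta>\<^sup>2 / 4)) * V \<le> (LINT y|lborel. \<bar>D y * w 1 y\<bar>)" if l: "l \<ge> 1" for l
  proof -
    \<comment> \<open>On the small ball the lower bound grows linearly in \<open>l\<close>; in the
      rest of the ball of radius \<open>r\<close> the integrand is nonnegative; outside it the
      weight decreases in \<open>l\<close>, so l = 1 provides a majorant.\<close>
    have pt: "d * (l * (3 * \<eta>\<^sup>2 / 4)) * indicator B y - \<bar>D y * w 1 y\<bar> \<le> D y * w l y" for y
    proof (cases "norm (y - x0) < r")
      case True
      then have Dy: "D y \<ge> d" by (rule Dd)
      have "d * (l * (3 * \<eta>\<^sup>2 / 4)) * indicator B y \<le> D y * w l y"
      proof (cases "y \<in> B")
        case True
        then have "norm (y - x0) \<le> \<eta> / 2" by (simp add: B_def dist_norm norm_minus_commute)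
        then have "(norm (y - x0))\<^sup>2 \<le> (\<eta> / 2)\<^sup>2" by (rule power_mono) simp
        \<comment> \<open>Here 3/4 is 1 - (1/2)^2; the linear growth in \<open>l\<close> then comes
          from exp u >= 1 + u.\<close>
        then have "(norm (y - x0))\<^sup>2 - \<eta>\<^sup>2 \<le> - (3 * \<eta>\<^sup>2 / 4)" by (simp add: power_divide)
        then have "l * (3 * \<eta>\<^sup>2 / 4) \<le> - l * ((norm (y - x0))\<^sup>2 - \<eta>\<^sup>2)"
          using l mult_left_mono[of "(norm (y - x0))\<^sup>2 - \<eta>\<^sup>2" "- (3 * \<eta>\<^sup>2 / 4)" l] by simp
        also have "\<dots> \<le> w l y"
          unfolding w_def using exp_ge_add_one_self[of "- l * ((norm (y - x0))\<^sup>2 - \<eta>\<^sup>2)"] by linarith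
        finally have "d * (l * (3 * \<eta>\<^sup>2 / 4)) \<le> D y * w l y"
          using Dy d l by (intro mult_mono) auto
        with True show ?thesis by simp
      next
        case False
        have "0 \<le> D y * w l y" using Dy d by (simp add: w_def)
        with False show ?thesis by simp
      qed
      then show ?thesis by (smt (verit) abs_ge_zero)
    next
      case False
      then have "2 * \<eta> \<le> norm (y - x0)" using eta by simp
      then have "(2 * \<eta>)\<^sup>2 \<le> (norm (y - x0))\<^sup>2" using eta by (intro power_mono) auto
      moreover have "\<eta>\<^sup>2 \<le> (2 * \<eta>)\<^sup>2" by (simp add: power_mult_distrib)
      ultimately have "0 \<le> (norm (y - x0))\<^sup>2 - \<eta>\<^sup>2" by linarith
      then have "w l y \<le> w 1 y" using mult_right_mono[OF l, of "(norm (y - x0))\<^sup>2 - \<eta>\<^sup>2"] unfolding w_def by simp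
      then have "\<bar>D y\<bar> * w l y \<le> \<bar>D y\<bar> * w 1 y" by (rule mult_left_mono) simp
      moreover have "\<bar>D y * w l' y\<bar> = \<bar>D y\<bar> * w l' y" for l' by (simp add: abs_mult w_def)
      ultimately have "- \<bar>D y * w 1 y\<bar> \<le> D y * w l y" by (smt (verit) abs_ge_minus_self)
      moreover have "y \<notin> B" using False eta by (simp add: B_def dist_norm norm_minus_commute)
      ultimately show ?thesis by simp
    qed
    have iB: "integrable lborel (\<lambda>y. d * (l * (3 * \<eta>\<^sup>2 / 4)) * indicator B y)"
      unfolding B_def using emeasure_lborel_ball_finite[of x0 "\<eta> / 2"]
      by (intro integrable_mult_right integrable_real_indicator) simp_all
    have "(LINT y|lborel. d * (l * (3 * \<eta>\<^sup>2 / 4)) * indicator B y - \<bar>D y * w 1 y\<bar>) \<le> (LINT y|lborel. D y * w l y)"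
      using l by (intro integral_mono Bochner_Integration.integrable_diff iB int1 w(1) pt) auto
    also have "\<dots> = 0" using l by (intro w(2)) auto
    finally have "(LINT y|lborel. d * (l * (3 * \<eta>\<^sup>2 / 4)) * indicator B y) \<le> (LINT y|lborel. \<bar>D y * w 1 y\<bar>)"
      using iB int1 by simp
    then show ?thesis by (simp add: V_def B_def)
  qed
  define c where "c = d * (3 * \<eta>\<^sup>2 / 4) * V"
  have c: "c > 0" using d eta V by (simp add: c_def)
  define I where "I = (LINT y|lborel. \<bar>D y * w 1 y\<bar>)"
  have I: "I \<ge> 0" unfolding I_def by simp
  \<comment> \<open>The choice l = 1 + I / c, which is at least 1, turns the left side into c + I,
    beyond the bound I.\<close>
  have "c * (1 + I / c) \<le> I"
    using key[of "1 + I / c"] I c by (simp add: c_def I_def mult_ac)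
  with c show False by (simp add: distrib_left)
qed

lemma distr_eq_imp_eq:
  fixes F1 F2 :: "(real ^ 'm::finite) \<times> real \<Rightarrow> real"
  assumes "continuous_on (- {0}) F1" "continuous_on (- {0}) F2"
    and "is_inv_fourier_symbol g F1" "is_inv_fourier_symbol g F2" and "x \<noteq> 0"
  shows "F1 x = F2 x"
proof (rule antisym)
  show "F1 x \<le> F2 x"
    by (rule distr_le_imp_le) (use assms in \<open>auto simp: is_inv_fourier_symbol_def\<close>)
  show "F2 x \<le> F1 x"
    by (rule distr_le_imp_le) (use assms in \<open>auto simp: is_inv_fourier_symbol_def\<close>)
qed

section \<open>The fundamental solution\<close>

lemma schwartz_bounded:
  assumes "schwartz f" "vs \<in> lists Basis"
  obtains C where "\<And>x. cmod (iter_partial vs f x) \<le> C"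
proof -
  obtain C where C: "\<And>x. norm x ^ 0 * cmod (iter_partial vs f x) \<le> C"
    using assms unfolding schwartz_def by meson
  show ?thesis by (rule that[of C]) (use C in simp)
qed

text \<open>Q = (A - B)^2 + 2 A B (1 + cos g) with cos g > -1. If A B vanishes, one of A and B is
  still positive, so the square is positive.\<close>

lemma Q_symbol_pos:
  fixes \<xi> :: "(real ^ 'm::finite) \<times> real"
  assumes g: "0 < g" "g < pi" and xi: "\<xi> \<noteq> 0"
  shows "Q_symbol g \<xi> > 0"
proof -
  define A B where "A = (norm (fst \<xi>))\<^sup>2" and "B = (snd \<xi>)\<^sup>2"
  have "(norm \<xi>)\<^sup>2 > 0" using xi by simp
  then have AB: "A \<ge> 0" "B \<ge> 0" "A + B > 0" by (simp_all add: A_def B_def norm_pair_square)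
  have c: "\<bar>cos g\<bar> < 1"
    using cos_monotone_0_pi[of 0 g] cos_monotone_0_pi[of g pi] g by auto
  have "A * B * (-1) \<le> A * B * cos g"
    using c AB by (intro mult_left_mono) auto
  moreover have "A * B * (-1) < A * B * cos g" if "A * B > 0"
    using that c by (intro mult_strict_left_mono) auto
  moreover have "(A - B)\<^sup>2 \<ge> 0" by simp
  moreover have "(A - B)\<^sup>2 > 0" if "A * B = 0"
    using that AB by (cases "A = 0") auto
  moreover have "A * B \<ge> 0" using AB by simp
  ultimately have "A\<^sup>2 + 2 * (A * B * cos g) + B\<^sup>2 > 0"
    unfolding power2_diff by (cases "A * B = 0") (auto simp: less_le)
  moreover have "Q_symbol g \<xi> = A\<^sup>2 + 2 * (A * B * cos g) + B\<^sup>2"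
    by (simp add: Q_symbol_def A_def B_def case_prod_unfold power_mult[symmetric] mult_ac)
  ultimately show ?thesis by simp
qed

lemma Q_symbol_le: "\<bar>Q_symbol g \<xi>\<bar> \<le> norm \<xi> ^ 4"
proof -
  define A B where "A = (norm (fst \<xi>))\<^sup>2" and "B = (snd \<xi>)\<^sup>2"
  have AB: "A * B \<ge> 0" by (simp add: A_def B_def)
  have "\<bar>A * B * cos g\<bar> \<le> A * B"
    unfolding abs_mult[of "A * B"] abs_of_nonneg[OF AB]
    by (rule mult_left_le) (use AB in simp_all)
  then have "\<bar>A\<^sup>2 + 2 * (A * B * cos g) + B\<^sup>2\<bar> \<le> A\<^sup>2 + 2 * (A * B) + B\<^sup>2"
    using zero_le_power2[of A] zero_le_power2[of B] by linarith
  also have "\<dots> = ((norm \<xi>)\<^sup>2)\<^sup>2"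
    unfolding norm_pair_square A_def B_def by (simp add: power2_eq_square algebra_simps)
  finally show ?thesis
    by (simp add: Q_symbol_def A_def B_def case_prod_unfold power_mult[symmetric] mult_ac)
qed

section \<open>The operator under the inverse transform\<close>

lemma inv_fourier_sum:
  fixes f :: "'i \<Rightarrow> 'a::euclidean_space \<Rightarrow> complex"
  assumes "\<And>i. i \<in> I \<Longrightarrow> integrable lborel (f i)"
  shows "inv_fourier (\<lambda>x. \<Sum>i\<in>I. f i x) \<xi> = (\<Sum>i\<in>I. inv_fourier (f i) \<xi>)"
  unfolding inv_fourier_def sum_distrib_left
  by (subst Bochner_Integration.integral_sum) (auto intro!: integrable_iexp_mult assms simp: sum_distrib_left)

lemma inv_fourier_add:
  assumes "integrable lborel f" "integrable lborel h"
  shows "inv_fourier (\<lambda>x. f x + h x) \<xi> = inv_fourier f \<xi> + inv_fourier h \<xi>"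
  using integrable_iexp_mult[OF assms(1), of \<xi>] integrable_iexp_mult[OF assms(2), of \<xi>]
  unfolding inv_fourier_def by (simp add: distrib_left)

lemma inv_fourier_cmult: "inv_fourier (\<lambda>x. c * f x) \<xi> = c * inv_fourier f \<xi>"
  unfolding inv_fourier_def by (simp add: mult.left_commute[of _ c])

lemma partial_deriv_sum:
  fixes h :: "'i \<Rightarrow> 'a::euclidean_space \<Rightarrow> complex"
  assumes "\<And>j x. j \<in> J \<Longrightarrow> h j differentiable (at x)"
  shows "partial_deriv v (\<lambda>x. \<Sum>j\<in>J. h j x) = (\<lambda>x. \<Sum>j\<in>J. partial_deriv v (h j) x)"
proof
  fix x
  have "((\<lambda>x. \<Sum>j\<in>J. h j x) has_derivative (\<lambda>d. \<Sum>j\<in>J. frechet_derivative (h j) (at x) d)) (at x)"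
    using assms frechet_derivative_works by (intro has_derivative_sum) blast
  from frechet_derivative_at[OF this, symmetric]
  show "partial_deriv v (\<lambda>x. \<Sum>j\<in>J. h j x) x = (\<Sum>j\<in>J. partial_deriv v (h j) x)"
    by (simp add: partial_deriv_def)
qed

text \<open>Smoothness lets the derivatives pass through the finite sums. The operator becomes a
  combination of iterated partial derivatives, to which the Schwartz estimates apply.\<close>

lemma L_op_iter_partial:
  fixes \<phi> :: "(real ^ 'm::finite) \<times> real \<Rightarrow> complex"
  assumes "smooth \<phi>"
  defines "e \<equiv> \<lambda>i. (axis i 1, 0) :: (real ^ 'm) \<times> real" and "d \<equiv> (0, 1) :: (real ^ 'm) \<times> real"
  shows "L_op g \<phi> = (\<lambda>x. (\<Sum>i\<in>UNIV. \<Sum>j\<in>UNIV. iter_partial [e i, e i, e j, e j] \<phi> x) +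
    (of_real (2 * cos g) * (\<Sum>i\<in>UNIV. iter_partial [e i, e i, d, d] \<phi> x) + iter_partial [d, d, d, d] \<phi> x))"
proof -
  have B: "e i \<in> Basis" "d \<in> Basis" for i
    by (simp_all add: e_def d_def Basis_prod_def Basis_vec_def axis_eq_axis)
  have diff: "iter_partial vs \<phi> differentiable (at x)" if "vs \<in> lists Basis" for vs x
    using assms(1) that unfolding smooth_def by blast
  have "laplace' \<phi> = (\<lambda>x. \<Sum>j\<in>UNIV. iter_partial [e j, e j] \<phi> x)"
    by (simp add: laplace'_def[abs_def] e_def)
  then have "laplace' (laplace' \<phi>) = (\<lambda>x. \<Sum>i\<in>UNIV. partial_deriv (e i) (partial_deriv (e i) (\<lambda>x. \<Sum>j\<in>UNIV. iter_partial [e j, e j] \<phi> x)) x)"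
    unfolding laplace'_def[of "laplace' \<phi>", abs_def] e_def by simp
  also have "\<dots> = (\<lambda>x. \<Sum>i\<in>UNIV. \<Sum>j\<in>UNIV. iter_partial [e i, e i, e j, e j] \<phi> x)"
  proof -
    have "partial_deriv (e i) (partial_deriv (e i) (\<lambda>x. \<Sum>j\<in>UNIV. iter_partial [e j, e j] \<phi> x)) =
        (\<lambda>x. \<Sum>j\<in>UNIV. iter_partial [e i, e i, e j, e j] \<phi> x)" for i
    proof -
      have "partial_deriv (e i) (\<lambda>x. \<Sum>j\<in>UNIV. iter_partial [e j, e j] \<phi> x) =
          (\<lambda>x. \<Sum>j\<in>UNIV. iter_partial [e i, e j, e j] \<phi> x)"
        unfolding iter_partial.simps(2)[of "e i"] by (rule partial_deriv_sum) (rule diff, simp add: B)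
      moreover have "partial_deriv (e i) (\<lambda>x. \<Sum>j\<in>UNIV. iter_partial [e i, e j, e j] \<phi> x) =
          (\<lambda>x. \<Sum>j\<in>UNIV. partial_deriv (e i) (iter_partial [e i, e j, e j] \<phi>) x)"
        by (rule partial_deriv_sum) (rule diff, simp add: B)
      ultimately show ?thesis
        by (simp only: iter_partial.simps(2))
    qed
    then show ?thesis by simp
  qed
  finally show ?thesis
    by (intro ext) (simp add: L_op_def laplace'_def[of "partial_deriv _ (partial_deriv _ \<phi>)"] d_last_def e_def d_def)
qed

text \<open>Every term has four derivatives, and the four factors -i multiply to 1, so the operator
  corresponds to \<open>Q_symbol\<close> without a sign. Integrability and boundedness qualify the
  image for the pairing formula.\<close>

lemma L_op_properties:
  fixes \<phi> :: "(real ^ 'm::finite) \<times> real \<Rightarrow> complex"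
  assumes \<phi>: "schwartz \<phi>"
  shows L_op_integrable: "integrable lborel (L_op g \<phi>)"
    and L_op_bounded: "\<exists>M. \<forall>x. cmod (L_op g \<phi> x) \<le> M"
    and inv_fourier_L_op: "inv_fourier (L_op g \<phi>) \<xi> = of_real (Q_symbol g \<xi>) * inv_fourier \<phi> \<xi>"
proof -
  define e where "e i = ((axis i 1, 0) :: (real ^ 'm) \<times> real)" for i
  define d where "d = ((0, 1) :: (real ^ 'm) \<times> real)"
  have B: "e i \<in> Basis" "d \<in> Basis" for i
    by (simp_all add: e_def d_def Basis_prod_def Basis_vec_def axis_eq_axis)
  define P where "P vs = iter_partial vs \<phi>" for vs
  have L: "L_op g \<phi> = (\<lambda>x. (\<Sum>i\<in>UNIV. \<Sum>j\<in>UNIV. P [e i, e i, e j, e j] x) +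
    (of_real (2 * cos g) * (\<Sum>i\<in>UNIV. P [e i, e i, d, d] x) + P [d, d, d, d] x))"
    using L_op_iter_partial[of \<phi> g] \<phi> unfolding P_def e_def d_def schwartz_def by blast
  have int: "integrable lborel (P vs)" if "vs \<in> lists Basis" for vs
    unfolding P_def by (rule schwartz_integrable[OF \<phi> that])
  have i1: "integrable lborel (P [e i, e i, e j, e j])" and i2: "integrable lborel (P [e i, e i, d, d])"
    and i3: "integrable lborel (P [d, d, d, d])" for i j
    by (intro int; simp add: B)+
  have i1': "integrable lborel (\<lambda>x. \<Sum>i\<in>UNIV. \<Sum>j\<in>UNIV. P [e i, e i, e j, e j] x)"
    and i2': "integrable lborel (\<lambda>x. \<Sum>i\<in>UNIV. P [e i, e i, d, d] x)"
    by (intro Bochner_Integration.integrable_sum i1 i2)+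
  show "integrable lborel (L_op g \<phi>)"
    unfolding L by (intro Bochner_Integration.integrable_add integrable_mult_right i1' i2' i3)
  show "\<exists>M. \<forall>x. cmod (L_op g \<phi> x) \<le> M"
  proof -
    have "\<exists>C. \<forall>x. cmod (P vs x) \<le> C" if "vs \<in> lists Basis" for vs
      using schwartz_bounded[OF \<phi> that] unfolding P_def by blast
    then obtain C where C: "\<And>vs x. vs \<in> lists Basis \<Longrightarrow> cmod (P vs x) \<le> C vs"
      by metis
    have "cmod (L_op g \<phi> x) \<le> (\<Sum>i\<in>UNIV. \<Sum>j\<in>UNIV. C [e i, e i, e j, e j]) +
        (\<bar>2 * cos g\<bar> * (\<Sum>i\<in>UNIV. C [e i, e i, d, d]) + C [d, d, d, d])" for x
      unfolding L
    proof (intro norm_triangle_le add_mono)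
      show "cmod (\<Sum>i\<in>UNIV. \<Sum>j\<in>UNIV. P [e i, e i, e j, e j] x) \<le> (\<Sum>i\<in>UNIV. \<Sum>j\<in>UNIV. C [e i, e i, e j, e j])"
        by (intro sum_norm_le C) (simp add: B)
      have "cmod (\<Sum>i\<in>UNIV. P [e i, e i, d, d] x) \<le> (\<Sum>i\<in>UNIV. C [e i, e i, d, d])"
        by (intro sum_norm_le C) (simp add: B)
      then show "cmod (of_real (2 * cos g) * (\<Sum>i\<in>UNIV. P [e i, e i, d, d] x)) \<le> \<bar>2 * cos g\<bar> * (\<Sum>i\<in>UNIV. C [e i, e i, d, d])"
        unfolding norm_mult norm_of_real by (rule mult_left_mono) simp
      show "cmod (P [d, d, d, d] x) \<le> C [d, d, d, d]"
        by (intro C) (simp add: B)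
    qed
    then show ?thesis by blast
  qed
  have F: "inv_fourier (P vs) \<xi> = (\<Prod>v\<leftarrow>vs. - \<i> * complex_of_real (\<xi> \<bullet> v)) * inv_fourier \<phi> \<xi>" if "vs \<in> lists Basis" for vs
    unfolding P_def by (rule inv_fourier_iter_partial[OF \<phi> that])
  have xe: "\<xi> \<bullet> e i = fst \<xi> $ i" and xd: "\<xi> \<bullet> d = snd \<xi>" for i
    by (simp_all add: e_def d_def inner_prod_def inner_axis)
  have F1: "inv_fourier (P [e i, e i, e j, e j]) \<xi> = of_real ((fst \<xi> $ i)\<^sup>2 * (fst \<xi> $ j)\<^sup>2) * inv_fourier \<phi> \<xi>"
    and F2: "inv_fourier (P [e i, e i, d, d]) \<xi> = of_real ((fst \<xi> $ i)\<^sup>2 * (snd \<xi>)\<^sup>2) * inv_fourier \<phi> \<xi>"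
    and F3: "inv_fourier (P [d, d, d, d]) \<xi> = of_real (snd \<xi> ^ 4) * inv_fourier \<phi> \<xi>" for i j
    by (subst F; simp add: B xe xd power2_eq_square power4_eq_xxxx mult_ac)+
  have nrm: "(\<Sum>i\<in>UNIV. (fst \<xi> $ i)\<^sup>2) = (norm (fst \<xi>))\<^sup>2"
    unfolding power2_norm_eq_inner inner_vec_def by (simp add: power2_eq_square)
  have "inv_fourier (L_op g \<phi>) \<xi> =
      (\<Sum>i\<in>UNIV. \<Sum>j\<in>UNIV. of_real ((fst \<xi> $ i)\<^sup>2 * (fst \<xi> $ j)\<^sup>2) * inv_fourier \<phi> \<xi>) +
      (of_real (2 * cos g) * (\<Sum>i\<in>UNIV. of_real ((fst \<xi> $ i)\<^sup>2 * (snd \<xi>)\<^sup>2) * inv_fourier \<phi> \<xi>) +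
       of_real (snd \<xi> ^ 4) * inv_fourier \<phi> \<xi>)"
  proof -
    have "inv_fourier (\<lambda>x. \<Sum>i\<in>UNIV. \<Sum>j\<in>UNIV. P [e i, e i, e j, e j] x) \<xi> =
        (\<Sum>i\<in>UNIV. inv_fourier (\<lambda>x. \<Sum>j\<in>UNIV. P [e i, e i, e j, e j] x) \<xi>)"
      by (intro inv_fourier_sum Bochner_Integration.integrable_sum i1)
    also have "\<dots> = (\<Sum>i\<in>UNIV. \<Sum>j\<in>UNIV. inv_fourier (P [e i, e i, e j, e j]) \<xi>)"
      by (intro sum.cong refl inv_fourier_sum i1)
    finally have s1: "inv_fourier (\<lambda>x. \<Sum>i\<in>UNIV. \<Sum>j\<in>UNIV. P [e i, e i, e j, e j] x) \<xi> = \<dots>" .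
    have s2: "inv_fourier (\<lambda>x. \<Sum>i\<in>UNIV. P [e i, e i, d, d] x) \<xi> = (\<Sum>i\<in>UNIV. inv_fourier (P [e i, e i, d, d]) \<xi>)"
      by (intro inv_fourier_sum i2)
    show ?thesis
      unfolding L inv_fourier_add[OF i1' Bochner_Integration.integrable_add[OF integrable_mult_right[OF i2'] i3]]
        inv_fourier_add[OF integrable_mult_right[OF i2'] i3] inv_fourier_cmult s1 s2 F1 F2 F3 ..
  qed
  also have "\<dots> = of_real ((\<Sum>i\<in>UNIV. (fst \<xi> $ i)\<^sup>2) * (\<Sum>i\<in>UNIV. (fst \<xi> $ i)\<^sup>2) +
      (2 * cos g * ((\<Sum>i\<in>UNIV. (fst \<xi> $ i)\<^sup>2) * (snd \<xi>)\<^sup>2) + snd \<xi> ^ 4)) * inv_fourier \<phi> \<xi>"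
  proof -
    let ?S = "\<Sum>i\<in>UNIV. (fst \<xi> $ i)\<^sup>2" and ?F = "inv_fourier \<phi> \<xi>"
    have "(\<Sum>i\<in>UNIV. \<Sum>j\<in>UNIV. of_real ((fst \<xi> $ i)\<^sup>2 * (fst \<xi> $ j)\<^sup>2) * ?F) = of_real (?S * ?S) * ?F"
      unfolding sum_product by (simp only: of_real_sum sum_distrib_right)
    moreover have "(\<Sum>i\<in>UNIV. of_real ((fst \<xi> $ i)\<^sup>2 * (snd \<xi>)\<^sup>2) * ?F) = of_real (?S * (snd \<xi>)\<^sup>2) * ?F"
      by (simp only: of_real_sum sum_distrib_right)
    ultimately show ?thesis
      by (simp only: of_real_add of_real_mult distrib_right mult.assoc)
  qed
  also have "\<dots> = of_real (Q_symbol g \<xi>) * inv_fourier \<phi> \<xi>"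
    unfolding nrm by (simp add: Q_symbol_def case_prod_unfold power2_eq_square power4_eq_xxxx mult_ac)
  finally show "inv_fourier (L_op g \<phi>) \<xi> = of_real (Q_symbol g \<xi>) * inv_fourier \<phi> \<xi>" .
qed

text \<open>Used with q = 1 for the transform itself and with q = \<open>Q_symbol g\<close> for the
  transform of \<open>L_op g \<phi>\<close>; the growth (1 + |\<xi>|^2)^2 is absorbed by two further
  powers of decay.\<close>

lemma integrable_weighted_inv_fourier:
  fixes f :: "'a::euclidean_space \<Rightarrow> complex" and q :: "'a \<Rightarrow> real"
  assumes f: "schwartz f" and q: "continuous_on UNIV q" "\<And>\<xi>. \<bar>q \<xi>\<bar> \<le> (1 + (norm \<xi>)\<^sup>2)\<^sup>2"
  shows "integrable lborel (\<lambda>\<xi>. complex_of_real (q \<xi>) * inv_fourier f \<xi>)"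
proof -
  obtain C where C: "C \<ge> 0" "\<And>\<xi>. cmod (inv_fourier f \<xi>) \<le> C / (1 + (norm \<xi>)\<^sup>2) ^ (DIM('a) + 2)"
    using inv_fourier_decay[OF f] by metis
  show ?thesis
  proof (rule Bochner_Integration.integrable_bound)
    show "integrable lborel (\<lambda>\<xi>::'a. C * (1 / (1 + (norm \<xi>)\<^sup>2) ^ DIM('a)))"
      by (intro integrable_mult_right integrable_weight) simp
    have "continuous_on UNIV (\<lambda>\<xi>. complex_of_real (q \<xi>) * inv_fourier f \<xi>)"
      using schwartz_integrable[OF f, of "[]"] by (intro continuous_intros q continuous_inv_fourier) simp
    then show "(\<lambda>\<xi>. complex_of_real (q \<xi>) * inv_fourier f \<xi>) \<in> borel_measurable lborel"
      by (rule continuous_imp_borel_measurable_lborel)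
    show "AE \<xi> in lborel. cmod (complex_of_real (q \<xi>) * inv_fourier f \<xi>) \<le> norm (C * (1 / (1 + (norm \<xi>)\<^sup>2) ^ DIM('a)))"
    proof (intro AE_I2)
      fix \<xi> :: 'a
      have p: "1 + (norm \<xi>)\<^sup>2 > 0" by (simp add: add_pos_nonneg)
      have "cmod (complex_of_real (q \<xi>) * inv_fourier f \<xi>) \<le>
          (1 + (norm \<xi>)\<^sup>2)\<^sup>2 * (C / (1 + (norm \<xi>)\<^sup>2) ^ (DIM('a) + 2))"
        unfolding norm_mult norm_of_real by (intro mult_mono q C) auto
      also have "\<dots> = C * (1 / (1 + (norm \<xi>)\<^sup>2) ^ DIM('a))"
        using p by (simp add: power_add power2_eq_square)
      finally show "cmod (complex_of_real (q \<xi>) * inv_fourier f \<xi>) \<le> norm (C * (1 / (1 + (norm \<xi>)\<^sup>2) ^ DIM('a)))"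
        unfolding real_norm_def using abs_ge_self order_trans by blast
    qed
  qed
qed

text \<open>One factor (2 pi)^(-n/2) comes from the normalisation of the symbol and one from the
  inverse transform; 1 / sin g undoes the constant of the superposition. The value at the pole
  follows the convention in \<open>fundamental_solution\<close>.\<close>

definition explicit_solution :: "real \<Rightarrow> (real ^ 'm::finite) \<times> real \<Rightarrow> real" where
  "explicit_solution g x = (if x = 0 then 0 else
     (2 * pi) powr (- real DIM((real ^ 'm) \<times> real)) / sin g * Re (kernel_integral (g / 2) x))"

section \<open>Existence and uniqueness for a fixed angle\<close>

context
  fixes g :: real
  assumes m: "CARD('m::finite) \<ge> 5" and g: "0 < g" "g < pi"
begin

text \<open>Stated for bounded integrable \<open>f\<close>, so as to cover indicators of compact
  sets, Schwartz functions and their images under \<open>L_op\<close>.\<close>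

lemma explicit_solution_distr:
  fixes f :: "(real ^ 'm) \<times> real \<Rightarrow> complex"
  assumes f: "integrable lborel f" and bdd: "\<And>x. cmod (f x) \<le> M"
  shows integrable_explicit_solution_mult: "integrable lborel (\<lambda>x. complex_of_real (explicit_solution g x) * f x)"
    and regular_distr_explicit_solution: "integrable lborel (inv_fourier f) \<Longrightarrow>
      regular_distr (explicit_solution g) f =
        complex_of_real ((2 * pi) powr (- real DIM((real ^ 'm) \<times> real) / 2)) *
        (LINT \<xi>|lborel. complex_of_real (1 / Q_symbol g \<xi>) * inv_fourier f \<xi>)"
proof -
  let ?n = "real DIM((real ^ 'm) \<times> real)"
  let ?c = "(2 * pi) powr (- ?n) / sin g"
  let ?k = "\<lambda>x. kernel_integral (g / 2) x * f x"
  have a: "0 < g / 2" "g / 2 < pi / 2" using g by auto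
  \<comment> \<open>The prescribed zero at the pole becomes an indicator, which differs from 1 on a
    null set.\<close>
  have eq: "complex_of_real (explicit_solution g x) * f x =
      of_real ?c * (indicator (- {0}) x *\<^sub>R ?k x)" for x
    using kernel_integral_real[OF m a, of x]
    by (cases "x = 0") (simp_all add: explicit_solution_def)
  have int: "integrable lborel ?k"
    by (rule integrable_kernel_integral_mult[OF m a f bdd])
  have int': "integrable lborel (\<lambda>x. indicator (- {0}) x *\<^sub>R ?k x)"
    by (rule integrable_mult_indicator[OF _ int]) simp
  then show "integrable lborel (\<lambda>x. complex_of_real (explicit_solution g x) * f x)"
    unfolding eq by (rule integrable_mult_right)
  assume ff: "integrable lborel (inv_fourier f)"
  have "(LINT x|lborel. indicator (- {0}) x *\<^sub>R ?k x) = (LINT x|lborel. ?k x)"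
  proof (rule integral_cong_AE)
    show "AE x in lborel. indicator (- {0}) x *\<^sub>R ?k x = ?k x"
      using AE_lborel_singleton[of 0] by eventually_elim simp
  qed (use int int' in auto)
  then have "regular_distr (explicit_solution g) f = of_real ?c * (LINT x|lborel. ?k x)"
    unfolding regular_distr_def eq by (simp only: integral_mult_right_zero)
  moreover have "?c = (2 * pi) powr (- ?n / 2) * ((2 * pi) powr (- ?n / 2) / sin g)"
    by (simp flip: powr_add)
  ultimately show "regular_distr (explicit_solution g) f =
        complex_of_real ((2 * pi) powr (- ?n / 2)) *
        (LINT \<xi>|lborel. complex_of_real (1 / Q_symbol g \<xi>) * inv_fourier f \<xi>)"
    unfolding integral_inverse_symbol[OF m g f bdd ff] by (simp only: of_real_mult mult.assoc)
qed

lemma explicit_solution_continuous: "continuous_on (- {0}) (explicit_solution g :: (real ^ 'm) \<times> real \<Rightarrow> real)"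
proof -
  have a: "0 < g / 2" "g / 2 < pi / 2" using g by auto
  have "continuous_on (- {0}) (\<lambda>x :: (real ^ 'm) \<times> real.
      (2 * pi) powr (- real DIM((real ^ 'm) \<times> real)) / sin g * Re (kernel_integral (g / 2) x))"
    by (intro continuous_intros kernel_integral_continuous[OF m a])
  then show ?thesis
    by (rule continuous_on_eq) (simp add: explicit_solution_def)
qed

lemma explicit_solution_inv_fourier:
  "is_inv_fourier_symbol g (explicit_solution g :: (real ^ 'm) \<times> real \<Rightarrow> real)"
  unfolding is_inv_fourier_symbol_def
proof (intro allI impI conjI)
  fix \<phi> :: "(real ^ 'm) \<times> real \<Rightarrow> complex" assume \<phi>: "schwartz \<phi>"
  have i: "integrable lborel \<phi>"
    using schwartz_integrable[OF \<phi>, of "[]"] by simp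
  obtain M where M: "\<And>x. cmod (\<phi> x) \<le> M"
    using schwartz_bounded[OF \<phi>, of "[]"] unfolding iter_partial.simps by blast
  show "integrable lborel (\<lambda>x. complex_of_real (explicit_solution g x) * \<phi> x)"
    by (rule integrable_explicit_solution_mult[OF i M])
  have "integrable lborel (inv_fourier \<phi>)"
    using integrable_weighted_inv_fourier[OF \<phi>, of "\<lambda>_. 1"] by (simp add: one_le_power)
  from regular_distr_explicit_solution[OF i M this]
  show "regular_distr (explicit_solution g) \<phi> =
      complex_of_real ((2 * pi) powr (- real DIM((real ^ 'm) \<times> real) / 2)) *
      inv_fourier_distr (regular_distr (\<lambda>\<xi>. 1 / Q_symbol g \<xi>)) \<phi>"
    by (simp only: inv_fourier_distr_def regular_distr_def)
qed

text \<open>The symbol cancels: pairing with \<open>L_op g \<phi>\<close> leaves a multiple of the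
  integral of the transform of \<phi>, and inversion at the origin returns
  \<open>\<phi> 0\<close>.\<close>

lemma explicit_solution_fundamental:
  "is_fundamental_solution g (explicit_solution g :: (real ^ 'm) \<times> real \<Rightarrow> real)"
  unfolding is_fundamental_solution_def
proof (intro conjI allI impI)
  show "locally_integrable (explicit_solution g :: (real ^ 'm) \<times> real \<Rightarrow> real)"
    unfolding locally_integrable_def
  proof (intro allI impI)
    fix K :: "((real ^ 'm) \<times> real) set" assume K: "compact K"
    \<comment> \<open>Local integrability is the pairing with the indicator of
      \<open>K\<close>.\<close>
    have "integrable lborel (\<lambda>x. complex_of_real (indicator K x))"
      using K emeasure_compact_finite[OF K]
      by (simp only: complex_of_real_integrable_eq) (auto intro!: integrable_real_indicator borel_compact)
    then have "integrable lborel (\<lambda>x. complex_of_real (explicit_solution g x) * complex_of_real (indicator K x))"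
      by (rule integrable_explicit_solution_mult[where M = 1]) (simp add: indicator_def)
    then have "integrable lborel (\<lambda>x. explicit_solution g x * indicator K x)"
      by (simp only: of_real_mult[symmetric] complex_of_real_integrable_eq)
    then show "set_integrable lborel K (explicit_solution g :: (real ^ 'm) \<times> real \<Rightarrow> real)"
      by (simp add: set_integrable_def mult.commute)
  qed
next
  let ?n = "real DIM((real ^ 'm) \<times> real)"
  fix \<phi> :: "(real ^ 'm) \<times> real \<Rightarrow> complex" assume "test_function \<phi>"
  then have \<phi>: "schwartz \<phi>" by (rule test_function_imp_schwartz)
  have i: "integrable lborel \<phi>"
    using schwartz_integrable[OF \<phi>, of "[]"] by simp
  obtain M where M: "\<And>x. cmod (L_op g \<phi> x) \<le> M"
    using L_op_bounded[OF \<phi>] by blast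
  obtain M' where M': "\<And>x. cmod (\<phi> x) \<le> M'"
    using schwartz_bounded[OF \<phi>, of "[]"] unfolding iter_partial.simps by blast
  have 1: "integrable lborel (inv_fourier \<phi>)"
    using integrable_weighted_inv_fourier[OF \<phi>, of "\<lambda>_. 1"] by (simp add: one_le_power)
  have 2: "integrable lborel (inv_fourier (L_op g \<phi>))"
    unfolding inv_fourier_L_op[OF \<phi>]
  proof (rule integrable_weighted_inv_fourier[OF \<phi>])
    show "continuous_on UNIV (Q_symbol g :: (real ^ 'm) \<times> real \<Rightarrow> real)"
      unfolding Q_symbol_def case_prod_unfold by (intro continuous_intros)
    show "\<bar>Q_symbol g \<xi>\<bar> \<le> (1 + (norm \<xi>)\<^sup>2)\<^sup>2" for \<xi> :: "(real ^ 'm) \<times> real"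
    proof -
      have "norm \<xi> ^ 4 = ((norm \<xi>)\<^sup>2)\<^sup>2" by (simp add: power_mult[symmetric])
      also have "\<dots> \<le> (1 + (norm \<xi>)\<^sup>2)\<^sup>2" by (rule power_mono) auto
      finally show ?thesis using Q_symbol_le[of g \<xi>] by linarith
    qed
  qed
  have "regular_distr (explicit_solution g) (L_op g \<phi>) =
      complex_of_real ((2 * pi) powr (- ?n / 2)) *
      (LINT \<xi>|lborel. complex_of_real (1 / Q_symbol g \<xi>) * inv_fourier (L_op g \<phi>) \<xi>)"
    by (rule regular_distr_explicit_solution[OF L_op_integrable[OF \<phi>] M 2])
  also have "(LINT \<xi>|lborel. complex_of_real (1 / Q_symbol g \<xi>) * inv_fourier (L_op g \<phi>) \<xi>) =
      (LINT \<xi>|lborel. inv_fourier \<phi> \<xi>)"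
  proof (rule integral_cong_AE)
    show "AE \<xi> in lborel. complex_of_real (1 / Q_symbol g \<xi>) * inv_fourier (L_op g \<phi>) \<xi> = inv_fourier \<phi> \<xi>"
      using AE_lborel_singleton[of 0]
    proof eventually_elim
      case (elim \<xi>)
      from Q_symbol_pos[OF g this] show ?case by (simp add: inv_fourier_L_op[OF \<phi>])
    qed
  qed (use borel_measurable_integrable[OF 1] borel_measurable_integrable[OF 2] in simp_all)
  also have "\<dots> = complex_of_real ((2 * pi) powr (?n / 2)) * \<phi> 0"
  proof (rule fourier_inversion_0[OF i _ M' 1])
    show "continuous_on UNIV \<phi>"
      using smooth_iter_partial_continuous[of \<phi> "[]"] \<phi> by (simp add: schwartz_def)
  qed
  also have "complex_of_real ((2 * pi) powr (- ?n / 2)) * (complex_of_real ((2 * pi) powr (?n / 2)) * \<phi> 0) = \<phi> 0"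
  proof -
    have "(2 * pi) powr (- ?n / 2) * (2 * pi) powr (?n / 2) = 1"
      unfolding powr_add[symmetric] minus_divide_left[symmetric] left_minus by simp
    then show ?thesis by (simp only: mult.assoc[symmetric] of_real_mult[symmetric]) simp
  qed
  finally show "regular_distr (explicit_solution g) (L_op g \<phi>) = \<phi> 0" .
qed

text \<open>Off the pole two continuous candidates with the same pairings agree by
  \<open>distr_eq_imp_eq\<close>; at the pole the normalisation decides.\<close>

lemma fundamental_solution_eq_explicit:
  "(fundamental_solution g :: (real ^ 'm) \<times> real \<Rightarrow> real) = explicit_solution g"
  unfolding fundamental_solution_def
proof (rule the_equality)
  show "is_fundamental_solution g (explicit_solution g :: (real ^ 'm) \<times> real \<Rightarrow> real) \<and>
    is_inv_fourier_symbol g (explicit_solution g :: (real ^ 'm) \<times> real \<Rightarrow> real) \<and>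
    continuous_on (- {0}) (explicit_solution g :: (real ^ 'm) \<times> real \<Rightarrow> real) \<and>
    explicit_solution g (0 :: (real ^ 'm) \<times> real) = 0"
    using explicit_solution_fundamental explicit_solution_inv_fourier explicit_solution_continuous
    by (simp add: explicit_solution_def)
next
  fix F :: "(real ^ 'm) \<times> real \<Rightarrow> real"
  assume F: "is_fundamental_solution g F \<and> is_inv_fourier_symbol g F \<and> continuous_on (- {0}) F \<and> F 0 = 0"
  show "F = explicit_solution g"
  proof
    fix x
    show "F x = explicit_solution g x"
    proof (cases "x = 0")
      case True
      with F show ?thesis by (simp add: explicit_solution_def)
    next
      case False
      with F show ?thesis
        using distr_eq_imp_eq[OF _ explicit_solution_continuous _ explicit_solution_inv_fourier] by blast
    qed
  qed
qed

end

theorem proposition3p3: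
  fixes n :: nat
  assumes "n \<ge> 6" and "CARD('m::finite) + 1 = n"
  shows "\<exists>\<gamma>. 0 < \<gamma> \<and> \<gamma> < pi \<and>
           (\<forall>t. t \<noteq> 0 \<longrightarrow> fundamental_solution \<gamma> ((0 :: real ^ 'm), t) < 0)"
proof -
  define p where "p = real CARD('m) - 2"
  \<comment> \<open>The sine is taken at p \<gamma> / 2 = 5 pi / 4, inside the interval (pi, 2 pi)
    where it is negative; p >= 3 gives \<gamma> <= 5 pi / 6.\<close>
  define \<gamma> where "\<gamma> = 5 * pi / (2 * p)"
  have m: "CARD('m) \<ge> 5" using assms by simp
  then have p: "p \<ge> 3" by (simp add: p_def)
  have g: "0 < \<gamma>" "\<gamma> < pi"
    using p pi_gt_zero by (simp_all add: \<gamma>_def divide_less_eq)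
  have a: "0 < \<gamma> / 2" "\<gamma> / 2 < pi / 2" using g by auto
  have eq: "p * (\<gamma> / 2) = pi + pi / 4" using p by (simp add: \<gamma>_def field_simps)
  have s: "sin (p * (\<gamma> / 2)) < 0"
    unfolding eq sin_add by (simp add: sin_45)
  have "fundamental_solution \<gamma> ((0 :: real ^ 'm), t) < 0" if t: "t \<noteq> 0" for t
  proof -
    obtain h where h: "h > 0" "Re (kernel_integral (\<gamma> / 2) (0 :: real ^ 'm, t)) = h * sin (p * (\<gamma> / 2))"
      using kernel_integral_axis[OF m a t] unfolding p_def by metis
    have "(2 * pi) powr (- real DIM((real ^ 'm) \<times> real)) / sin \<gamma> > 0"
      using sin_gt_zero[OF g] by simp
    moreover have "h * sin (p * (\<gamma> / 2)) < 0"
      using h(1) s by (rule mult_pos_neg)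
    ultimately have "(2 * pi) powr (- real DIM((real ^ 'm) \<times> real)) / sin \<gamma> * (h * sin (p * (\<gamma> / 2))) < 0"
      by (rule mult_pos_neg)
    moreover have "((0 :: real ^ 'm), t) \<noteq> 0"
      using t by (simp add: zero_prod_def)
    ultimately show ?thesis
      unfolding fundamental_solution_eq_explicit[OF m g] explicit_solution_def h(2) by (simp only: if_False)
  qed
  with g show ?thesis by blast
qed

end
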